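(* Let $s>5/2$. Let $S(u,v):=\langle R(u,v)v,u\rangle$ be the unnormalized sectional curvature on $H^sG$ associated with the 2CH equation (all objects as defined in the context). Then $$S(u,v)>0$$ for all vectors $u,v\in T_{(\mathrm{id},0)}H^sG\simeq H^s(S^1)\times H^{s-1}(S^1)$, $u\neq v$, of the form $$u=\begin{pmatrix}\cos k_1x\\ \cos k_2x\end{pmatrix},\qquad v=\begin{pmatrix}\cos l_1x\\ \cos l_2x\end{pmatrix},\qquad k_1,k_2,l_1,l_2\in\{2\pi,4\pi,\dots\}.$$ Moreover, the sectional curvature $\mathrm{Sec}(u,v)$ satisfies $$\mathrm{Sec}(u,v):=\frac{S(u,v)}{\langle u,u\rangle\langle v,v\rangle-\langle u,v\rangle^2}\geq\frac18$$ for all vectors $u,v\in T_{(\mathrm{id},0)}H^sG$, $u\neq v$, of the form $$u=\begin{pmatrix}0\\ \cos k_2x\end{pmatrix},\qquad v=\begin{pmatrix}0\\ \cos l_2x\end{pmatrix},\qquad k_2,l_2\in\{2\pi,4\pi,\dots\}.$$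
   Context: $S^1\simeq\mathbb{R}/\mathbb{Z}$ (length $1$). $H^s\mathrm{Diff}(S^1)$ is the Hilbert manifold of orientation-preserving diffeomorphisms of $S^1$ of Sobolev class $H^s$. $H^sG=H^s\mathrm{Diff}(S^1)\circledS H^{s-1}(S^1)$ is the set $H^s\mathrm{Diff}(S^1)\times H^{s-1}(S^1)$ with group product $(\varphi,f)(\psi,g)=(\varphi\circ\psi,\,g+f\circ\psi)$; it is a topological group and a smooth manifold modeled on $H^s(S^1)\times H^{s-1}(S^1)$. The map $\varphi\mapsto(\varphi(0),\varphi(x)-x-\varphi(0))$ identifies $H^s\mathrm{Diff}(S^1)$ with $S^1\times\{h\in H^s(S^1): h(0)=0,\ h_x>-1\}$, giving a natural smooth identification $TH^sG\simeq H^sG\times(H^s(S^1)\times H^{s-1}(S^1))$; vector fields on $H^sG$ are thereby regarded as maps $H^sG\to H^s(S^1)\times H^{s-1}(S^1)$, and $D$ denotes their derivative in this trivialization. Let $A=1-\partial_x^2$ (an isomorphism $H^r(S^1)\to H^{r-2}(S^1)$). The 2CH Christoffel map is $$\Gamma_{(\mathrm{id},0)}((u_1,u_2),(v_1,v_2))=\Bigl(\Gamma^0(u_1,v_1)-\tfrac12A^{-1}\partial_x(u_2v_2),\ -\tfrac12(u_{1x}v_2+v_{1x}u_2)\Bigr),\qquad \Gamma^0(u_1,v_1)=-A^{-1}\partial_x\bigl(u_1v_1+\tfrac12u_{1x}v_{1x}\bigr),$$ extended by right-invariance, $\Gamma_{(\varphi,f)}(X,Y)=\Gamma_{(\mathrm{id},0)}(X\circ\varphi^{-1},Y\circ\varphi^{-1})\circ\varphi$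 (composition acting on each component). It defines a smooth spray on $H^sG$, with covariant derivative $$(\nabla_XY)(\varphi,f)=DY(\varphi,f)\cdot X(\varphi,f)-\Gamma_{(\varphi,f)}(Y(\varphi,f),X(\varphi,f))$$ and curvature tensor $$R(X,Y)Z=\nabla_X\nabla_YZ-\nabla_Y\nabla_XZ-\nabla_{[X,Y]}Z.$$ The metric at the identity is $$\langle(u_1,u_2),(v_1,v_2)\rangle=\int_{S^1}(u_1v_1+u_{1x}v_{1x})\,dx+\int_{S^1}u_2v_2\,dx,$$ extended to $H^sG$ by $\langle X,Y\rangle_{(\varphi,f)}=\langle X\circ\varphi^{-1},Y\circ\varphi^{-1}\rangle$. In the claim, $\langle\cdot,\cdot\rangle$ and $R$ are evaluated at $(\mathrm{id},0)$. *)

theory Defs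
  imports "HOL-Analysis.Analysis" "HOL-Library.Function_Algebras"
begin

text \<open>
  Functions on the circle of length 1 are 1-periodic functions on the reals. Addition and
  subtraction of functions and of pairs of functions are pointwise (theory Function Algebras).
\<close>

type_synonym circle_pair = "(real \<Rightarrow> real) \<times> (real \<Rightarrow> real)"

section \<open>Sobolev spaces on the circle\<close>

definition fourier_coefficient :: "(real \<Rightarrow> real) \<Rightarrow> int \<Rightarrow> complex" where
  "fourier_coefficient f n =
     integral {0..1} (\<lambda>x. complex_of_real (f x) * cis (- (2 * pi * of_int n * x)))"

definition sobolev_weight :: "real \<Rightarrow> (real \<Rightarrow> real) \<Rightarrow> int \<Rightarrow> real" where
  "sobolev_weight r f n =
     (1 + (2 * pi * of_int n)\<^sup>2) powr r * (cmod (fourier_coefficient f n))\<^sup>2"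

text \<open>
  The following is the space of class \<open>r\<close> only for \<open>r > 1/2\<close>, where each element has a unique
  continuous representative; it is used below for \<open>r > 3/2\<close> only.
\<close>

definition sobolev :: "real \<Rightarrow> (real \<Rightarrow> real) set" where
  "sobolev r = {f. (\<forall>x. f (x + 1) = f x) \<and> continuous_on UNIV f \<and>
                   sobolev_weight r f summable_on UNIV}"

definition sobolev_norm :: "real \<Rightarrow> (real \<Rightarrow> real) \<Rightarrow> real" where
  "sobolev_norm r f = sqrt (infsum (sobolev_weight r f) UNIV)"

definition model_space :: "real \<Rightarrow> circle_pair set" where
  "model_space s = sobolev s \<times> sobolev (s - 1)"

definition model_norm :: "real \<Rightarrow> circle_pair \<Rightarrow> real" where
  "model_norm s U = sqrt ((sobolev_norm s (fst U))\<^sup>2 + (sobolev_norm (s - 1) (snd U))\<^sup>2)"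

section \<open>The group and the derivative of vector fields\<close>

text \<open>
  A circle diffeomorphism is represented by a lift \<open>\<phi>\<close> to the real line, i.e. \<open>\<phi>(x) = x + h(x)\<close>
  with \<open>h\<close> periodic and \<open>h' > -1\<close>. Lifts differing by an integer represent the same
  diffeomorphism, and the lifts provide the charts of the manifold: \<open>h\<close> ranges over an open
  subset of the Sobolev space. In these charts the trivialisation of the tangent bundle is the
  obvious one. All vector fields used below are invariant under integer translations of the lift.
\<close>

definition HsG :: "real \<Rightarrow> circle_pair set" where
  "HsG s = {(\<phi>, f). (\<lambda>x. \<phi> x - x) \<in> sobolev s \<and> (\<forall>x. deriv \<phi> x > 0) \<and> f \<in> sobolev (s - 1)}"

definition unit_G :: circle_pair where
  "unit_G = (id, \<lambda>x. 0)"

type_synonym vector_field = "circle_pair \<Rightarrow> circle_pair"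

definition scale_pair :: "real \<Rightarrow> circle_pair \<Rightarrow> circle_pair" where
  "scale_pair c U = ((\<lambda>x. c * fst U x), (\<lambda>x. c * snd U x))"

definition bounded_linear_on_model :: "real \<Rightarrow> (circle_pair \<Rightarrow> circle_pair) \<Rightarrow> bool" where
  "bounded_linear_on_model s L \<longleftrightarrow>
     (\<forall>U\<in>model_space s. L U \<in> model_space s) \<and>
     (\<forall>U\<in>model_space s. \<forall>V\<in>model_space s. L (U + V) = L U + L V) \<and>
     (\<forall>c. \<forall>U\<in>model_space s. L (scale_pair c U) = scale_pair c (L U)) \<and>
     (\<exists>K. \<forall>U\<in>model_space s. model_norm s (L U) \<le> K * model_norm s U)"

text \<open>
  Frechet differentiability on the open set \<open>HsG s\<close>. The smoothness index \<open>s\<close> is a variable, so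
  the Sobolev spaces are not types and the library notion of derivative does not apply. The
  membership in \<open>model_space s\<close> is stated explicitly because \<open>model_norm\<close> is meaningless outside.
\<close>

definition has_frechet_derivative_at ::
    "real \<Rightarrow> vector_field \<Rightarrow> (circle_pair \<Rightarrow> circle_pair) \<Rightarrow> circle_pair \<Rightarrow> bool" where
  "has_frechet_derivative_at s Y L p \<longleftrightarrow>
     bounded_linear_on_model s L \<and>
     (\<forall>\<epsilon>>0. \<exists>\<delta>>0. \<forall>h\<in>model_space s. p + h \<in> HsG s \<and> model_norm s h < \<delta> \<longrightarrow>
        Y (p + h) - Y p - L h \<in> model_space s \<and>
        model_norm s (Y (p + h) - Y p - L h) \<le> \<epsilon> * model_norm s h)"

definition field_derivative :: "real \<Rightarrow> vector_field \<Rightarrow> circle_pair \<Rightarrow> circle_pair \<Rightarrow> circle_pair" where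
  "field_derivative s Y p = (SOME L. has_frechet_derivative_at s Y L p)"

definition lie_bracket :: "real \<Rightarrow> vector_field \<Rightarrow> vector_field \<Rightarrow> vector_field" where
  "lie_bracket s X Y = (\<lambda>p. field_derivative s Y p (X p) - field_derivative s X p (Y p))"

section \<open>The Christoffel map and the metric\<close>

definition helmholtz :: "(real \<Rightarrow> real) \<Rightarrow> real \<Rightarrow> real" where
  "helmholtz f = (\<lambda>x. f x - deriv (deriv f) x)"

definition C2_circle :: "(real \<Rightarrow> real) set" where
  "C2_circle = {f. (\<forall>x. f (x + 1) = f x) \<and> (\<forall>x. f differentiable at x) \<and>
                   (\<forall>x. deriv f differentiable at x) \<and> continuous_on UNIV (deriv (deriv f))}"

text \<open>
  The inverse of \<open>1 - \<partial>\<^sub>x\<^sup>2\<close> is applied below only to continuous functions (elements of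
  Sobolev spaces of class \<open>s - 2 > 1/2\<close>). There the inverse between Sobolev spaces is the
  restriction of the inverse between \<open>C\<^sup>2\<close> and continuous periodic functions, whatever \<open>s\<close> is.
\<close>

definition helmholtz_inv :: "(real \<Rightarrow> real) \<Rightarrow> real \<Rightarrow> real" where
  "helmholtz_inv = the_inv_into C2_circle helmholtz"

definition christoffel0 :: "(real \<Rightarrow> real) \<Rightarrow> (real \<Rightarrow> real) \<Rightarrow> real \<Rightarrow> real" where
  "christoffel0 u v =
     - helmholtz_inv (deriv (\<lambda>x. u x * v x + 1/2 * (deriv u x * deriv v x)))"

fun christoffel_unit :: "circle_pair \<Rightarrow> circle_pair \<Rightarrow> circle_pair" where
  "christoffel_unit (u1, u2) (v1, v2) =
     ((\<lambda>x. christoffel0 u1 v1 x - 1/2 * helmholtz_inv (deriv (\<lambda>x. u2 x * v2 x)) x),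
      (\<lambda>x. - 1/2 * (deriv u1 x * v2 x + deriv v1 x * u2 x)))"

definition compose_pair :: "circle_pair \<Rightarrow> (real \<Rightarrow> real) \<Rightarrow> circle_pair" where
  "compose_pair U \<psi> = (fst U \<circ> \<psi>, snd U \<circ> \<psi>)"

definition christoffel :: "circle_pair \<Rightarrow> circle_pair \<Rightarrow> circle_pair \<Rightarrow> circle_pair" where
  "christoffel p U V =
     compose_pair
       (christoffel_unit (compose_pair U (inv (fst p))) (compose_pair V (inv (fst p)))) (fst p)"

fun metric_unit :: "circle_pair \<Rightarrow> circle_pair \<Rightarrow> real" where
  "metric_unit (u1, u2) (v1, v2) =
     integral {0..1} (\<lambda>x. u1 x * v1 x + deriv u1 x * deriv v1 x) +
     integral {0..1} (\<lambda>x. u2 x * v2 x)"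

definition metric :: "circle_pair \<Rightarrow> circle_pair \<Rightarrow> circle_pair \<Rightarrow> real" where
  "metric p U V = metric_unit (compose_pair U (inv (fst p))) (compose_pair V (inv (fst p)))"

section \<open>Covariant derivative and curvature\<close>

definition cov_deriv :: "real \<Rightarrow> vector_field \<Rightarrow> vector_field \<Rightarrow> vector_field" where
  "cov_deriv s X Y = (\<lambda>p. field_derivative s Y p (X p) - christoffel p (Y p) (X p))"

definition curvature ::
    "real \<Rightarrow> vector_field \<Rightarrow> vector_field \<Rightarrow> vector_field \<Rightarrow> vector_field" where
  "curvature s X Y Z = (\<lambda>p. cov_deriv s X (cov_deriv s Y Z) p - cov_deriv s Y (cov_deriv s X Z) p
                             - cov_deriv s (lie_bracket s X Y) Z p)"

text \<open>
  The curvature is a tensor, so its value on tangent vectors is obtained by extending them to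
  smooth vector fields in any way; the extension constant in the trivialisation is used.
\<close>

definition curvature_at ::
    "real \<Rightarrow> circle_pair \<Rightarrow> circle_pair \<Rightarrow> circle_pair \<Rightarrow> circle_pair \<Rightarrow> circle_pair" where
  "curvature_at s p u v w = curvature s (\<lambda>_. u) (\<lambda>_. v) (\<lambda>_. w) p"

definition unnormalized_sectional :: "real \<Rightarrow> circle_pair \<Rightarrow> circle_pair \<Rightarrow> real" where
  "unnormalized_sectional s u v = metric unit_G (curvature_at s unit_G u v v) u"

definition sectional :: "real \<Rightarrow> circle_pair \<Rightarrow> circle_pair \<Rightarrow> real" where
  "sectional s u v = unnormalized_sectional s u v /
     (metric unit_G u u * metric unit_G v v - (metric unit_G u v)\<^sup>2)"

definition wavenumbers :: "real set" where
  "wavenumbers = {2 * pi * real n | n. n \<ge> 1}"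

end

theory Submission
  imports Defs
begin

text \<open>
  Write a diffeomorphism near the identity as \<open>\<phi> = id + h\<close>. Since
  \<open>A\<inverse>\<partial>\<^sub>x = ((1 - \<partial>\<^sub>x)\<inverse> - (1 + \<partial>\<^sub>x)\<inverse>) / 2\<close>, conjugating this operator by \<open>\<phi>\<close> gives an
  explicit expression in \<open>exp (\<plusminus>h)\<close>, \<open>1 + h'\<close>, \<open>1 / (1 + h')\<close>, products and fixed Fourier
  multipliers. The Banach algebra property of the Sobolev spaces then shows that the Christoffel
  map is Frechet differentiable at the identity, without loss of derivatives, and computes its
  derivative.

  Integrating by parts, all terms of \<open>S(u,v)\<close> that involve this derivative combine to the Gauss type
  formula \<open>S(u,v) = \<langle>\<Gamma>(u,v), \<Gamma>(u,v)\<rangle> - \<langle>\<Gamma>(u,u), \<Gamma>(v,v)\<rangle>\<close>. The second components contribute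
  \<open>1/4 \<integral> (u\<^sub>1' v\<^sub>2 - v\<^sub>1' u\<^sub>2)\<^sup>2 \<ge> 0\<close>. The first ones are \<open>-A\<inverse>\<partial>\<^sub>x\<close> applied to cosine polynomials, hence
  a quadratic form in their coefficients, diagonal up to coinciding frequencies. If \<open>k\<^sub>1 \<noteq> l\<^sub>1\<close>, the
  frequency \<open>k\<^sub>1 - l\<^sub>1\<close> makes it positive; if \<open>k\<^sub>1 = l\<^sub>1\<close>, it is at least \<open>- k\<^sub>1\<^sup>2 / 16\<close> and the second
  components contribute at least \<open>3 k\<^sub>1\<^sup>2 / 32\<close>.
\<close>

text \<open>\<open>field_derivative\<close> is a \<open>SOME\<close> choice, so a computed
  derivative says nothing about the curvature until derivatives are known to be unique on
  \<open>model_space s\<close>. This holds because every point of \<open>HsG s\<close> can be moved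
  a little along every ray. Extending tangent vectors by constant fields turns the inner covariant
  derivative into minus the Christoffel map, whose derivative at the identity is the main analytic
  input. The map does not depend on the second component of the point, so only a variation
  \<open>h\<close> of \<open>\<phi>\<close> occurs. The obstacle is that differentiating
  \<open>X \<circ> inv \<phi>\<close> in \<open>\<phi>\<close> costs a derivative of
  \<open>X\<close>. In the conjugated form the vectors enter as fixed coefficients
  \<open>\<alpha>\<close>, \<open>\<beta>\<close> of class \<open>s - 1\<close>, and
  \<open>\<phi>\<close> only through multiplication by functions of \<open>h\<close> and
  \<open>deriv h\<close>; \<open>solve\<close> then gains one derivative. As \<open>s\<close> is an
  arbitrary real, Sobolev norms are estimated on weighted Fourier coefficients over finite index
  sets. The threshold \<open>5/2\<close> makes \<open>deriv (fst U)\<close> and \<open>snd U\<close>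
  continuously differentiable, so that the derivatives under \<open>helmholtz_inv\<close> are
  classical.\<close>

abbreviation fcoeff :: "(real \<Rightarrow> real) \<Rightarrow> int \<Rightarrow> complex" where
  "fcoeff \<equiv> fourier_coefficient"

abbreviation snorm :: "real \<Rightarrow> (real \<Rightarrow> real) \<Rightarrow> real" where
  "snorm \<equiv> sobolev_norm"

section \<open>Fourier exponentials on the circle of length 1\<close>

definition fexp :: "int \<Rightarrow> real \<Rightarrow> complex" where
  "fexp n x = cis (2 * pi * of_int n * x)"

lemma norm_fexp [simp]: "cmod (fexp n x) = 1"
  by (simp add: fexp_def)

text \<open>Symbol of \<open>1 - d^2/dx^2\<close> at the frequency \<open>n\<close>.\<close>

definition wt :: "int \<Rightarrow> real" where
  "wt n = 1 + (2 * pi * of_int n)\<^sup>2"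

abbreviation (input) I01 :: "(real \<Rightarrow> 'a::real_normed_vector) \<Rightarrow> 'a" where
  "I01 \<equiv> integral {0..1}"

lemma fexp_0 [simp]: "fexp 0 x = 1"
  by (simp add: fexp_def)

lemma fexp_add: "fexp (m + n) x = fexp m x * fexp n x"
  by (simp add: fexp_def cis_mult algebra_simps)

lemma fexp_uminus: "fexp (- n) x = cnj (fexp n x)"
  by (simp add: fexp_def cis_cnj)

lemma cis_int_mult: "cis (2 * pi * of_int n) = 1"
  by (simp add: complex_eq_iff)

lemma fexp_periodic: "fexp n (x + 1) = fexp n x"
proof -
  have "fexp n (x + 1) = fexp n x * cis (2 * pi * of_int n)"
    by (simp add: fexp_def cis_mult algebra_simps)
  then show ?thesis by (simp only: cis_int_mult mult_1_right)
qed

lemma continuous_on_fexp [continuous_intros]: "continuous_on S (fexp n)"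
  unfolding fexp_def by (intro continuous_intros)

lemma fcoeff_fexp:
  "fcoeff f n = I01 (\<lambda>x. of_real (f x) * fexp (- n) x)"
  by (simp add: fourier_coefficient_def fexp_def)

lemma fexp_has_vector_derivative:
  "(fexp n has_vector_derivative (\<i> * of_real (2 * pi * of_int n) * fexp n x)) (at x within S)"
  unfolding fexp_def cis_conv_exp
  by (auto intro!: derivative_eq_intros has_vector_derivative_real_field simp: algebra_simps)

lemma fexp_has_integral:
  "((\<lambda>x. \<i> * of_real (2 * pi * of_int n) * fexp n x) has_integral (fexp n b - fexp n a)) {a..b}"
  if "a \<le> b"
  using fundamental_theorem_of_calculus[OF that fexp_has_vector_derivative[of n]] by simp

lemma integral_fexp: "I01 (fexp n) = (if n = 0 then 1 else 0)"
proof (cases "n = 0")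
  case False
  have "((\<lambda>x. \<i> * of_real (2 * pi * of_int n) * fexp n x) has_integral 0) {0..1}"
    using fexp_has_integral[of 0 1 n] fexp_periodic[of n 0] by simp
  then have "((\<lambda>x. (1 / (\<i> * of_real (2 * pi * of_int n)))
        * (\<i> * of_real (2 * pi * of_int n) * fexp n x)) has_integral
        (1 / (\<i> * of_real (2 * pi * of_int n))) * 0) {0..1}"
    by (rule has_integral_mult_right)
  moreover have "(\<lambda>x. (1 / (\<i> * of_real (2 * pi * of_int n)))
        * (\<i> * of_real (2 * pi * of_int n) * fexp n x)) = fexp n"
    using False by (auto simp: field_simps)
  ultimately have "(fexp n has_integral 0) {0..1}" by (simp only: mult_zero_right)
  then show ?thesis using False by (simp add: integral_unique)
qed (simp add: fexp_def[abs_def])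

section \<open>Completeness of the trigonometric system\<close>

lemma periodic_add_int:
  fixes f :: "real \<Rightarrow> 'a"
  assumes "\<And>x. f (x + 1) = f x"
  shows "f (x + of_int n) = f x"
proof (induction n rule: int_induct[where k = 0])
  case (step1 i) then show ?case using assms[of "x + of_int i"] by (simp add: algebra_simps)
next
  case (step2 i) then show ?case using assms[of "x + of_int i - 1"] by (simp add: algebra_simps)
qed simp

text \<open>Moves a periodic function to the unit circle, where polynomial approximation is
  available. \<open>Arg\<close> jumps on the negative real axis; there \<open>Arg2pi\<close> is
  continuous and gives the same value, since two arguments of one point differ by a multiple of
  \<open>2 * pi\<close>, which a 1-periodic function does not see.\<close>

lemma continuous_on_circle:
  fixes f :: "real \<Rightarrow> real"
  assumes cont: "continuous_on UNIV f" and per: "\<And>x. f (x + 1) = f x"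
  shows "continuous_on (sphere 0 1) (\<lambda>z. f (Arg z / (2 * pi)))"
    and "f (Arg (cis (2 * pi * x)) / (2 * pi)) = f x"
proof -
  have eq: "f (a / (2 * pi)) = f (b / (2 * pi))" if "cis a = cis b" for a b
  proof -
    obtain n :: int where "a = b + 2 * pi * n"
    proof -
      have "sin a = sin b \<and> cos a = cos b"
        using \<open>cis a = cis b\<close> by (metis cis.sel)
      then show ?thesis using that sin_cos_eq_iff[of a b] by metis
    qed
    then have "a / (2 * pi) = b / (2 * pi) + of_int n" by (simp add: field_simps)
    then show ?thesis using periodic_add_int[of f, OF per] by simp
  qed
  have fc: "isCont f x" for x using cont by (simp add: continuous_on_eq_continuous_at)
  have sph: "cis (Arg z) = z" if "norm z = 1" for z
    using that cis_Arg[of z] by (metis norm_zero sgn_eq scaleR_one inverse_1 zero_neq_one sgn_div_norm)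
  show "f (Arg (cis (2 * pi * x)) / (2 * pi)) = f x"
    using eq[of "Arg (cis (2 * pi * x))" "2 * pi * x"] sph[of "cis (2 * pi * x)"] by simp
  have "continuous (at z within sphere 0 1) (\<lambda>z. f (Arg z / (2 * pi)))" if z: "norm z = 1" for z
  proof (cases "z \<in> \<real>\<^sub>\<le>\<^sub>0")
    case False
    then have "continuous (at z) (\<lambda>z. f (Arg z / (2 * pi)))"
      by (intro continuous_at_compose[OF _ fc, unfolded o_def] continuous_intros continuous_at_Arg) auto
    then show ?thesis by (rule continuous_at_imp_continuous_at_within)
  next
    case True
    then have "z \<notin> \<real>\<^sub>\<ge>\<^sub>0" using z by (auto elim!: nonpos_Reals_cases nonneg_Reals_cases)
    then have "continuous (at z) (\<lambda>z. f (Arg2pi z / (2 * pi)))"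
      by (intro continuous_at_compose[OF _ fc, unfolded o_def] continuous_intros continuous_at_Arg2pi) auto
    then have c: "continuous (at z within sphere 0 1) (\<lambda>z. f (Arg2pi z / (2 * pi)))"
      by (rule continuous_at_imp_continuous_at_within)
    have e: "f (Arg2pi w / (2 * pi)) = f (Arg w / (2 * pi))" if "norm w = 1" for w
    proof (rule eq)
      show "cis (Arg2pi w) = cis (Arg w)"
        using sph[OF that] Arg2pi_eq[of w] that by (simp add: cis_conv_exp)
    qed
    have "\<forall>\<^sub>F w in at z within sphere 0 1. f (Arg2pi w / (2 * pi)) = f (Arg w / (2 * pi))"
      using e by (auto simp: eventually_at_filter)
    from tendsto_cong[OF this] c show ?thesis
      unfolding continuous_within e[OF z] by simp
  qed
  then show "continuous_on (sphere 0 1) (\<lambda>z. f (Arg z / (2 * pi)))"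
    by (auto simp: continuous_on_eq_continuous_within)
qed

text \<open>
  This class is stable under multiplication by exponentials, hence by trigonometric polynomials,
  so Stone--Weierstrass on the unit circle makes a member of it orthogonal to itself.
\<close>

definition null_coeffs :: "(real \<Rightarrow> complex) set" where
  "null_coeffs = {k. continuous_on {0..1} k \<and> (\<forall>n. I01 (\<lambda>x. k x * fexp n x) = 0)}"

lemma null_coeffs_integrable:
  assumes "k \<in> null_coeffs"
  shows "(\<lambda>x. k x * fexp n x) integrable_on {0..1}"
  using assms unfolding null_coeffs_def
  by (intro integrable_continuous_real continuous_intros) auto

lemma null_coeffs_add:
  assumes "k \<in> null_coeffs" "l \<in> null_coeffs"
  shows "(\<lambda>x. k x + l x) \<in> null_coeffs"
  using assms null_coeffs_integrable[OF assms(1)] null_coeffs_integrable[OF assms(2)]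
  unfolding null_coeffs_def
  by (auto intro!: continuous_intros simp: distrib_right integral_add)

lemma null_coeffs_cmult:
  assumes "k \<in> null_coeffs"
  shows "(\<lambda>x. c * k x) \<in> null_coeffs"
  using assms unfolding null_coeffs_def
  by (auto intro!: continuous_intros simp: mult.assoc)

lemma null_coeffs_fexp:
  assumes "k \<in> null_coeffs"
  shows "(\<lambda>x. k x * fexp m x) \<in> null_coeffs"
proof -
  have "(\<lambda>x. k x * fexp m x * fexp n x) = (\<lambda>x. k x * fexp (m + n) x)" for n
    by (subst fexp_add) (rule ext, rule mult.assoc)
  moreover have "I01 (\<lambda>x. k x * fexp (m + n) x) = 0" for n
    using assms unfolding null_coeffs_def by blast
  ultimately have "I01 (\<lambda>x. k x * fexp m x * fexp n x) = 0" for n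
    by metis
  moreover have "continuous_on {0..1} (\<lambda>x. k x * fexp m x)"
    using assms unfolding null_coeffs_def by (auto intro!: continuous_intros)
  ultimately show ?thesis unfolding null_coeffs_def by blast
qed

text \<open>On the circle a linear functional is a combination of \<open>fexp 1\<close> and
  \<open>fexp (-1)\<close>, under which the class is stable. \<open>k\<close> has to vary in the
  induction: for a product the second factor is applied to the result of the first.\<close>

lemma null_coeffs_polynomial:
  fixes p :: "complex \<Rightarrow> real"
  assumes "real_polynomial_function p" "k \<in> null_coeffs"
  shows "(\<lambda>x. k x * of_real (p (cis (2 * pi * x)))) \<in> null_coeffs"
  using assms
proof (induction arbitrary: k rule: real_polynomial_function.induct)
  case (linear f)
  have f: "f (cis t) = cos t * f 1 + sin t * f \<i>" for t
  proof -
    interpret bounded_linear f by fact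
    have "cis t = cos t *\<^sub>R 1 + sin t *\<^sub>R \<i>" by (simp add: complex_eq_iff)
    then show ?thesis by (simp add: add scaleR)
  qed
  have c: "complex_of_real (cos (2 * pi * x)) = (fexp 1 x + fexp (-1) x) / 2"
    and s: "complex_of_real (sin (2 * pi * x)) = (fexp 1 x - fexp (-1) x) / (2 * \<i>)" for x
    by (auto simp: fexp_def complex_eq_iff Re_divide Im_divide)
  have "(\<lambda>x. (of_real (f 1) / 2 + of_real (f \<i>) / (2 * \<i>)) * (k x * fexp 1 x) +
             (of_real (f 1) / 2 - of_real (f \<i>) / (2 * \<i>)) * (k x * fexp (-1) x)) \<in> null_coeffs"
    by (intro null_coeffs_add null_coeffs_cmult null_coeffs_fexp linear.prems)
  moreover have "(\<lambda>x. (of_real (f 1) / 2 + of_real (f \<i>) / (2 * \<i>)) * (k x * fexp 1 x) +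
             (of_real (f 1) / 2 - of_real (f \<i>) / (2 * \<i>)) * (k x * fexp (-1) x))
     = (\<lambda>x. k x * of_real (f (cis (2 * pi * x))))"
    by (simp only: f of_real_add of_real_mult c s) (simp add: field_simps fun_eq_iff)
  ultimately show ?case by simp
next
  case (const c)
  then show ?case using null_coeffs_cmult[of k "of_real c"] by (simp add: mult.commute)
next
  case (add f g)
  then show ?case using null_coeffs_add[OF add.IH(1)[OF add.prems] add.IH(2)[OF add.prems]]
    by (simp add: distrib_left)
next
  case (mult f g)
  then show ?case using mult.IH(2)[OF mult.IH(1)[OF mult.prems]]
    by (simp add: mult.assoc)
qed

text \<open>The real part \<open>f\<close> is orthogonal to every polynomial \<open>p\<close> on the
  circle, so the integral of \<open>f * f\<close> equals that of \<open>f * (f - p)\<close>. A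
  uniform approximation by \<open>p\<close> makes the latter arbitrarily small.\<close>

lemma fourier_unique_aux:
  assumes k: "k \<in> null_coeffs" and cont: "continuous_on UNIV k" and per: "\<And>x. k (x + 1) = k x"
  shows "Re (k x) = 0"
proof -
  let ?f = "\<lambda>x. Re (k x)"
  have cf: "continuous_on UNIV ?f" by (intro continuous_intros cont)
  have cfS: "continuous_on S k" for S using cont continuous_on_subset by blast
  have pf: "?f (x + 1) = ?f x" for x by (simp add: per)
  have orth: "I01 (\<lambda>x. ?f x * p (cis (2 * pi * x))) = 0"
    if "real_polynomial_function p" for p
  proof -
    have kp: "(\<lambda>x. k x * of_real (p (cis (2 * pi * x)))) \<in> null_coeffs"
      by (rule null_coeffs_polynomial[OF that k])
    then have i: "(\<lambda>x. k x * of_real (p (cis (2 * pi * x)))) integrable_on {0..1}"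
      and "I01 (\<lambda>x. k x * of_real (p (cis (2 * pi * x)))) = 0"
      using null_coeffs_integrable[OF kp, of 0] unfolding null_coeffs_def
      by (auto dest: spec[of _ 0])
    then show ?thesis
      using integral_linear[OF i bounded_linear_Re] by (simp add: o_def)
  qed
  define I where "I = I01 (\<lambda>x. \<bar>?f x\<bar>)"
  have "I \<ge> 0" unfolding I_def
    by (intro integral_nonneg integrable_continuous_real continuous_intros cfS) auto
  have le: "I01 (\<lambda>x. ?f x * ?f x) \<le> e * I" if e0: "e > 0" for e
  proof -
    obtain p where p: "real_polynomial_function p"
      and ap: "\<And>z. z \<in> sphere 0 1 \<Longrightarrow> \<bar>?f (Arg z / (2 * pi)) - p z\<bar> < e"
      by (rule Stone_Weierstrass_real_polynomial_function[OF compact_sphere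
            continuous_on_circle(1)[OF cf, OF pf] e0]) blast
    have ap': "\<bar>?f x - p (cis (2 * pi * x))\<bar> < e" for x
    proof -
      have "cis (2 * pi * x) \<in> sphere 0 1" by simp
      from ap[OF this] show ?thesis by (simp only: continuous_on_circle(2)[OF cf, OF pf])
    qed
    have cp: "continuous_on S (\<lambda>x. p (cis (2 * pi * x)))" for S
    proof -
      have "continuous_on UNIV p"
        by (rule continuous_on_polymonial_function) (use p in \<open>simp only: real_polynomial_function_eq\<close>)
      then show ?thesis by (rule continuous_on_compose2) (intro continuous_intros, simp)
    qed
    have "I01 (\<lambda>x. ?f x * ?f x) =
        I01 (\<lambda>x. ?f x * ?f x) - I01 (\<lambda>x. ?f x * p (cis (2 * pi * x)))"
      using orth[OF p] by simp
    also have "\<dots> = I01 (\<lambda>x. ?f x * ?f x - ?f x * p (cis (2 * pi * x)))"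
      by (intro integral_diff[symmetric] integrable_continuous_real continuous_intros cfS cp)
    also have "\<dots> \<le> I01 (\<lambda>x. e * \<bar>?f x\<bar>)"
    proof (intro integral_le integrable_continuous_real continuous_intros cfS cp)
      fix x
      have "?f x * ?f x - ?f x * p (cis (2 * pi * x)) \<le> \<bar>?f x\<bar> * \<bar>?f x - p (cis (2 * pi * x))\<bar>"
        by (metis abs_mult abs_ge_self right_diff_distrib)
      also have "\<dots> \<le> \<bar>?f x\<bar> * e" using ap'[of x] by (intro mult_left_mono) auto
      finally show "?f x * ?f x - ?f x * p (cis (2 * pi * x)) \<le> e * \<bar>?f x\<bar>" by (simp add: mult.commute)
    qed
    also have "\<dots> = e * I" by (simp add: I_def)
    finally show ?thesis .
  qed
  have "I01 (\<lambda>x. ?f x * ?f x) \<le> 0"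
  proof (rule field_le_epsilon)
    fix e :: real assume "e > 0"
    then have "I01 (\<lambda>x. ?f x * ?f x) \<le> e / (I + 1) * I"
      using le[of "e / (I + 1)"] \<open>I \<ge> 0\<close> by simp
    also have "\<dots> \<le> e" using \<open>I \<ge> 0\<close> \<open>e > 0\<close> by (simp add: field_simps)
    finally show "I01 (\<lambda>x. ?f x * ?f x) \<le> 0 + e" by simp
  qed
  moreover have "I01 (\<lambda>x. ?f x * ?f x) \<ge> 0"
    by (intro integral_nonneg integrable_continuous_real continuous_intros cfS) auto
  ultimately have "I01 (\<lambda>x. ?f x * ?f x) = 0" by simp
  moreover have "continuous_on {0..1} (\<lambda>x. ?f x * ?f x)"
    by (intro continuous_intros cfS)
  ultimately have "\<forall>x\<in>{0..1}. ?f x * ?f x = 0"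
    by (subst (asm) integral_eq_0_iff) auto
  then have z: "?f x = 0" if "x \<in> {0..1}" for x
    using that by auto
  have "?f x = ?f (frac x)"
    using periodic_add_int[of ?f "frac x" "\<lfloor>x\<rfloor>", OF pf] by (simp add: frac_def)
  also have "\<dots> = 0" by (rule z) (use frac_lt_1[of x] in auto)
  finally show ?thesis .
qed

lemma fourier_unique:
  fixes k :: "real \<Rightarrow> complex"
  assumes cont: "continuous_on UNIV k" and per: "\<And>x. k (x + 1) = k x"
    and "\<And>n. I01 (\<lambda>x. k x * fexp n x) = 0"
  shows "k x = 0"
proof -
  have k: "k \<in> null_coeffs"
    using assms continuous_on_subset unfolding null_coeffs_def by blast
  \<comment> \<open>Multiplication by \<open>- \<i>\<close> turns the imaginary part into a real
    part and stays inside the class.\<close>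
  have "Re (- \<i> * k x) = 0"
    by (rule fourier_unique_aux[OF null_coeffs_cmult[OF k]]) (auto intro!: continuous_intros cont simp: per)
  then show ?thesis using fourier_unique_aux[OF k cont per, of x] by (simp add: complex_eq_iff)
qed

section \<open>Absolutely convergent Fourier series\<close>

abbreviation summable_coeffs :: "(int \<Rightarrow> complex) \<Rightarrow> bool" where
  "summable_coeffs a \<equiv> (\<lambda>n. cmod (a n)) summable_on UNIV"

definition fseries :: "(int \<Rightarrow> complex) \<Rightarrow> real \<Rightarrow> complex" where
  "fseries a x = (\<Sum>\<^sub>\<infinity>n. a n * fexp n x)"

lemma fseries_uniform_limit:
  assumes "summable_coeffs a"
  shows "uniform_limit S (\<lambda>X x. \<Sum>n\<in>X. a n * fexp n x) (fseries a) (finite_subsets_at_top UNIV)"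
  unfolding fseries_def
  by (rule Weierstrass_m_test_general[where M = "\<lambda>n. cmod (a n)"])
     (use assms in \<open>auto simp: norm_mult\<close>)

lemma continuous_on_fseries:
  assumes "summable_coeffs a"
  shows "continuous_on S (fseries a)"
  by (rule uniform_limit_theorem[OF _ fseries_uniform_limit[OF assms]])
     (auto intro!: always_eventually continuous_intros)

lemma fseries_periodic: "fseries a (x + 1) = fseries a x"
  unfolding fseries_def by (simp only: fexp_periodic)

text \<open>Uniform convergence allows termwise integration. The interval and the factor
  \<open>\<psi>\<close> stay free because of three different uses: \<open>fexp m\<close> recovers
  coefficients, \<open>g * fexp (- n)\<close> gives the convolution formula, and the constant 1 on
  \<open>{c..d}\<close> gives the fundamental theorem in \<open>sobolev_deriv\<close>.\<close>

lemma has_sum_integral_fseries: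
  fixes \<psi> :: "real \<Rightarrow> complex"
  assumes a: "summable_coeffs a" and \<psi>: "continuous_on {c..d} \<psi>"
  shows "((\<lambda>n. a n * integral {c..d} (\<lambda>x. fexp n x * \<psi> x)) has_sum
          integral {c..d} (\<lambda>x. fseries a x * \<psi> x)) UNIV"
proof -
  let ?T = "\<lambda>X x. (\<Sum>n\<in>X. a n * fexp n x) * \<psi> x"
  have "uniform_limit {c..d} ?T (\<lambda>x. fseries a x * \<psi> x) (finite_subsets_at_top UNIV)"
    by (intro uniform_lim_mult fseries_uniform_limit a uniform_limit_const
        compact_imp_bounded compact_continuous_image continuous_on_fseries \<psi> compact_Icc)
  then obtain I J where I: "\<And>X. (?T X has_integral I X) {c..d}"
    and J: "((\<lambda>x. fseries a x * \<psi> x) has_integral J) {c..d}"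
    and lim: "(I \<longlongrightarrow> J) (finite_subsets_at_top UNIV)"
    by (rule uniform_limit_integral) (auto intro!: continuous_intros \<psi>)
  have i: "(\<lambda>x. fexp n x * \<psi> x) integrable_on {c..d}" for n
    by (intro integrable_continuous_real continuous_intros \<psi>)
  have "I X = (\<Sum>n\<in>X. a n * integral {c..d} (\<lambda>x. fexp n x * \<psi> x))" if "finite X" for X
  proof -
    have "((\<lambda>x. \<Sum>n\<in>X. a n * (fexp n x * \<psi> x)) has_integral
        (\<Sum>n\<in>X. a n * integral {c..d} (\<lambda>x. fexp n x * \<psi> x))) {c..d}"
      using i that by (intro has_integral_sum has_integral_mult_right integrable_integral) auto
    moreover have "(\<lambda>x. \<Sum>n\<in>X. a n * (fexp n x * \<psi> x)) = ?T X"
      by (simp add: sum_distrib_right mult.assoc)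
    ultimately show ?thesis using has_integral_unique[OF I[of X]] by simp
  qed
  then have "\<forall>\<^sub>F X in finite_subsets_at_top UNIV.
      I X = (\<Sum>n\<in>X. a n * integral {c..d} (\<lambda>x. fexp n x * \<psi> x))"
    by (intro eventually_finite_subsets_at_top_weakI) auto
  then have "((\<lambda>X. \<Sum>n\<in>X. a n * integral {c..d} (\<lambda>x. fexp n x * \<psi> x)) \<longlongrightarrow> J)
      (finite_subsets_at_top UNIV)"
    using lim by (rule tendsto_cong[THEN iffD1])
  then show ?thesis using integral_unique[OF J] by (simp add: has_sum_def)
qed

lemma integral_fseries_fexp:
  assumes "summable_coeffs a"
  shows "I01 (\<lambda>x. fseries a x * fexp m x) = a (- m)"
proof -
  have e: "I01 (\<lambda>x. fexp n x * fexp m x) = (if n = - m then 1 else 0)" for n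
    unfolding fexp_add[symmetric] integral_fexp by auto
  have "((\<lambda>n. a n * (if n = - m then 1 else 0)) has_sum
      I01 (\<lambda>x. fseries a x * fexp m x)) UNIV"
    using has_sum_integral_fseries[OF assms, of 0 1 "fexp m"]
    by (simp only: e continuous_on_fexp simp_thms)
  moreover have "((\<lambda>n. a n * (if n = - m then 1 else 0)) has_sum a (- m)) UNIV"
    by (rule has_sum_finite_neutralI[of "{- m}"]) auto
  ultimately show ?thesis by (rule has_sum_unique)
qed

lemma fcoeff_uminus:
  "fcoeff f (- n) = cnj (fcoeff f n)"
proof -
  have "cnj (fcoeff f n) = I01 (cnj \<circ> (\<lambda>x. of_real (f x) * fexp (- n) x))"
    unfolding fcoeff_fexp by (simp add: integral_cnj o_def)
  also have "cnj \<circ> (\<lambda>x. of_real (f x) * fexp (- n) x) = (\<lambda>x. of_real (f x) * fexp (- (- n)) x)"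
    by (simp add: fun_eq_iff fexp_uminus)
  finally show ?thesis unfolding fcoeff_fexp by simp
qed

lemma fseries_real:
  assumes a: "summable_coeffs a" and sym: "\<And>n. a (- n) = cnj (a n)"
  shows "of_real (Re (fseries a x)) = fseries a x"
    and "fcoeff (\<lambda>x. Re (fseries a x)) = a"
proof -
  have "cnj (fseries a x) = (\<Sum>\<^sub>\<infinity>n. a (- n) * fexp (- n) x)" for x
    unfolding fseries_def infsum_cnj[symmetric] by (simp only: sym fexp_uminus complex_cnj_mult)
  also have "\<dots> x = fseries a x" for x
    unfolding fseries_def
    by (rule infsum_reindex_bij_witness[of _ uminus uminus]) auto
  finally have "cnj (fseries a x) = fseries a x" for x .
  then show re: "of_real (Re (fseries a x)) = fseries a x" for x
    by (simp add: complex_eq_iff)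
  show "fcoeff (\<lambda>x. Re (fseries a x)) = a"
    unfolding fcoeff_fexp re using integral_fseries_fexp[OF a] by auto
qed

text \<open>The difference between \<open>f\<close> and its series is continuous and periodic with
  vanishing coefficients, hence zero.\<close>

lemma continuous_eq_fseries:
  assumes f: "continuous_on UNIV f" "\<And>x. f (x + 1) = f x"
    and a: "summable_coeffs (fcoeff f)"
  shows "complex_of_real (f x) = fseries (fcoeff f) x"
proof -
  let ?k = "\<lambda>x. of_real (f x) - fseries (fcoeff f) x"
  have "?k x = 0"
  proof (rule fourier_unique)
    show "continuous_on UNIV ?k" by (intro continuous_intros f continuous_on_fseries a)
    show "?k (x + 1) = ?k x" for x by (simp only: fseries_periodic f)
    have cf: "continuous_on {0..1} f" using f continuous_on_subset by blast
    fix n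
    have "I01 (\<lambda>x. ?k x * fexp n x) =
        I01 (\<lambda>x. of_real (f x) * fexp n x)
        - I01 (\<lambda>x. fseries (fcoeff f) x * fexp n x)"
      unfolding left_diff_distrib
      by (intro integral_diff integrable_continuous_real continuous_intros cf continuous_on_fseries a)
    also have "\<dots> = 0"
      unfolding integral_fseries_fexp[OF a] unfolding fcoeff_fexp by simp
    finally show "I01 (\<lambda>x. ?k x * fexp n x) = 0" .
  qed
  then show ?thesis by simp
qed

section \<open>Sobolev spaces\<close>

abbreviation wcoeff :: "real \<Rightarrow> (real \<Rightarrow> real) \<Rightarrow> int \<Rightarrow> real" where
  "wcoeff r f n \<equiv> wt n powr (r / 2) * cmod (fcoeff f n)"

lemma wt_ge_1: "wt n \<ge> 1" by (simp add: wt_def)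

lemma wt_pos: "wt n > 0" using wt_ge_1[of n] by linarith

lemma sobolev_weight_eq: "sobolev_weight r f n = (wcoeff r f n)\<^sup>2"
proof -
  have "wt n powr r = (wt n powr (r / 2))\<^sup>2"
    by (simp add: power2_eq_square flip: powr_add)
  then show ?thesis unfolding sobolev_weight_def wt_def[symmetric] by (simp only: power_mult_distrib)
qed

lemma sobolev_periodic: "f \<in> sobolev r \<Longrightarrow> f (x + 1) = f x"
  and sobolev_continuous: "f \<in> sobolev r \<Longrightarrow> continuous_on S f"
  by (auto simp: sobolev_def intro: continuous_on_subset)

text \<open>Membership and norm bound come together from one bound on all finite partial sums. In
  this form the Minkowski and Cauchy-Schwarz inequalities for \<open>L2_set\<close> apply directly,
  and infinite sums are confined to this lemma and its converse below.\<close>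

lemma sobolevI:
  assumes "\<And>x. f (x + 1) = f x" "continuous_on UNIV f"
    and B: "\<And>F. finite F \<Longrightarrow> L2_set (wcoeff r f) F \<le> B"
  shows "f \<in> sobolev r" "snorm r f \<le> B"
proof -
  have "B \<ge> 0" using B[of "{}"] by simp
  have le: "sum (sobolev_weight r f) F \<le> B\<^sup>2" if "finite F" for F
    using B[OF that] unfolding L2_set_def sobolev_weight_eq
    by (rule sqrt_le_D)
  have "sobolev_weight r f summable_on UNIV"
    by (rule nonneg_bdd_above_summable_on)
       (auto intro!: bdd_aboveI2[where M = "B\<^sup>2"] le, simp add: sobolev_weight_def)
  then show "f \<in> sobolev r" using assms by (simp add: sobolev_def)
  have "infsum (sobolev_weight r f) UNIV \<le> B\<^sup>2"
    by (rule infsum_le_finite_sums) (use le \<open>sobolev_weight r f summable_on UNIV\<close> in auto)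
  then show "snorm r f \<le> B"
    unfolding sobolev_norm_def using \<open>B \<ge> 0\<close> by (simp add: real_le_lsqrt)
qed

lemma L2_set_le_sobolev_norm:
  assumes "f \<in> sobolev r" "finite F"
  shows "L2_set (wcoeff r f) F \<le> snorm r f"
proof -
  have "sum (sobolev_weight r f) F \<le> infsum (sobolev_weight r f) UNIV"
    using assms by (intro finite_sum_le_infsum) (auto simp: sobolev_def sobolev_weight_def)
  then show ?thesis unfolding sobolev_norm_def L2_set_def sobolev_weight_eq by simp
qed

lemma sobolev_norm_nonneg: "snorm r f \<ge> 0"
  unfolding sobolev_norm_def by (intro real_sqrt_ge_zero infsum_nonneg) (simp add: sobolev_weight_def)

lemma sobolev_mono:
  assumes "f \<in> sobolev r" "q \<le> r"
  shows "f \<in> sobolev q" "snorm q f \<le> snorm r f"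
proof -
  have "L2_set (wcoeff q f) F \<le> snorm r f" if F: "finite F" for F
  proof -
    have "L2_set (wcoeff q f) F \<le> L2_set (wcoeff r f) F"
      using assms by (intro L2_set_mono mult_right_mono powr_mono) (auto simp: wt_ge_1)
    then show ?thesis using L2_set_le_sobolev_norm[OF assms(1) F] by linarith
  qed
  from sobolevI[OF _ _ this] show "f \<in> sobolev q" "snorm q f \<le> snorm r f"
    using sobolev_periodic[OF assms(1)] sobolev_continuous[OF assms(1)] by auto
qed

text \<open>The shape \<open>(1 + k)^2\<close> is what the comparison with a p-series over
  \<open>Suc k\<close> wants. It follows from \<open>2 * k \<le> 2 * k^2\<close> and the crude bound
  \<open>(2 * pi)^2 \<ge> 4\<close>, so that
  \<open>1 + 2 * k + k^2 \<le> 1 + 4 * k^2\<close>.\<close>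

lemma wt_ge: "wt (int k) \<ge> (1 + real k)\<^sup>2" "wt (- int k) \<ge> (1 + real k)\<^sup>2"
proof -
  have "real k \<le> (real k)\<^sup>2"
    by (cases k) (auto simp: power2_eq_square)
  moreover have "(2 * pi)\<^sup>2 \<ge> 4"
    using pi_gt3 power_mono[of 2 "2 * pi" 2] by simp
  then have "4 * (real k)\<^sup>2 \<le> (2 * pi)\<^sup>2 * (real k)\<^sup>2" by (intro mult_right_mono) auto
  moreover have "(1 + real k)\<^sup>2 = 1 + 2 * real k + (real k)\<^sup>2"
    by (simp add: power2_eq_square algebra_simps)
  ultimately have "(1 + real k)\<^sup>2 \<le> 1 + (2 * pi)\<^sup>2 * (real k)\<^sup>2"
    by linarith
  then show "wt (int k) \<ge> (1 + real k)\<^sup>2" "wt (- int k) \<ge> (1 + real k)\<^sup>2"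
    by (simp_all add: wt_def power_mult_distrib)
qed

lemma wt_summable:
  assumes "r > 1/2"
  shows "(\<lambda>n. wt n powr (- r)) summable_on UNIV"
proof -
  have "summable (\<lambda>k. real (Suc k) powr (- 2 * r))"
    using assms summable_real_powr_iff[of "- 2 * r"] summable_Suc_iff[of "\<lambda>k. real k powr (- 2 * r)"]
    by simp
  then have s: "(\<lambda>k. real (Suc k) powr (- 2 * r)) summable_on UNIV"
    by (subst summable_on_UNIV_nonneg_real_iff) auto
  have le: "y powr (- r) \<le> real (Suc k) powr (- 2 * r)" if "y \<ge> (1 + real k)\<^sup>2" for y k
  proof -
    have "y powr (- r) \<le> ((1 + real k)\<^sup>2) powr (- r)"
      using that assms by (intro powr_mono2') auto
    also have "(1 + real k)\<^sup>2 = (1 + real k) powr 2" by simp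
    also have "(\<dots>) powr (- r) = real (Suc k) powr (- 2 * r)"
      by (subst powr_powr) (simp add: add.commute)
    finally show ?thesis .
  qed
  have "(\<lambda>k. wt (int k) powr (- r)) summable_on UNIV"
    by (rule summable_on_comparison_test[OF s le[OF wt_ge(1)]]) simp
  then have 1: "(\<lambda>n. wt n powr (- r)) summable_on (range int)"
    by (subst summable_on_reindex) (auto simp: o_def inj_on_def)
  have "(\<lambda>k. wt (- int k) powr (- r)) summable_on UNIV"
    by (rule summable_on_comparison_test[OF s le[OF wt_ge(2)]]) simp
  then have 2: "(\<lambda>n. wt n powr (- r)) summable_on (range (\<lambda>k. - int k))"
    by (subst summable_on_reindex) (auto simp: o_def inj_on_def)
  have "(UNIV :: int set) = range int \<union> range (\<lambda>k. - int k)"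
    by (auto simp: image_iff) (metis int_cases2)
  then show ?thesis using summable_on_union[OF 1 2] by simp
qed

text \<open>The embedding constant of class \<open>r\<close> into functions with summable Fourier
  coefficients. It has this meaning only for \<open>r > 1/2\<close>; otherwise the sum diverges and
  \<open>infsum\<close> returns its default 0.\<close>

definition emb :: "real \<Rightarrow> real" where
  "emb r = sqrt (\<Sum>\<^sub>\<infinity>n. wt n powr (- r))"

lemma emb_nonneg: "emb r \<ge> 0"
  unfolding emb_def by (intro real_sqrt_ge_zero infsum_nonneg) simp

text \<open>Cauchy-Schwarz against the square summable weights
  \<open>wt n powr (- r / 2)\<close>.\<close>

lemma weighted_l2_imp_l1:
  assumes r: "r > 1/2"
    and B: "\<And>F. finite F \<Longrightarrow> L2_set (\<lambda>n. wt n powr (r / 2) * cmod (a n)) F \<le> B"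
  shows "summable_coeffs a" "(\<Sum>\<^sub>\<infinity>n. cmod (a n)) \<le> emb r * B"
proof -
  have le: "(\<Sum>n\<in>F. cmod (a n)) \<le> emb r * B" if F: "finite F" for F
  proof -
    have "(\<Sum>n\<in>F. cmod (a n)) = (\<Sum>n\<in>F. \<bar>wt n powr (- r / 2)\<bar> * \<bar>wt n powr (r / 2) * cmod (a n)\<bar>)"
    proof (rule sum.cong)
      fix n
      have "wt n powr (- r / 2) * wt n powr (r / 2) = 1"
        using wt_pos[of n] by (simp flip: powr_add)
      then have "\<bar>wt n powr (- r / 2)\<bar> * \<bar>wt n powr (r / 2) * cmod (a n)\<bar> = 1 * cmod (a n)"
        by (metis abs_mult abs_norm_cancel abs_1 mult.assoc)
      then show "cmod (a n) = \<bar>wt n powr (- r / 2)\<bar> * \<bar>wt n powr (r / 2) * cmod (a n)\<bar>" by simp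
    qed simp
    also have "\<dots> \<le> L2_set (\<lambda>n. wt n powr (- r / 2)) F * L2_set (\<lambda>n. wt n powr (r / 2) * cmod (a n)) F"
      by (rule L2_set_mult_ineq)
    also have "\<dots> \<le> emb r * B"
    proof (rule mult_mono[OF _ B[OF F] emb_nonneg L2_set_nonneg])
      have "(\<Sum>n\<in>F. (wt n powr (- r / 2))\<^sup>2) = (\<Sum>n\<in>F. wt n powr (- r))"
        by (intro sum.cong) (auto simp: power2_eq_square simp flip: powr_add)
      also have "\<dots> \<le> (\<Sum>\<^sub>\<infinity>n. wt n powr (- r))"
        using wt_summable[OF r] F by (intro finite_sum_le_infsum) auto
      finally show "L2_set (\<lambda>n. wt n powr (- r / 2)) F \<le> emb r"
        unfolding L2_set_def emb_def by simp
    qed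
    finally show ?thesis .
  qed
  show *: "summable_coeffs a"
    by (rule nonneg_bdd_above_summable_on) (auto intro!: bdd_aboveI2[where M = "emb r * B"] le)
  show "(\<Sum>\<^sub>\<infinity>n. cmod (a n)) \<le> emb r * B"
    by (rule infsum_le_finite_sums[OF *]) (auto intro: le)
qed

lemma sobolev_l1:
  assumes "f \<in> sobolev r" "r > 1/2"
  shows "summable_coeffs (fcoeff f)"
    and "(\<Sum>\<^sub>\<infinity>n. cmod (fcoeff f n)) \<le> emb r * snorm r f"
  using weighted_l2_imp_l1[OF assms(2) L2_set_le_sobolev_norm[OF assms(1)]] by auto

lemma sobolev_eq_fseries:
  assumes "f \<in> sobolev r" "r > 1/2"
  shows "complex_of_real (f x) = fseries (fcoeff f) x"
  by (intro continuous_eq_fseries sobolev_l1[OF assms] sobolev_continuous[OF assms(1)]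
      sobolev_periodic[OF assms(1)])

text \<open>Elements of \<open>sobolev r\<close> are continuous functions and not classes, so equal
  coefficients give pointwise equality. Identities between Fourier multipliers are checked through
  this lemma.\<close>

lemma sobolev_ext:
  assumes "f \<in> sobolev r" "g \<in> sobolev r" "r > 1/2"
    and "\<And>n. fcoeff f n = fcoeff g n"
  shows "f = g"
proof
  fix x
  have "fcoeff f = fcoeff g" using assms(4) by auto
  then have "complex_of_real (f x) = complex_of_real (g x)"
    using sobolev_eq_fseries[of _ r] assms(1-3) by metis
  then show "f x = g x" by simp
qed

lemma sobolev_sup_bound:
  assumes "f \<in> sobolev r" "r > 1/2"
  shows "\<bar>f x\<bar> \<le> emb r * snorm r f"
proof -
  have "\<bar>f x\<bar> = cmod (fseries (fcoeff f) x)"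
    using sobolev_eq_fseries[OF assms, of x] by (metis norm_of_real real_norm_def)
  also have "\<dots> \<le> (\<Sum>\<^sub>\<infinity>n. cmod (fcoeff f n * fexp n x))"
    unfolding fseries_def using sobolev_l1(1)[OF assms]
    by (intro norm_infsum_bound) (simp add: norm_mult)
  also have "\<dots> \<le> emb r * snorm r f"
    using sobolev_l1(2)[OF assms] by (simp add: norm_mult)
  finally show ?thesis .
qed

lemma sobolev_norm_0_imp:
  assumes "f \<in> sobolev r" "r > 1/2" "snorm r f = 0"
  shows "f x = 0"
  using sobolev_sup_bound[OF assms(1,2), of x] assms(3) by simp

text \<open>Constructs a function from prescribed coefficients; the symmetry of \<open>a\<close>
  makes the series real. Both the derivative and \<open>solve\<close> arise in this way.\<close>

lemma sobolev_fseriesI: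
  assumes r: "r > 1/2" and sym: "\<And>n. a (- n) = cnj (a n)"
    and B: "\<And>F. finite F \<Longrightarrow> L2_set (\<lambda>n. wt n powr (r / 2) * cmod (a n)) F \<le> B"
  shows "(\<lambda>x. Re (fseries a x)) \<in> sobolev r" "snorm r (\<lambda>x. Re (fseries a x)) \<le> B"
    "fcoeff (\<lambda>x. Re (fseries a x)) = a"
proof -
  note a = weighted_l2_imp_l1(1)[OF r B]
  show fc: "fcoeff (\<lambda>x. Re (fseries a x)) = a"
    by (rule fseries_real(2)[OF a sym])
  have "L2_set (wcoeff r (\<lambda>x. Re (fseries a x))) F \<le> B" if "finite F" for F
    unfolding fc by (rule B[OF that])
  note * = sobolevI[OF _ _ this]
  show "(\<lambda>x. Re (fseries a x)) \<in> sobolev r" "snorm r (\<lambda>x. Re (fseries a x)) \<le> B"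
    by (auto intro!: * continuous_intros continuous_on_fseries a simp: fseries_periodic simp del: of_int_add)
qed

lemma fcoeff_add:
  assumes "continuous_on UNIV f" "continuous_on UNIV g"
  shows "fcoeff (\<lambda>x. f x + g x) n = fcoeff f n + fcoeff g n"
proof -
  have "continuous_on {0..1} f" "continuous_on {0..1} g"
    using assms continuous_on_subset by blast+
  then show ?thesis unfolding fourier_coefficient_def of_real_add distrib_right
    by (intro integral_add integrable_continuous_real continuous_intros)
qed

lemma fcoeff_cmult:
  "fcoeff (\<lambda>x. c * f x) n = of_real c * fcoeff f n"
  unfolding fourier_coefficient_def by (simp add: mult.assoc)

lemma sobolev_add:
  assumes f: "f \<in> sobolev r" and g: "g \<in> sobolev r"
  shows "(\<lambda>x. f x + g x) \<in> sobolev r"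
    and "snorm r (\<lambda>x. f x + g x) \<le> snorm r f + snorm r g"
proof -
  have "L2_set (wcoeff r (\<lambda>x. f x + g x)) F \<le> snorm r f + snorm r g" if F: "finite F" for F
  proof -
    have "L2_set (wcoeff r (\<lambda>x. f x + g x)) F \<le> L2_set (\<lambda>n. wcoeff r f n + wcoeff r g n) F"
      unfolding fcoeff_add[OF sobolev_continuous[OF f] sobolev_continuous[OF g]]
        distrib_left[symmetric]
      by (intro L2_set_mono mult_left_mono norm_triangle_ineq) auto
    also have "\<dots> \<le> L2_set (wcoeff r f) F + L2_set (wcoeff r g) F" by (rule L2_set_triangle_ineq)
    also have "\<dots> \<le> snorm r f + snorm r g"
      by (intro add_mono L2_set_le_sobolev_norm f g F)
    finally show ?thesis .
  qed
  note * = sobolevI[OF _ _ this]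
  show "(\<lambda>x. f x + g x) \<in> sobolev r"
    and "snorm r (\<lambda>x. f x + g x) \<le> snorm r f + snorm r g"
    by (auto intro!: * continuous_intros sobolev_continuous[OF f] sobolev_continuous[OF g]
        simp: sobolev_periodic[OF f] sobolev_periodic[OF g])
qed

lemma sobolev_norm_cmult: "snorm r (\<lambda>x. c * f x) = \<bar>c\<bar> * snorm r f"
proof -
  have "sobolev_weight r (\<lambda>x. c * f x) = (\<lambda>n. c\<^sup>2 * sobolev_weight r f n)"
    by (simp add: fun_eq_iff sobolev_weight_def fcoeff_cmult norm_mult power_mult_distrib)
  then show ?thesis
    unfolding sobolev_norm_def by (simp add: infsum_cmult_right' real_sqrt_mult)
qed

lemma sobolev_cmult:
  assumes "f \<in> sobolev r"
  shows "(\<lambda>x. c * f x) \<in> sobolev r"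
proof -
  have "sobolev_weight r (\<lambda>x. c * f x) = (\<lambda>n. c\<^sup>2 * sobolev_weight r f n)"
    by (simp add: fun_eq_iff sobolev_weight_def fcoeff_cmult norm_mult power_mult_distrib)
  then show ?thesis using assms
    by (auto simp: sobolev_def intro!: continuous_intros summable_on_cmult_right)
qed

lemma sobolev_diff:
  assumes f: "f \<in> sobolev r" and g: "g \<in> sobolev r"
  shows "(\<lambda>x. f x - g x) \<in> sobolev r"
    and "snorm r (\<lambda>x. f x - g x) \<le> snorm r f + snorm r g"
  using sobolev_add[OF f sobolev_cmult[OF g, of "-1"]] sobolev_norm_cmult[of r "-1" g] by auto

section \<open>The algebra property\<close>

text \<open>Only \<open>f\<close> is expanded. The other factor stays inside the integral as a test
  function, whose integrals against \<open>fexp m\<close> are the shifted coefficients of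
  \<open>g\<close>.\<close>

lemma fcoeff_mult:
  assumes f: "f \<in> sobolev r" and g: "g \<in> sobolev r" and r: "r > 1/2"
  shows "((\<lambda>m. fcoeff f m * fcoeff g (n - m)) has_sum
          fcoeff (\<lambda>x. f x * g x) n) UNIV"
proof -
  have "continuous_on {0..1} (\<lambda>x. of_real (g x) * fexp (- n) x)"
    by (intro continuous_intros sobolev_continuous[OF g])
  from has_sum_integral_fseries[OF sobolev_l1(1)[OF f r] this]
  have "((\<lambda>m. fcoeff f m * I01 (\<lambda>x. fexp m x * (of_real (g x) * fexp (- n) x))) has_sum
      I01 (\<lambda>x. fseries (fcoeff f) x * (of_real (g x) * fexp (- n) x))) UNIV" .
  moreover have "fexp m x * (of_real (g x) * fexp (- n) x) = of_real (g x) * fexp (- (n - m)) x" for m x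
    using fexp_add[of m "- n" x] by simp
  ultimately show ?thesis
    unfolding fcoeff_fexp sobolev_eq_fseries[OF f r, symmetric] of_real_mult
    by (simp add: mult.assoc)
qed

lemma L2_set_sum_le:
  "L2_set (\<lambda>n. \<Sum>m\<in>X. f m n) F \<le> (\<Sum>m\<in>X. L2_set (f m) F)"
proof (induction X rule: infinite_finite_induct)
  case (insert x X)
  have "L2_set (\<lambda>n. \<Sum>m\<in>insert x X. f m n) F = L2_set (\<lambda>n. f x n + (\<Sum>m\<in>X. f m n)) F"
    using insert by simp
  also have "\<dots> \<le> L2_set (f x) F + L2_set (\<lambda>n. \<Sum>m\<in>X. f m n) F" by (rule L2_set_triangle_ineq)
  finally show ?case using insert by simp
qed (auto simp: L2_set_def)

text \<open>A convolution with a summable sequence is a superposition of shifts, and shifts preserve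
  the l2 norm. Minkowski gives the bound for finitely many shifts, and a limit in the finite set of
  shifts gives the rest.\<close>

lemma young_inequality:
  fixes \<alpha> b :: "int \<Rightarrow> real"
  assumes \<alpha>: "\<And>m. \<alpha> m \<ge> 0" "\<alpha> summable_on UNIV" and b: "\<And>m. b m \<ge> 0"
    and N: "\<And>F. finite F \<Longrightarrow> L2_set b F \<le> N"
  shows "(\<lambda>m. \<alpha> m * b (n - m)) summable_on UNIV"
    and "finite F \<Longrightarrow> L2_set (\<lambda>n. \<Sum>\<^sub>\<infinity>m. \<alpha> m * b (n - m)) F \<le> infsum \<alpha> UNIV * N"
proof -
  have bN: "b m \<le> N" for m using N[of "{m}"] b[of m] by simp
  have N0: "N \<ge> 0" using N[of "{}"] by simp
  have s: "(\<lambda>m. \<alpha> m * b (n - m)) summable_on UNIV" for n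
    by (rule summable_on_comparison_test[OF summable_on_cmult_left[OF \<alpha>(2), of N]])
       (auto intro!: mult_left_mono \<alpha> bN mult_nonneg_nonneg b)
  then show "(\<lambda>m. \<alpha> m * b (n - m)) summable_on UNIV" .
  assume F: "finite F"
  have shift: "L2_set (\<lambda>n. b (n - m)) F \<le> N" for m
  proof -
    have "L2_set (\<lambda>n. b (n - m)) F = L2_set b ((\<lambda>n. n - m) ` F)"
      unfolding L2_set_def by (subst sum.reindex) (auto simp: inj_on_def)
    then show ?thesis using N[of "(\<lambda>n. n - m) ` F"] F by simp
  qed
  have fin: "L2_set (\<lambda>n. \<Sum>m\<in>X. \<alpha> m * b (n - m)) F \<le> infsum \<alpha> UNIV * N" if "finite X" for X
  proof -
    have "L2_set (\<lambda>n. \<Sum>m\<in>X. \<alpha> m * b (n - m)) F \<le> (\<Sum>m\<in>X. L2_set (\<lambda>n. \<alpha> m * b (n - m)) F)"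
      by (rule L2_set_sum_le)
    also have "\<dots> = (\<Sum>m\<in>X. \<alpha> m * L2_set (\<lambda>n. b (n - m)) F)"
      by (intro sum.cong refl L2_set_right_distrib[symmetric] \<alpha>)
    also have "\<dots> \<le> (\<Sum>m\<in>X. \<alpha> m * N)" by (intro sum_mono mult_left_mono shift \<alpha>)
    also have "\<dots> = sum \<alpha> X * N" by (simp add: sum_distrib_right)
    also have "\<dots> \<le> infsum \<alpha> UNIV * N"
      using that by (intro mult_right_mono N0 finite_sum_le_infsum \<alpha>) auto
    finally show ?thesis .
  qed
  have "((\<lambda>X. L2_set (\<lambda>n. \<Sum>m\<in>X. \<alpha> m * b (n - m)) F) \<longlongrightarrow>
      L2_set (\<lambda>n. \<Sum>\<^sub>\<infinity>m. \<alpha> m * b (n - m)) F) (finite_subsets_at_top UNIV)"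
    unfolding L2_set_def by (intro tendsto_intros infsum_tendsto s)
  then show "L2_set (\<lambda>n. \<Sum>\<^sub>\<infinity>m. \<alpha> m * b (n - m)) F \<le> infsum \<alpha> UNIV * N"
    by (rule tendsto_upperbound)
       (auto intro!: eventually_finite_subsets_at_top_weakI fin)
qed

text \<open>Lets the weight of a product fall on one factor at a time. The 4 comes from
  \<open>(x + y)^2 \<le> 2 * x^2 + 2 * y^2\<close> and from bounding a sum of two terms by twice
  their maximum.\<close>

lemma wt_peetre:
  assumes "r \<ge> 0"
  shows "wt n powr (r / 2) \<le> 4 powr (r / 2) * (wt m powr (r / 2) + wt (n - m) powr (r / 2))"
proof -
  define x y where "x = 2 * pi * of_int m" and "y = 2 * pi * of_int (n - m)"
  have "2 * pi * of_int n = x + y" by (simp add: x_def y_def algebra_simps)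
  have "(x + y)\<^sup>2 \<le> 2 * x\<^sup>2 + 2 * y\<^sup>2" 
    using zero_le_power2[of "x - y"] by (simp add: power2_eq_square algebra_simps)
  then have "1 + (x + y)\<^sup>2 \<le> 4 * max (1 + x\<^sup>2) (1 + y\<^sup>2)"
    by (auto simp: max_def)
  then have "wt n \<le> 4 * max (wt m) (wt (n - m))"
    unfolding wt_def[of n] \<open>2 * pi * of_int n = x + y\<close> by (simp add: wt_def x_def y_def)
  then have "wt n powr (r / 2) \<le> (4 * max (wt m) (wt (n - m))) powr (r / 2)"
    using assms wt_pos[of n] by (intro powr_mono2) auto
  also have "\<dots> = 4 powr (r / 2) * max (wt m) (wt (n - m)) powr (r / 2)"
    by (rule powr_mult)
  also have "\<dots> \<le> 4 powr (r / 2) * (wt m powr (r / 2) + wt (n - m) powr (r / 2))"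
    by (intro mult_left_mono) (auto simp: max_def)
  finally show ?thesis .
qed

text \<open>Three summands so that one constant is at least 1, dominates the sup norm constant
  \<open>emb r\<close>, and is a constant for products.\<close>

definition alg :: "real \<Rightarrow> real" where
  "alg r = 1 + 2 * 4 powr (r / 2) * emb r + emb r"

lemma alg_ge: "alg r \<ge> 1" "alg r \<ge> emb r" "2 * 4 powr (r / 2) * emb r \<le> alg r"
proof -
  have "0 \<le> 2 * 4 powr (r / 2) * emb r" using emb_nonneg[of r] by simp
  then show "alg r \<ge> 1" "alg r \<ge> emb r" "2 * 4 powr (r / 2) * emb r \<le> alg r"
    using emb_nonneg[of r] unfolding alg_def by linarith+
qed

text \<open>After \<open>wt_peetre\<close> each half of the convolution carries the weight on one
  factor, measured in l2, while the other factor is measured in l1 by the embedding.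
  \<open>young_inequality\<close> bounds both halves.\<close>

lemma sobolev_mult:
  assumes f: "f \<in> sobolev r" and g: "g \<in> sobolev r" and r: "r > 1/2"
  shows "(\<lambda>x. f x * g x) \<in> sobolev r"
    and "snorm r (\<lambda>x. f x * g x) \<le> alg r * snorm r f * snorm r g"
proof -
  let ?f = "\<lambda>m. cmod (fcoeff f m)" and ?g = "\<lambda>m. cmod (fcoeff g m)"
  define C where "C = 4 powr (r / 2)"
  have C0: "C \<ge> 0" by (simp add: C_def)
  note Yf = young_inequality[of ?f "wcoeff r g" "snorm r g",
      OF norm_ge_zero sobolev_l1(1)[OF f r] _ L2_set_le_sobolev_norm[OF g]]
  note Yg = young_inequality[of ?g "wcoeff r f" "snorm r f",
      OF norm_ge_zero sobolev_l1(1)[OF g r] _ L2_set_le_sobolev_norm[OF f]]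
  define S1 where "S1 n = (\<Sum>\<^sub>\<infinity>m. ?f m * wcoeff r g (n - m))" for n
  define S2 where "S2 n = (\<Sum>\<^sub>\<infinity>m. ?g m * wcoeff r f (n - m))" for n
  have bound: "wcoeff r (\<lambda>x. f x * g x) n \<le> C * (S1 n + S2 n)" for n
  proof -
    have s1: "((\<lambda>m. ?f m * wcoeff r g (n - m)) has_sum S1 n) UNIV"
      unfolding S1_def by (intro has_sum_infsum Yf(1)) simp
    have "((\<lambda>m. ?g m * wcoeff r f (n - m)) has_sum S2 n) UNIV"
      unfolding S2_def by (intro has_sum_infsum Yg(1)) simp
    \<comment> \<open>The reflection \<open>m \<mapsto> n - m\<close> brings the second convolution
      to the index of the first, so that the two series can be added termwise.\<close>
    then have s2: "((\<lambda>m. ?g (n - m) * wcoeff r f m) has_sum S2 n) UNIV"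
      by (subst (asm) has_sum_reindex_bij_witness[of UNIV "\<lambda>m. n - m" "\<lambda>m. n - m" UNIV
            "\<lambda>m. ?g (n - m) * wcoeff r f m"]) auto
    have s: "((\<lambda>m. C * (?f m * wcoeff r g (n - m) + ?g (n - m) * wcoeff r f m)) has_sum
        C * (S1 n + S2 n)) UNIV"
      by (intro has_sum_cmult_right has_sum_add s1 s2)
    have p: "((\<lambda>m. of_real (wt n powr (r / 2)) * (fcoeff f m * fcoeff g (n - m))) has_sum
        of_real (wt n powr (r / 2)) * fcoeff (\<lambda>x. f x * g x) n) UNIV"
      by (intro has_sum_cmult_right fcoeff_mult[OF f g r])
    have "cmod (of_real (wt n powr (r / 2)) * (fcoeff f m * fcoeff g (n - m)))
        \<le> C * (?f m * wcoeff r g (n - m) + ?g (n - m) * wcoeff r f m)" for m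
    proof -
      have "cmod (of_real (wt n powr (r / 2)) * (fcoeff f m * fcoeff g (n - m)))
          = wt n powr (r / 2) * (?f m * ?g (n - m))"
        by (simp add: norm_mult)
      also have "\<dots> \<le> (C * (wt m powr (r / 2) + wt (n - m) powr (r / 2))) * (?f m * ?g (n - m))"
        unfolding C_def using r by (intro mult_right_mono wt_peetre) auto
      also have "\<dots> = C * (?f m * wcoeff r g (n - m) + ?g (n - m) * wcoeff r f m)"
        by (simp add: algebra_simps)
      finally show ?thesis .
    qed
    from norm_infsum_le[OF p s this]
    have "cmod (of_real (wt n powr (r / 2)) * fcoeff (\<lambda>x. f x * g x) n) \<le> C * (S1 n + S2 n)"
      by simp
    then show ?thesis by (simp add: norm_mult)
  qed
  have "L2_set (wcoeff r (\<lambda>x. f x * g x)) F \<le> alg r * snorm r f * snorm r g"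
    if F: "finite F" for F
  proof -
    let ?N = "snorm r f * snorm r g"
    have N0: "?N \<ge> 0" by (simp add: sobolev_norm_nonneg)
    have "L2_set (wcoeff r (\<lambda>x. f x * g x)) F \<le> L2_set (\<lambda>n. C * (S1 n + S2 n)) F"
      by (intro L2_set_mono bound) simp
    also have "\<dots> = C * L2_set (\<lambda>n. S1 n + S2 n) F"
      by (intro L2_set_right_distrib[symmetric] C0)
    also have "\<dots> \<le> C * (L2_set S1 F + L2_set S2 F)"
      by (intro mult_left_mono L2_set_triangle_ineq C0)
    also have "\<dots> \<le> C * ((emb r * snorm r f) * snorm r g + (emb r * snorm r g) * snorm r f)"
    proof (intro mult_left_mono add_mono C0)
      have "L2_set S1 F \<le> infsum ?f UNIV * snorm r g"
        unfolding S1_def by (rule Yf(2)[OF _ _ F]) auto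
      also have "\<dots> \<le> (emb r * snorm r f) * snorm r g"
        by (intro mult_right_mono sobolev_l1[OF f r] sobolev_norm_nonneg)
      finally show "L2_set S1 F \<le> (emb r * snorm r f) * snorm r g" .
      have "L2_set S2 F \<le> infsum ?g UNIV * snorm r f"
        unfolding S2_def by (rule Yg(2)[OF _ _ F]) auto
      also have "\<dots> \<le> (emb r * snorm r g) * snorm r f"
        by (intro mult_right_mono sobolev_l1[OF g r] sobolev_norm_nonneg)
      finally show "L2_set S2 F \<le> (emb r * snorm r g) * snorm r f" .
    qed
    also have "\<dots> = (2 * C * emb r) * ?N" by (simp add: algebra_simps)
    also have "\<dots> \<le> alg r * ?N"
      unfolding C_def by (intro mult_right_mono alg_ge N0)
    finally show ?thesis by (simp add: mult.assoc)
  qed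
  note * = sobolevI[OF _ _ this]
  show "(\<lambda>x. f x * g x) \<in> sobolev r"
    and "snorm r (\<lambda>x. f x * g x) \<le> alg r * snorm r f * snorm r g"
    by (auto intro!: * continuous_intros sobolev_continuous[OF f] sobolev_continuous[OF g]
        simp: sobolev_periodic[OF f] sobolev_periodic[OF g])
qed

lemma sobolev_sup_alg:
  assumes "f \<in> sobolev r" "r > 1/2"
  shows "\<bar>f x\<bar> \<le> alg r * snorm r f"
  using sobolev_sup_bound[OF assms, of x] mult_right_mono[OF alg_ge(2)[of r] sobolev_norm_nonneg[of r f]]
  by linarith

text \<open>The series of \<open>f\<close> is not differentiated termwise. Instead the series
  \<open>g\<close> with the expected coefficients, which converges uniformly because
  \<open>r - 1 > 1/2\<close>, is integrated termwise; this reproduces the increments of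
  \<open>f\<close>, and the fundamental theorem returns \<open>g\<close> as the derivative.\<close>

lemma sobolev_deriv:
  assumes f: "f \<in> sobolev r" and r: "r > 3/2"
  shows "(f has_real_derivative deriv f x) (at x)" "deriv f \<in> sobolev (r - 1)"
    "snorm (r - 1) (deriv f) \<le> snorm r f"
    "fcoeff (deriv f) n = \<i> * of_real (2 * pi * of_int n) * fcoeff f n"
proof -
  define a where "a n = \<i> * of_real (2 * pi * of_int n) * fcoeff f n" for n
  have r1: "r - 1 > 1/2" and r2: "r > 1/2" using r by auto
  have sym: "a (- n) = cnj (a n)" for n
    by (simp add: a_def fcoeff_uminus)
  have le: "wt n powr ((r - 1) / 2) * cmod (a n) \<le> wcoeff r f n" for n
  proof -
    have "cmod (\<i> * of_real (2 * pi * of_int n)) = sqrt ((2 * pi * of_int n)\<^sup>2)"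
      by (simp add: norm_mult abs_mult real_sqrt_mult power_mult_distrib)
    also have "\<dots> \<le> sqrt (wt n)" by (rule real_sqrt_le_mono) (simp add: wt_def)
    also have "\<dots> = wt n powr (1 / 2)" using wt_pos[of n] by (simp add: powr_half_sqrt)
    finally have "cmod (a n) \<le> wt n powr (1 / 2) * cmod (fcoeff f n)"
      unfolding a_def norm_mult by (intro mult_right_mono) (simp_all add: norm_mult)
    then have "wt n powr ((r - 1) / 2) * cmod (a n)
        \<le> wt n powr ((r - 1) / 2) * (wt n powr (1 / 2) * cmod (fcoeff f n))"
      by (intro mult_left_mono) auto
    also have "\<dots> = wt n powr ((r - 1) / 2 + 1 / 2) * cmod (fcoeff f n)"
      by (simp add: powr_add mult.assoc)
    also have "(r - 1) / 2 + 1 / 2 = r / 2" by (simp add: field_simps)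
    finally show ?thesis .
  qed
  have B: "L2_set (\<lambda>n. wt n powr ((r - 1) / 2) * cmod (a n)) F \<le> snorm r f" if "finite F" for F
  proof -
    have "L2_set (\<lambda>n. wt n powr ((r - 1) / 2) * cmod (a n)) F \<le> L2_set (wcoeff r f) F"
      by (intro L2_set_mono le) auto
    then show ?thesis using L2_set_le_sobolev_norm[OF f that] by linarith
  qed
  define g where "g x = Re (fseries a x)" for x
  note g = sobolev_fseriesI[OF r1 sym B, folded g_def]
  have a: "summable_coeffs a" by (rule weighted_l2_imp_l1(1)[OF r1 B])
  have gs: "of_real (g x) = fseries a x" for x
    unfolding g_def by (rule fseries_real(1)[OF a sym])
  have ftc: "f d - f c = integral {c..d} g" if "c \<le> d" for c d
  proof -
    have i: "a n * integral {c..d} (\<lambda>x. fexp n x * 1) =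
        fcoeff f n * fexp n d - fcoeff f n * fexp n c" for n
    proof -
      have "integral {c..d} (\<lambda>x. (\<i> * of_real (2 * pi * of_int n)) * fexp n x) = fexp n d - fexp n c"
        using fexp_has_integral[OF that, of n] by (intro integral_unique) (simp add: mult.assoc)
      then have "\<i> * of_real (2 * pi * of_int n) * integral {c..d} (fexp n) = fexp n d - fexp n c"
        by (subst (asm) integral_mult_right) simp
      from arg_cong[OF this, of "\<lambda>z. fcoeff f n * z"] show ?thesis
        unfolding a_def by (simp add: algebra_simps)
    qed
    have s: "((\<lambda>n. fcoeff f n * fexp n x) has_sum of_real (f x)) UNIV" for x
      unfolding sobolev_eq_fseries[OF f r2] fseries_def
      by (rule has_sum_infsum, rule abs_summable_summable) (simp add: norm_mult sobolev_l1(1)[OF f r2])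
    have "((\<lambda>n. fcoeff f n * fexp n d - fcoeff f n * fexp n c) has_sum
        (of_real (f d) - of_real (f c))) UNIV"
      using has_sum_add[OF s has_sum_uminusI[OF s], of d c] by simp
    moreover have "((\<lambda>n. fcoeff f n * fexp n d - fcoeff f n * fexp n c) has_sum
        integral {c..d} (\<lambda>x. fseries a x * 1)) UNIV"
      using has_sum_integral_fseries[OF a continuous_on_const[of _ 1], of c d] unfolding i .
    ultimately have "complex_of_real (f d - f c) = integral {c..d} (\<lambda>x. fseries a x)"
      using has_sum_unique by fastforce
    also have "\<dots> = of_real (integral {c..d} g)"
    proof -
      have "(g has_integral integral {c..d} g) {c..d}"
        by (intro integrable_integral integrable_continuous_real sobolev_continuous[OF g(1)])
      from has_integral_linear[OF this bounded_linear_of_real[where 'a = complex]]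
      have "((\<lambda>x. fseries a x) has_integral of_real (integral {c..d} g)) {c..d}"
        by (simp add: o_def gs)
      then show ?thesis by (rule integral_unique)
    qed
    finally show ?thesis using of_real_eq_iff by blast
  qed
  have "(f has_real_derivative g x) (at x)" for x
  proof -
    have "((\<lambda>y. integral {x - 1..y} g) has_real_derivative g x) (at x within {x - 1..x + 1})"
      by (rule integral_has_real_derivative[OF sobolev_continuous[OF g(1)]]) auto
    then have "((\<lambda>y. f (x - 1) + integral {x - 1..y} g) has_real_derivative g x) (at x within {x - 1..x + 1})"
      by (auto intro!: derivative_eq_intros)
    then have "(f has_real_derivative g x) (at x within {x - 1..x + 1})"
      by (rule has_field_derivative_transform_within[where d = 1]) (auto simp flip: ftc)
    then show ?thesis by (simp add: at_within_Icc_at)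
  qed
  note D = this
  then have "deriv f = g" using DERIV_imp_deriv by blast
  then show "(f has_real_derivative deriv f x) (at x)" "deriv f \<in> sobolev (r - 1)"
    "snorm (r - 1) (deriv f) \<le> snorm r f"
    "fcoeff (deriv f) n = \<i> * of_real (2 * pi * of_int n) * fcoeff f n"
    using D g by (simp_all add: a_def)
qed

section \<open>Derivatives and the operators \<open>(\<partial>\<^sub>x \<mp> 1)\<inverse>\<close>\<close>

text \<open>The inverse of \<open>d/dx - \<epsilon>\<close> as a Fourier multiplier. For
  \<open>\<epsilon>\<close> equal to 1 or -1 the denominator has modulus \<open>sqrt (wt n)\<close>,
  so exactly one derivative is gained.\<close>

definition solve :: "real \<Rightarrow> (real \<Rightarrow> real) \<Rightarrow> real \<Rightarrow> real" where
  "solve \<epsilon> f x = Re (fseries (\<lambda>n. fcoeff f n / (\<i> * of_real (2 * pi * of_int n) - of_real \<epsilon>)) x)"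

context
  fixes \<epsilon> r :: real
  assumes \<epsilon>: "\<epsilon> \<in> {1, -1}" and r: "r > 1/2"
begin

lemma solve_sobolev:
  assumes f: "f \<in> sobolev r"
  shows "solve \<epsilon> f \<in> sobolev (r + 1)" "snorm (r + 1) (solve \<epsilon> f) \<le> snorm r f"
    "fcoeff (solve \<epsilon> f) n =
       fcoeff f n / (\<i> * of_real (2 * pi * of_int n) - of_real \<epsilon>)"
proof -
  define a where "a n = fcoeff f n / (\<i> * of_real (2 * pi * of_int n) - of_real \<epsilon>)" for n
  have sym: "a (- n) = cnj (a n)" for n
    by (simp add: a_def fcoeff_uminus)
  have B: "L2_set (\<lambda>n. wt n powr ((r + 1) / 2) * cmod (a n)) F \<le> snorm r f" if F: "finite F" for F
  proof -
    have "wt n powr ((r + 1) / 2) * cmod (a n) = wcoeff r f n" for n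
    proof -
      have "\<epsilon>\<^sup>2 = 1" using \<epsilon> by auto
      then have "cmod (\<i> * of_real (2 * pi * of_int n) - of_real \<epsilon>) = sqrt (wt n)"
        by (simp add: cmod_def wt_def)
      also have "\<dots> = wt n powr (1 / 2)" using wt_pos[of n] by (simp add: powr_half_sqrt)
      finally have c: "cmod (\<i> * of_real (2 * pi * of_int n) - of_real \<epsilon>) = wt n powr (1 / 2)" .
      have "wt n powr ((r + 1) / 2) = wt n powr (r / 2) * wt n powr (1 / 2)"
        by (simp add: add_divide_distrib flip: powr_add)
      then show ?thesis unfolding a_def norm_divide c using wt_pos[of n] by simp
    qed
    then show ?thesis using L2_set_le_sobolev_norm[OF f F] by simp
  qed
  have r1: "r + 1 > 1/2" using r by simp
  have eq: "solve \<epsilon> f = (\<lambda>x. Re (fseries a x))" by (simp add: fun_eq_iff solve_def a_def[abs_def])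
  show "solve \<epsilon> f \<in> sobolev (r + 1)" "snorm (r + 1) (solve \<epsilon> f) \<le> snorm r f"
    "fcoeff (solve \<epsilon> f) n =
       fcoeff f n / (\<i> * of_real (2 * pi * of_int n) - of_real \<epsilon>)"
    unfolding eq a_def[symmetric] using sobolev_fseriesI[OF r1 sym B] by simp_all
qed

lemma solve_denominator_nz: "\<i> * of_real (2 * pi * of_int n) - of_real \<epsilon> \<noteq> 0"
  using \<epsilon> by (auto simp: complex_eq_iff)

lemma solve_has_derivative:
  assumes f: "f \<in> sobolev r"
  shows "(solve \<epsilon> f has_real_derivative \<epsilon> * solve \<epsilon> f x + f x) (at x)"
proof -
  note s = solve_sobolev[OF f]
  have r1: "r + 1 > 3/2" using r by simp
  note d = sobolev_deriv[OF s(1) r1]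
  have "deriv (solve \<epsilon> f) = (\<lambda>x. \<epsilon> * solve \<epsilon> f x + f x)"
  proof (rule sobolev_ext)
    have s': "(\<lambda>x. \<epsilon> * solve \<epsilon> f x) \<in> sobolev r"
      using sobolev_cmult[OF sobolev_mono(1)[OF s(1)], of r \<epsilon>] by simp
    then show "(\<lambda>x. \<epsilon> * solve \<epsilon> f x + f x) \<in> sobolev r" by (intro sobolev_add f)
    show "deriv (solve \<epsilon> f) \<in> sobolev r" using d(2) by simp
    show "fcoeff (deriv (solve \<epsilon> f)) n = fcoeff (\<lambda>x. \<epsilon> * solve \<epsilon> f x + f x) n" for n
      unfolding d(4) s(3) fcoeff_cmult
        fcoeff_add[OF sobolev_continuous[OF s'] sobolev_continuous[OF f]]
      using solve_denominator_nz[of n] by (simp add: field_simps)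
  qed (rule r)
  then show ?thesis using d(1)[of x] by simp
qed

lemma solve_add:
  assumes f: "f \<in> sobolev r" and g: "g \<in> sobolev r"
  shows "solve \<epsilon> (\<lambda>x. f x + g x) x = solve \<epsilon> f x + solve \<epsilon> g x"
proof -
  have "solve \<epsilon> (\<lambda>x. f x + g x) = (\<lambda>x. solve \<epsilon> f x + solve \<epsilon> g x)"
    by (rule sobolev_ext[of _ "r + 1"])
       (use r in \<open>simp_all add: solve_sobolev sobolev_add f g add_divide_distrib
          fcoeff_add[OF sobolev_continuous sobolev_continuous, OF f g]
          fcoeff_add[OF sobolev_continuous sobolev_continuous, OF solve_sobolev(1) solve_sobolev(1), OF f g]\<close>)
  then show ?thesis by (rule fun_cong)
qed

lemma solve_cmult:
  assumes f: "f \<in> sobolev r"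
  shows "solve \<epsilon> (\<lambda>x. c * f x) x = c * solve \<epsilon> f x"
proof -
  have "solve \<epsilon> (\<lambda>x. c * f x) = (\<lambda>x. c * solve \<epsilon> f x)"
    by (rule sobolev_ext[of _ "r + 1"])
       (use r in \<open>simp_all add: solve_sobolev sobolev_cmult f fcoeff_cmult\<close>)
  then show ?thesis by (rule fun_cong)
qed

end

section \<open>Constants, uniform limits and power series in Sobolev spaces\<close>

lemma fcoeff_const: "fcoeff (\<lambda>x. c) n = (if n = 0 then of_real c else 0)"
  unfolding fcoeff_fexp using integral_fexp[of "- n"] by simp

lemma sobolev_const:
  shows "(\<lambda>x. c) \<in> sobolev r" "snorm r (\<lambda>x. c) \<le> \<bar>c\<bar>"
proof -
  have "L2_set (wcoeff r (\<lambda>x. c)) F \<le> \<bar>c\<bar>" if "finite F" for F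
  proof -
    have "L2_set (wcoeff r (\<lambda>x. c)) F \<le> (\<Sum>n\<in>F. wcoeff r (\<lambda>x. c) n)"
      by (rule L2_set_le_sum) simp
    also have "\<dots> = (\<Sum>n\<in>F. if n = 0 then \<bar>c\<bar> else 0)"
      by (intro sum.cong) (auto simp: fcoeff_const wt_def)
    also have "\<dots> \<le> \<bar>c\<bar>" using that by (simp add: sum.delta)
    finally show ?thesis .
  qed
  from sobolevI[OF _ _ this] show "(\<lambda>x. c) \<in> sobolev r" "snorm r (\<lambda>x. c) \<le> \<bar>c\<bar>" by auto
qed

text \<open>Lower semicontinuity of the norm: uniform convergence makes each Fourier coefficient
  converge, and a bound on finite partial sums survives the limit. Power series can thus be summed
  uniformly while their norms stay under control.\<close>

lemma sobolev_uniform_limit: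
  fixes F :: "nat \<Rightarrow> real \<Rightarrow> real"
  assumes F: "\<And>k. F k \<in> sobolev r" "\<And>k. snorm r (F k) \<le> B"
    and lim: "uniform_limit UNIV F f sequentially"
  shows "f \<in> sobolev r" "snorm r f \<le> B"
proof -
  have cf: "continuous_on UNIV f"
    by (rule uniform_limit_theorem[OF _ lim]) (auto intro!: always_eventually sobolev_continuous F)
  have pw: "(\<lambda>k. F k x) \<longlonglongrightarrow> f x" for x
    using tendsto_uniform_limitI[OF lim] by auto
  have pf: "f (x + 1) = f x" for x
    using LIMSEQ_unique[OF pw[of "x + 1"]] pw[of x] sobolev_periodic[OF F(1)] by simp
  have fc: "(\<lambda>k. fcoeff (F k) n) \<longlonglongrightarrow> fcoeff f n" for n
  proof -
    have "bounded (f ` {0..1})"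
      by (intro compact_imp_bounded compact_continuous_image continuous_on_subset[OF cf]) auto
    then have b: "bounded ((\<lambda>x. complex_of_real (f x)) ` {0..1})"
      unfolding bounded_iff by auto
    have "uniform_limit {0..1} (\<lambda>k x. complex_of_real (F k x)) (\<lambda>x. of_real (f x)) sequentially"
      by (intro bounded_linear.uniform_limit[OF bounded_linear_of_real] uniform_limit_on_subset[OF lim]) simp
    then have "uniform_limit {0..1} (\<lambda>k x. of_real (F k x) * fexp (- n) x) (\<lambda>x. of_real (f x) * fexp (- n) x) sequentially"
      by (intro uniform_lim_mult uniform_limit_const b compact_imp_bounded compact_continuous_image continuous_intros) auto
    then obtain I J where I: "\<And>k. ((\<lambda>x. of_real (F k x) * fexp (- n) x) has_integral I k) {0..1}"
      and J: "((\<lambda>x. of_real (f x) * fexp (- n) x) has_integral J) {0..1}" and l: "I \<longlonglongrightarrow> J"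
      by (rule uniform_limit_integral) (auto intro!: continuous_intros sobolev_continuous F)
    show ?thesis
      using l integral_unique[OF I] integral_unique[OF J] unfolding fcoeff_fexp by simp
  qed
  have "L2_set (wcoeff r f) X \<le> B" if "finite X" for X
  proof (rule tendsto_upperbound)
    show "(\<lambda>k. L2_set (wcoeff r (F k)) X) \<longlonglongrightarrow> L2_set (wcoeff r f) X"
      unfolding L2_set_def by (intro tendsto_intros fc)
    show "\<forall>\<^sub>F k in sequentially. L2_set (wcoeff r (F k)) X \<le> B"
      by (intro always_eventually allI order.trans[OF L2_set_le_sobolev_norm[OF F(1) that] F(2)])
  qed simp
  from sobolevI[OF pf cf this] show "f \<in> sobolev r" "snorm r f \<le> B" by auto
qed

lemma sobolev_power:
  assumes f: "f \<in> sobolev r" and r: "r > 1/2"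
  shows "(\<lambda>x. f x ^ k) \<in> sobolev r"
    and "snorm r (\<lambda>x. f x ^ k) \<le> (alg r * snorm r f) ^ k"
proof (induction k)
  case 0
  { case 1 show ?case using sobolev_const(1)[of 1 r] by simp }
  { case 2 show ?case using sobolev_const(2)[of r 1] by simp }
next
  case (Suc k)
  { case 1 show ?case using sobolev_mult(1)[OF f Suc(1) r] by simp }
  { case 2
    have "snorm r (\<lambda>x. f x * f x ^ k) \<le> alg r * snorm r f * snorm r (\<lambda>x. f x ^ k)"
      by (rule sobolev_mult(2)[OF f Suc(1) r])
    also have "\<dots> \<le> alg r * snorm r f * (alg r * snorm r f) ^ k"
      using alg_ge(1)[of r] by (intro mult_left_mono Suc(2)) (auto simp: sobolev_norm_nonneg)
    finally show ?case by simp }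
qed

text \<open>One smallness condition serves twice: as \<open>alg r\<close> dominates both the product
  constant and the sup norm constant, the terms are bounded by \<open>(1/2) ^ k\<close> pointwise
  and in the Sobolev norm. The bound 2 is the sum of that geometric series.\<close>

lemma sobolev_power_series:
  fixes c :: "nat \<Rightarrow> real"
  assumes f: "f \<in> sobolev r" and r: "r > 1/2" and c: "\<And>k. \<bar>c k\<bar> \<le> 1"
    and small: "alg r * snorm r f \<le> 1/2"
  shows "(\<lambda>x. \<Sum>k. c k * f x ^ k) \<in> sobolev r" "snorm r (\<lambda>x. \<Sum>k. c k * f x ^ k) \<le> 2"
    "summable (\<lambda>k. c k * f x ^ k)"
proof -
  have fx: "\<bar>f x\<bar> \<le> 1/2" for x
    using sobolev_sup_alg[OF f r, of x] small by linarith
  have bd: "norm (c k * f x ^ k) \<le> (1/2) ^ k" for k x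
    using mult_mono[OF c[of k] power_mono[OF fx[of x], of k]] by (simp add: abs_mult power_abs)
  have "summable (\<lambda>k. (1/2) ^ k :: real)" by (rule summable_geometric) simp
  note M = Weierstrass_m_test[OF bd this]
  show "summable (\<lambda>k. c k * f x ^ k)"
    by (rule summable_comparison_test'[OF \<open>summable (\<lambda>k. (1/2) ^ k :: real)\<close>, of 0]) (use bd in auto)
  have part: "(\<lambda>x. \<Sum>k<n. c k * f x ^ k) \<in> sobolev r \<and>
      snorm r (\<lambda>x. \<Sum>k<n. c k * f x ^ k) \<le> (\<Sum>k<n. (1/2) ^ k)" for n
  proof (induction n)
    case 0 show ?case using sobolev_const(1)[of 0 r] sobolev_const(2)[of r 0] by simp
  next
    case (Suc n)
    have t: "(\<lambda>x. c n * f x ^ n) \<in> sobolev r" by (intro sobolev_cmult sobolev_power f r)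
    have "snorm r (\<lambda>x. c n * f x ^ n) \<le> 1 * (1/2) ^ n"
      unfolding sobolev_norm_cmult
    proof (rule mult_mono[OF c])
      have "snorm r (\<lambda>x. f x ^ n) \<le> (alg r * snorm r f) ^ n"
        by (rule sobolev_power[OF f r])
      also have "\<dots> \<le> (1/2) ^ n"
        using alg_ge(1)[of r] by (intro power_mono small) (auto simp: sobolev_norm_nonneg)
      finally show "snorm r (\<lambda>x. f x ^ n) \<le> (1/2) ^ n" .
    qed (auto simp: sobolev_norm_nonneg)
    then show ?case
      using sobolev_add[OF conjunct1[OF Suc] t] Suc by simp
  qed
  have "(\<Sum>k<n. (1/2) ^ k) \<le> (2::real)" for n
    by (simp add: sum_gp_strict)
  then have B: "snorm r (\<lambda>x. \<Sum>k<n. c k * f x ^ k) \<le> 2" for n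
    using part[of n] by (meson order.trans)
  show "(\<lambda>x. \<Sum>k. c k * f x ^ k) \<in> sobolev r" "snorm r (\<lambda>x. \<Sum>k. c k * f x ^ k) \<le> 2"
    by (rule sobolev_uniform_limit[OF conjunct1[OF part] B M])+
qed

text \<open>The 2 bounds the norm of a power series; three factors \<open>alg r\<close> come from
  squaring \<open>alg r * snorm r f\<close> and from one product, and the fourth only rounds up, by
  \<open>alg r \<ge> 1\<close>.\<close>

abbreviation (input) rem :: "real \<Rightarrow> real" where
  "rem r \<equiv> 2 * (alg r)\<^sup>2 * (alg r)\<^sup>2"

text \<open>The remainder is \<open>f x ^ 2\<close> times the series with coefficients shifted by 2,
  to which the same norm bound applies.\<close>

lemma sobolev_power_series_remainder:
  fixes c :: "nat \<Rightarrow> real"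
  assumes f: "f \<in> sobolev r" and r: "r > 1/2" and c: "\<And>k. \<bar>c k\<bar> \<le> 1"
    and small: "alg r * snorm r f \<le> 1/2"
  shows "(\<lambda>x. (\<Sum>k. c k * f x ^ k) - c 0 - c 1 * f x) \<in> sobolev r"
    and "snorm r (\<lambda>x. (\<Sum>k. c k * f x ^ k) - c 0 - c 1 * f x) \<le> rem r * (snorm r f)\<^sup>2"
proof -
  note ps = sobolev_power_series[OF f r c small]
  note g = sobolev_power_series[OF f r, of "\<lambda>k. c (k + 2)", OF c small]
  have eq: "(\<Sum>k. c k * f x ^ k) - c 0 - c 1 * f x = f x ^ 2 * (\<Sum>k. c (k + 2) * f x ^ k)" for x
  proof -
    have "(\<Sum>k. c k * f x ^ k) = (\<Sum>k. c (k + 2) * f x ^ (k + 2)) + (\<Sum>k<2. c k * f x ^ k)"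
      by (rule suminf_split_initial_segment[OF ps(3)])
    also have "(\<Sum>k. c (k + 2) * f x ^ (k + 2)) = (\<Sum>k. f x ^ 2 * (c (k + 2) * f x ^ k))"
      by (simp add: power2_eq_square mult_ac)
    also have "\<dots> = f x ^ 2 * (\<Sum>k. c (k + 2) * f x ^ k)" by (rule suminf_mult[OF g(3)])
    finally show ?thesis by (simp add: eval_nat_numeral)
  qed
  note p2 = sobolev_power[OF f r, of 2]
  note m = sobolev_mult[OF p2(1) g(1) r]
  show "(\<lambda>x. (\<Sum>k. c k * f x ^ k) - c 0 - c 1 * f x) \<in> sobolev r"
    unfolding eq by (rule m(1))
  have "snorm r (\<lambda>x. f x ^ 2 * (\<Sum>k. c (k + 2) * f x ^ k))
      \<le> alg r * (alg r * snorm r f) ^ 2 * 2"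
    using alg_ge(1)[of r]
    by (intro order.trans[OF m(2)] mult_mono mult_left_mono p2 g) (auto simp: sobolev_norm_nonneg)
  also have "\<dots> \<le> alg r * (alg r * (alg r * snorm r f) ^ 2 * 2)"
    using alg_ge(1)[of r] mult_right_mono[of 1 "alg r" "alg r * (alg r * snorm r f) ^ 2 * 2"] by auto
  also have "\<dots> = rem r * (snorm r f)\<^sup>2"
    by (simp add: power2_eq_square)
  finally show "snorm r (\<lambda>x. (\<Sum>k. c k * f x ^ k) - c 0 - c 1 * f x)
      \<le> rem r * (snorm r f)\<^sup>2"
    unfolding eq .
qed

lemma sobolev_exp:
  assumes f: "f \<in> sobolev r" and r: "r > 1/2" and small: "alg r * snorm r f \<le> 1/2"
  shows "(\<lambda>x. exp (f x)) \<in> sobolev r" "(\<lambda>x. exp (f x) - 1 - f x) \<in> sobolev r"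
    and "snorm r (\<lambda>x. exp (f x) - 1 - f x) \<le> rem r * (snorm r f)\<^sup>2"
proof -
  let ?c = "\<lambda>k. 1 / fact k :: real"
  have c: "\<bar>?c k\<bar> \<le> 1" for k by simp
  have e: "(\<Sum>k. ?c k * f x ^ k) = exp (f x)" for x
    unfolding exp_def by (simp add: field_simps)
  show "(\<lambda>x. exp (f x)) \<in> sobolev r" "(\<lambda>x. exp (f x) - 1 - f x) \<in> sobolev r"
    and "snorm r (\<lambda>x. exp (f x) - 1 - f x) \<le> rem r * (snorm r f)\<^sup>2"
    using sobolev_power_series(1)[of f r ?c, OF f r c small]
      sobolev_power_series_remainder[of f r ?c, OF f r c small]
    unfolding e by simp_all
qed

lemma sobolev_inverse:
  assumes f: "f \<in> sobolev r" and r: "r > 1/2" and small: "alg r * snorm r f \<le> 1/2"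
  shows "(\<lambda>x. 1 / (1 + f x)) \<in> sobolev r" "(\<lambda>x. 1 / (1 + f x) - 1 + f x) \<in> sobolev r"
    and "snorm r (\<lambda>x. 1 / (1 + f x) - 1 + f x) \<le> rem r * (snorm r f)\<^sup>2"
proof -
  let ?c = "\<lambda>k. (- 1) ^ k :: real"
  have c: "\<bar>?c k\<bar> \<le> 1" for k by simp
  have e: "(\<Sum>k. ?c k * f x ^ k) = 1 / (1 + f x)" for x
  proof -
    have "\<bar>f x\<bar> \<le> 1/2"
      using sobolev_sup_alg[OF f r, of x] small by linarith
    then have "(\<Sum>k. (- f x) ^ k) = 1 / (1 - (- f x))" by (intro suminf_geometric) auto
    moreover have "(- f x) ^ k = ?c k * f x ^ k" for k by (rule power_minus)
    ultimately show ?thesis by simp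
  qed
  show "(\<lambda>x. 1 / (1 + f x)) \<in> sobolev r" "(\<lambda>x. 1 / (1 + f x) - 1 + f x) \<in> sobolev r"
    and "snorm r (\<lambda>x. 1 / (1 + f x) - 1 + f x) \<le> rem r * (snorm r f)\<^sup>2"
    using sobolev_power_series(1)[of f r ?c, OF f r c small]
      sobolev_power_series_remainder[of f r ?c, OF f r c small]
    unfolding e by simp_all
qed

section \<open>First order expansions at the origin\<close>

text \<open>
  Expansions with quadratic remainder are stable under sums, products and bounded linear maps, so
  that derivatives of composite expressions are obtained by the product rule.
\<close>

definition linear_map :: "real \<Rightarrow> real \<Rightarrow> ((real \<Rightarrow> real) \<Rightarrow> real \<Rightarrow> real) \<Rightarrow> bool" where
  "linear_map s r L \<longleftrightarrow>
     (\<forall>h\<in>sobolev s. L h \<in> sobolev r) \<and>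
     (\<forall>h\<in>sobolev s. \<forall>k\<in>sobolev s. L (\<lambda>x. h x + k x) = (\<lambda>x. L h x + L k x)) \<and>
     (\<forall>c. \<forall>h\<in>sobolev s. L (\<lambda>x. c * h x) = (\<lambda>x. c * L h x)) \<and>
     (\<exists>K\<ge>0. \<forall>h\<in>sobolev s. snorm r (L h) \<le> K * snorm s h)"

definition expands :: "real \<Rightarrow> real \<Rightarrow> ((real \<Rightarrow> real) \<Rightarrow> real \<Rightarrow> real) \<Rightarrow> (real \<Rightarrow> real) \<Rightarrow>
    ((real \<Rightarrow> real) \<Rightarrow> real \<Rightarrow> real) \<Rightarrow> bool" where
  "expands s r \<Phi> a L \<longleftrightarrow> a \<in> sobolev r \<and> linear_map s r L \<and>
     (\<exists>K\<ge>0. \<exists>\<delta>>0. \<forall>h\<in>sobolev s. snorm s h < \<delta> \<longrightarrow> \<Phi> h \<in> sobolev r \<and>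
        snorm r (\<lambda>x. \<Phi> h x - a x - L h x) \<le> K * (snorm s h)\<^sup>2)"

text \<open>\<open>expands\<close> with its constants exposed. The radius is capped at 1 so that in
  a product the remainders of order three and four are dominated by the quadratic one.\<close>

definition expansion_bounds where
  "expansion_bounds s r \<Phi> a L M K \<delta> \<longleftrightarrow> M \<ge> 0 \<and> K \<ge> 0 \<and> \<delta> > 0 \<and> \<delta> \<le> 1 \<and>
     (\<forall>h\<in>sobolev s. snorm r (L h) \<le> M * snorm s h) \<and>
     (\<forall>h\<in>sobolev s. snorm s h < \<delta> \<longrightarrow> \<Phi> h \<in> sobolev r \<and>
        snorm r (\<lambda>x. \<Phi> h x - a x - L h x) \<le> K * (snorm s h)\<^sup>2)"

lemma expandsE:
  assumes "expands s r \<Phi> a L"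
  obtains M K \<delta> where "expansion_bounds s r \<Phi> a L M K \<delta>"
proof -
  obtain M where "M \<ge> 0" "\<forall>h\<in>sobolev s. snorm r (L h) \<le> M * snorm s h"
    using assms unfolding expands_def linear_map_def by blast
  moreover obtain K \<delta> where "K \<ge> 0" "\<delta> > 0" "\<forall>h\<in>sobolev s. snorm s h < \<delta> \<longrightarrow> \<Phi> h \<in> sobolev r \<and>
      snorm r (\<lambda>x. \<Phi> h x - a x - L h x) \<le> K * (snorm s h)\<^sup>2"
    using assms unfolding expands_def by blast
  ultimately show ?thesis using that[of M K "min \<delta> 1"] by (auto simp: expansion_bounds_def)
qed

lemma expansion_boundsD:
  assumes "expansion_bounds s r \<Phi> a L M K \<delta>"
  shows "M \<ge> 0" "K \<ge> 0" "\<delta> > 0" "\<delta> \<le> 1"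
    "h \<in> sobolev s \<Longrightarrow> snorm r (L h) \<le> M * snorm s h"
    "h \<in> sobolev s \<Longrightarrow> snorm s h < \<delta> \<Longrightarrow> \<Phi> h \<in> sobolev r"
    "h \<in> sobolev s \<Longrightarrow> snorm s h < \<delta> \<Longrightarrow> snorm r (\<lambda>x. \<Phi> h x - a x - L h x) \<le> K * (snorm s h)\<^sup>2"
  using assms by (auto simp: expansion_bounds_def)

lemma expands_value: "expands s r \<Phi> a L \<Longrightarrow> a \<in> sobolev r"
  and expands_linear: "expands s r \<Phi> a L \<Longrightarrow> linear_map s r L"
  by (auto simp: expands_def)

lemma linear_map_sobolev: "linear_map s r L \<Longrightarrow> h \<in> sobolev s \<Longrightarrow> L h \<in> sobolev r"
  by (auto simp: linear_map_def)

lemma expandsI: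
  assumes "a \<in> sobolev r" "linear_map s r L" "K \<ge> 0" "\<delta> > 0"
    and "\<And>h. h \<in> sobolev s \<Longrightarrow> snorm s h < \<delta> \<Longrightarrow> \<Phi> h \<in> sobolev r \<and>
           snorm r (\<lambda>x. \<Phi> h x - a x - L h x) \<le> K * (snorm s h)\<^sup>2"
  shows "expands s r \<Phi> a L"
  using assms unfolding expands_def by blast

lemma linear_map_add:
  assumes L: "linear_map s r L" and M: "linear_map s r M"
  shows "linear_map s r (\<lambda>h x. L h x + M h x)"
proof -
  obtain K1 where K1: "K1 \<ge> 0" "\<forall>h\<in>sobolev s. snorm r (L h) \<le> K1 * snorm s h"
    using L unfolding linear_map_def by blast
  obtain K2 where K2: "K2 \<ge> 0" "\<forall>h\<in>sobolev s. snorm r (M h) \<le> K2 * snorm s h"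
    using M unfolding linear_map_def by blast
  have "snorm r (\<lambda>x. L h x + M h x) \<le> (K1 + K2) * snorm s h" if "h \<in> sobolev s" for h
    using sobolev_add(2)[OF linear_map_sobolev[OF L that] linear_map_sobolev[OF M that]] K1 K2 that
    by (force simp: distrib_right)
  moreover have "K1 + K2 \<ge> 0" using K1 K2 by simp
  ultimately show ?thesis
    using L M unfolding linear_map_def by (auto simp: sobolev_add algebra_simps)
qed

lemma linear_map_mult:
  assumes a: "a \<in> sobolev r" and L: "linear_map s r L" and r: "r > 1/2"
  shows "linear_map s r (\<lambda>h x. a x * L h x)"
proof -
  obtain K where K: "K \<ge> 0" "\<forall>h\<in>sobolev s. snorm r (L h) \<le> K * snorm s h"
    using L unfolding linear_map_def by blast
  let ?K = "alg r * snorm r a * K"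
  have K0: "alg r * snorm r a \<ge> 0" using alg_ge(1)[of r] by (simp add: sobolev_norm_nonneg)
  have "snorm r (\<lambda>x. a x * L h x) \<le> ?K * snorm s h" if h: "h \<in> sobolev s" for h
    using sobolev_mult(2)[OF a linear_map_sobolev[OF L h] r]
      mult_left_mono[OF bspec[OF K(2) h] K0] by (simp add: mult.assoc)
  moreover have "?K \<ge> 0" using K0 K by simp
  ultimately show ?thesis
    using L a r unfolding linear_map_def by (auto simp: sobolev_mult algebra_simps)
qed

lemma expands_const:
  assumes "a \<in> sobolev r"
  shows "expands s r (\<lambda>_. a) a (\<lambda>h x. 0)"
proof (rule expandsI[where K = 0 and \<delta> = 1])
  show "linear_map s r (\<lambda>h x. 0)"
    unfolding linear_map_def using sobolev_const(1)[of 0 r] sobolev_const(2)[of r 0]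
    by (auto intro!: exI[of _ 0])
qed (use assms sobolev_const(2)[of r 0] in auto)

lemma expands_add:
  assumes e: "expands s r \<Phi> a L" "expands s r \<Psi> b M"
  shows "expands s r (\<lambda>h x. \<Phi> h x + \<Psi> h x) (\<lambda>x. a x + b x) (\<lambda>h x. L h x + M h x)"
proof -
  obtain A1 K1 \<delta>1 where "expansion_bounds s r \<Phi> a L A1 K1 \<delta>1"
    by (rule expandsE[OF e(1)])
  note 1 = expansion_boundsD(2,3,6,7)[OF this]
  obtain A2 K2 \<delta>2 where "expansion_bounds s r \<Psi> b M A2 K2 \<delta>2"
    by (rule expandsE[OF e(2)])
  note 2 = expansion_boundsD(2,3,6,7)[OF this]
  show ?thesis
  proof (rule expandsI[where K = "K1 + K2" and \<delta> = "min \<delta>1 \<delta>2"], goal_cases)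
    case (5 h)
    then have h: "h \<in> sobolev s" "snorm s h < \<delta>1" "snorm s h < \<delta>2" by auto
    have i: "(\<lambda>x. \<Phi> h x - a x - L h x) \<in> sobolev r" "(\<lambda>x. \<Psi> h x - b x - M h x) \<in> sobolev r"
      using 1(3)[OF h(1,2)] 2(3)[OF h(1,3)] expands_value[OF e(1)] expands_value[OF e(2)]
        linear_map_sobolev[OF expands_linear[OF e(1)] h(1)] linear_map_sobolev[OF expands_linear[OF e(2)] h(1)]
      by (auto intro!: sobolev_diff)
    have "snorm r (\<lambda>x. (\<Phi> h x - a x - L h x) + (\<Psi> h x - b x - M h x)) \<le> (K1 + K2) * (snorm s h)\<^sup>2"
      using sobolev_add(2)[OF i] 1(4)[OF h(1,2)] 2(4)[OF h(1,3)] by (simp add: distrib_right)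
    then show ?case using sobolev_add(1)[OF 1(3)[OF h(1,2)] 2(3)[OF h(1,3)]] by (simp add: algebra_simps)
  qed (use 1 2 in \<open>auto intro!: sobolev_add linear_map_add expands_value[OF e(1)] expands_value[OF e(2)]
        expands_linear[OF e(1)] expands_linear[OF e(2)]\<close>)
qed

text \<open>With remainders \<open>\<rho>\<close> of \<open>\<Phi>\<close> and \<open>\<tau>\<close>
  of \<open>\<Psi>\<close>, the remainder of the product is
  \<open>\<rho> * \<Psi> + (a + L) * \<tau> + L * M\<close>: each term is quadratic in
  \<open>h\<close>, the last one because both of its factors are linear.\<close>

lemma expands_mult:
  assumes e: "expands s r \<Phi> a L" "expands s r \<Psi> b M" and r: "r > 1/2"
  shows "expands s r (\<lambda>h x. \<Phi> h x * \<Psi> h x) (\<lambda>x. a x * b x) (\<lambda>h x. a x * M h x + b x * L h x)"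
proof -
  obtain A1 K1 \<delta>1 where "expansion_bounds s r \<Phi> a L A1 K1 \<delta>1"
    by (rule expandsE[OF e(1)])
  note 1 = expansion_boundsD[OF this]
  obtain A2 K2 \<delta>2 where "expansion_bounds s r \<Psi> b M A2 K2 \<delta>2"
    by (rule expandsE[OF e(2)])
  note 2 = expansion_boundsD[OF this]
  note ab = expands_value[OF e(1)] expands_value[OF e(2)]
  define C where "C = alg r"
  have C0: "C \<ge> 0" using alg_ge(1)[of r] by (simp add: C_def)
  define Na Nb where "Na = snorm r a" and "Nb = snorm r b"
  have N0: "Na \<ge> 0" "Nb \<ge> 0" by (auto simp: Na_def Nb_def sobolev_norm_nonneg)
  \<comment> \<open>One summand for each of the three terms of the remainder;
    \<open>Nb + A2 + K2\<close> bounds the full second factor and \<open>Na + A1\<close> the affine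
    part of the first.\<close>
  define K where "K = C * K1 * (Nb + A2 + K2) + C * (Na + A1) * K2 + C * A1 * A2"
  have K0: "K \<ge> 0" using C0 N0 1 2 by (simp add: K_def)
  show ?thesis
  proof (rule expandsI[where K = K and \<delta> = "min \<delta>1 \<delta>2"], goal_cases)
    case (5 h)
    then have h: "h \<in> sobolev s" and d: "snorm s h < \<delta>1" "snorm s h < \<delta>2" by auto
    define n where "n = snorm s h"
    have n: "n \<ge> 0" "n \<le> 1" using d 1(4) by (auto simp: n_def sobolev_norm_nonneg)
    then have n2: "n\<^sup>2 \<le> 1" by (simp add: power_le_one)
    note Lh = linear_map_sobolev[OF expands_linear[OF e(1)] h]
    note Mh = linear_map_sobolev[OF expands_linear[OF e(2)] h]
    define \<rho> \<tau> where "\<rho> x = \<Phi> h x - a x - L h x" and "\<tau> x = \<Psi> h x - b x - M h x" for x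
    have \<rho>: "\<rho> \<in> sobolev r" "snorm r \<rho> \<le> K1 * n\<^sup>2"
      unfolding \<rho>_def n_def using 1(6,7)[OF h d(1)] ab Lh by (auto intro!: sobolev_diff)
    have \<tau>: "\<tau> \<in> sobolev r" "snorm r \<tau> \<le> K2 * n\<^sup>2"
      unfolding \<tau>_def n_def using 2(6,7)[OF h d(2)] ab Mh by (auto intro!: sobolev_diff)
    have aL: "(\<lambda>x. a x + L h x) \<in> sobolev r" "snorm r (\<lambda>x. a x + L h x) \<le> Na + A1"
    proof -
      have "A1 * n \<le> A1" using 1(1) n by (simp add: mult_left_le)
      then show "(\<lambda>x. a x + L h x) \<in> sobolev r" "snorm r (\<lambda>x. a x + L h x) \<le> Na + A1"
        using sobolev_add[OF ab(1) Lh] 1(5)[OF h] by (auto simp: Na_def n_def)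
    qed
    have bM: "(\<lambda>x. b x + M h x) \<in> sobolev r" "snorm r (\<lambda>x. b x + M h x) \<le> Nb + A2"
    proof -
      have "A2 * n \<le> A2" using 2(1) n by (simp add: mult_left_le)
      then show "(\<lambda>x. b x + M h x) \<in> sobolev r" "snorm r (\<lambda>x. b x + M h x) \<le> Nb + A2"
        using sobolev_add[OF ab(2) Mh] 2(5)[OF h] by (auto simp: Nb_def n_def)
    qed
    have \<Psi>: "\<Psi> h \<in> sobolev r" "snorm r (\<Psi> h) \<le> Nb + A2 + K2"
    proof -
      show "\<Psi> h \<in> sobolev r" by (rule 2(6)[OF h d(2)])
      have "K2 * n\<^sup>2 \<le> K2" using 2(2) n2 by (simp add: mult_left_le)
      moreover have "\<Psi> h = (\<lambda>x. (b x + M h x) + \<tau> x)" by (simp add: \<tau>_def)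
      ultimately show "snorm r (\<Psi> h) \<le> Nb + A2 + K2"
        using sobolev_add(2)[OF bM(1) \<tau>(1)] bM(2) \<tau>(2) by simp
    qed
    note m1 = sobolev_mult[OF \<rho>(1) \<Psi>(1) r, folded C_def]
    note m2 = sobolev_mult[OF aL(1) \<tau>(1) r, folded C_def]
    note m3 = sobolev_mult[OF Lh Mh r, folded C_def]
    have "snorm r (\<lambda>x. \<rho> x * \<Psi> h x) \<le> C * (K1 * n\<^sup>2) * (Nb + A2 + K2)"
      using C0 1 \<rho> \<Psi> by (intro order.trans[OF m1(2)] mult_mono mult_left_mono)
        (auto simp: sobolev_norm_nonneg)
    moreover have "snorm r (\<lambda>x. (a x + L h x) * \<tau> x) \<le> C * (Na + A1) * (K2 * n\<^sup>2)"
      using C0 1 N0 \<tau> aL by (intro order.trans[OF m2(2)] mult_mono mult_left_mono)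
        (auto simp: sobolev_norm_nonneg)
    moreover have "snorm r (\<lambda>x. L h x * M h x) \<le> C * (A1 * n) * (A2 * n)"
      using C0 1 2 n 1(5)[OF h] 2(5)[OF h] by (intro order.trans[OF m3(2)] mult_mono mult_left_mono)
        (auto simp: sobolev_norm_nonneg n_def)
    moreover have "snorm r (\<lambda>x. (\<rho> x * \<Psi> h x + (a x + L h x) * \<tau> x) + L h x * M h x)
        \<le> snorm r (\<lambda>x. \<rho> x * \<Psi> h x) + snorm r (\<lambda>x. (a x + L h x) * \<tau> x)
          + snorm r (\<lambda>x. L h x * M h x)"
      using sobolev_add(2)[OF sobolev_add(1)[OF m1(1) m2(1)] m3(1)] sobolev_add(2)[OF m1(1) m2(1)] by linarith
    moreover have "C * (K1 * n\<^sup>2) * (Nb + A2 + K2) + C * (Na + A1) * (K2 * n\<^sup>2) + C * (A1 * n) * (A2 * n) = K * n\<^sup>2"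
      unfolding K_def by (simp add: power2_eq_square algebra_simps)
    moreover have "(\<lambda>x. \<Phi> h x * \<Psi> h x - a x * b x - (a x * M h x + b x * L h x))
        = (\<lambda>x. (\<rho> x * \<Psi> h x + (a x + L h x) * \<tau> x) + L h x * M h x)"
      by (simp add: fun_eq_iff \<rho>_def \<tau>_def algebra_simps)
    ultimately show ?case
      using sobolev_mult(1)[OF 1(6)[OF h d(1)] \<Psi>(1) r] by (simp add: n_def)
  qed (use 1 2 K0 in \<open>auto intro!: sobolev_mult linear_map_add linear_map_mult ab r
        expands_linear[OF e(1)] expands_linear[OF e(2)]\<close>)
qed

lemma expands_compose_linear:
  assumes e: "expands s r \<Phi> a L" and T: "linear_map r q T"
  shows "expands s q (\<lambda>h. T (\<Phi> h)) (T a) (\<lambda>h. T (L h))"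
proof -
  obtain A1 K1 \<delta>1 where "expansion_bounds s r \<Phi> a L A1 K1 \<delta>1"
    by (rule expandsE[OF e])
  note 1 = expansion_boundsD[OF this]
  obtain K where K: "K \<ge> 0" "\<forall>h\<in>sobolev r. snorm q (T h) \<le> K * snorm r h"
    using T unfolding linear_map_def by blast
  have Tadd: "T (\<lambda>x. h x + k x) = (\<lambda>x. T h x + T k x)" if "h \<in> sobolev r" "k \<in> sobolev r" for h k
    using T that unfolding linear_map_def by blast
  have Tc: "T (\<lambda>x. c * h x) = (\<lambda>x. c * T h x)" if "h \<in> sobolev r" for h c
    using T that unfolding linear_map_def by blast
  have Td: "T (\<lambda>x. h x - k x) = (\<lambda>x. T h x - T k x)" if "h \<in> sobolev r" "k \<in> sobolev r" for h k
    using Tadd[OF that(1) sobolev_cmult[OF that(2), of "-1"]] Tc[OF that(2), of "-1"] by simp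
  note L = expands_linear[OF e]
  have "linear_map s q (\<lambda>h. T (L h))"
  proof -
    have "snorm q (T (L h)) \<le> K * A1 * snorm s h" if h: "h \<in> sobolev s" for h
      using bspec[OF K(2) linear_map_sobolev[OF L h]] mult_left_mono[OF 1(5)[OF h] K(1)]
      by (simp add: mult.assoc)
    moreover have "K * A1 \<ge> 0" using K 1 by simp
    ultimately show ?thesis
      using L linear_map_sobolev[OF T linear_map_sobolev[OF L]] Tadd Tc
      unfolding linear_map_def by (auto 0 4)
  qed
  then show ?thesis
  proof (rule expandsI[where K = "K * K1" and \<delta> = \<delta>1, rotated], goal_cases)
    case (3 h)
    have i: "(\<lambda>x. \<Phi> h x - a x) \<in> sobolev r" "(\<lambda>x. \<Phi> h x - a x - L h x) \<in> sobolev r"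
      using 3 by (auto intro!: sobolev_diff 1 expands_value[OF e] linear_map_sobolev[OF L])
    have "(\<lambda>x. T (\<Phi> h) x - T a x - T (L h) x) = T (\<lambda>x. \<Phi> h x - a x - L h x)"
      using Td[OF i(1) linear_map_sobolev[OF L 3(1)]] Td[OF 1(6)[OF 3] expands_value[OF e]] by simp
    moreover have "snorm q (T (\<lambda>x. \<Phi> h x - a x - L h x)) \<le> K * (K1 * (snorm s h)\<^sup>2)"
      using bspec[OF K(2) i(2)] mult_left_mono[OF 1(7)[OF 3] K(1)] by linarith
    ultimately show ?case
      using linear_map_sobolev[OF T 1(6)[OF 3]] by (simp add: mult.assoc)
  qed (use K 1 linear_map_sobolev[OF T expands_value[OF e]] in auto)
qed

lemma linear_map_embedding:
  assumes "q \<le> r"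
  shows "linear_map r q (\<lambda>h. h)"
  using sobolev_mono[OF _ assms] unfolding linear_map_def by (auto intro!: exI[of _ 1])

lemma linear_map_cmult: "linear_map r r (\<lambda>h x. c * h x)"
  unfolding linear_map_def
  by (auto simp: sobolev_cmult sobolev_norm_cmult algebra_simps intro!: exI[of _ "\<bar>c\<bar>"])

lemma linear_map_solve:
  assumes "\<epsilon> \<in> {1, -1}" "r > 1/2"
  shows "linear_map r (r + 1) (solve \<epsilon>)"
  using solve_sobolev[OF assms] solve_add[OF assms] solve_cmult[OF assms]
  unfolding linear_map_def by (auto simp: fun_eq_iff intro!: exI[of _ 1])

lemma linear_map_deriv:
  assumes "r > 3/2"
  shows "linear_map r (r - 1) deriv"
proof -
  have "deriv (\<lambda>x. h x + k x) = (\<lambda>x. deriv h x + deriv k x)" if "h \<in> sobolev r" "k \<in> sobolev r" for h k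
    using DERIV_add[OF sobolev_deriv(1) sobolev_deriv(1), OF that(1) assms that(2) assms]
    by (auto intro!: DERIV_imp_deriv)
  moreover have "deriv (\<lambda>x. c * h x) = (\<lambda>x. c * deriv h x)" if "h \<in> sobolev r" for h c
    using DERIV_cmult[OF sobolev_deriv(1)[OF that assms]] by (auto intro!: DERIV_imp_deriv)
  ultimately show ?thesis
    unfolding linear_map_def using sobolev_deriv[OF _ assms] by (auto intro!: exI[of _ 1])
qed

lemma expands_id: "expands s s (\<lambda>h. h) (\<lambda>x. 0) (\<lambda>h. h)"
  by (rule expandsI[where K = 0 and \<delta> = 1])
     (use sobolev_const(1)[of 0 s] sobolev_const(2)[of s 0] linear_map_embedding[of s s] in auto)

lemma expands_exp:
  assumes s: "s > 1/2" and \<epsilon>: "\<epsilon> \<in> {1, -1}"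
  shows "expands s s (\<lambda>h x. exp (\<epsilon> * h x)) (\<lambda>x. 1) (\<lambda>h x. \<epsilon> * h x)"
\<comment> \<open>The radius ensures \<open>alg s * snorm s h \<le> 1/2\<close>, as the power series
  requires.\<close>
proof (rule expandsI[where K = "rem s" and \<delta> = "1 / (2 * alg s)"], goal_cases)
  case (5 h)
  have e: "\<bar>\<epsilon>\<bar> = 1" using \<epsilon> by auto
  have "alg s * snorm s (\<lambda>x. \<epsilon> * h x) \<le> 1/2"
    using 5(2) alg_ge(1)[of s] by (simp add: sobolev_norm_cmult e field_simps)
  from sobolev_exp[OF sobolev_cmult[OF 5(1)] s this] show ?case
    by (simp add: sobolev_norm_cmult e)
qed (use alg_ge(1)[of s] sobolev_const(1)[of 1 s] linear_map_cmult in auto)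

lemma expands_inverse:
  assumes s: "s > 3/2"
  shows "expands s (s - 1) (\<lambda>h x. 1 / (1 + deriv h x)) (\<lambda>x. 1) (\<lambda>h x. - 1 * deriv h x)"
proof (rule expandsI[where K = "rem (s - 1)" and \<delta> = "1 / (2 * alg (s - 1))"], goal_cases)
  case 2
  have "expands s (s - 1) (\<lambda>h x. - 1 * deriv h x) (\<lambda>x. - 1 * deriv (\<lambda>x. 0) x) (\<lambda>h x. - 1 * deriv h x)"
    by (rule expands_compose_linear[OF expands_compose_linear[OF expands_id] linear_map_cmult])
       (rule linear_map_deriv[OF s])
  then show ?case by (rule expands_linear)
next
  case (5 h)
  note d = sobolev_deriv[OF 5(1) s]
  have s1: "s - 1 > 1/2" using s by simp
  have "alg (s - 1) * snorm (s - 1) (deriv h) \<le> alg (s - 1) * snorm s h"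
    using alg_ge(1)[of "s - 1"] d(3) by (intro mult_left_mono) auto
  also have "\<dots> \<le> 1/2" using 5(2) alg_ge(1)[of "s - 1"] by (simp add: field_simps)
  finally have small: "alg (s - 1) * snorm (s - 1) (deriv h) \<le> 1/2" .
  note i = sobolev_inverse[OF d(2) s1 small]
  have "(snorm (s - 1) (deriv h))\<^sup>2 \<le> (snorm s h)\<^sup>2"
    by (intro power_mono d(3) sobolev_norm_nonneg)
  then have "rem (s - 1) * (snorm (s - 1) (deriv h))\<^sup>2
      \<le> rem (s - 1) * (snorm s h)\<^sup>2"
    by (intro mult_left_mono) auto
  then show ?case using i(1) order.trans[OF i(3)] by simp
qed (use alg_ge(1)[of "s - 1"] sobolev_const(1)[of 1 "s - 1"] in auto)

lemma expands_deriv: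
  assumes "s > 3/2"
  shows "expands s (s - 1) deriv (\<lambda>x. 0) deriv"
  using expands_compose_linear[OF expands_id linear_map_deriv[OF assms]] by simp

section \<open>The conjugated operator \<open>A\<inverse> \<partial>\<^sub>x\<close>\<close>

text \<open>
  For \<open>g = \<alpha> + \<beta> / \<phi>'\<^sup>2\<close> with \<open>\<phi> = id + h\<close>, \<open>flux\<close> is \<open>\<phi>' g\<close> and \<open>transport \<epsilon>\<close> is
  \<open>((1 - \<epsilon> \<partial>\<^sub>x)\<inverse> (\<epsilon> g \<circ> \<phi>\<inverse>)) \<circ> \<phi>\<close>, the periodic solution of \<open>\<sigma>' = \<epsilon> \<phi>' \<sigma> - \<phi>' g\<close>. The
  substitution \<open>\<sigma> = exp (\<epsilon> h) \<tau>\<close> reduces this to the constant coefficient equation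
  \<open>\<tau>' - \<epsilon> \<tau> = - exp (- \<epsilon> h) \<phi>' g\<close>.
\<close>

abbreviation flux :: "(real \<Rightarrow> real) \<Rightarrow> (real \<Rightarrow> real) \<Rightarrow> (real \<Rightarrow> real) \<Rightarrow> real \<Rightarrow> real" where
  "flux \<alpha> \<beta> h x \<equiv> \<alpha> x * (1 + deriv h x) + \<beta> x * (1 / (1 + deriv h x))"

abbreviation (input) wflux :: "real \<Rightarrow> (real \<Rightarrow> real) \<Rightarrow> (real \<Rightarrow> real) \<Rightarrow> (real \<Rightarrow> real) \<Rightarrow> real \<Rightarrow> real" where
  "wflux \<epsilon> \<alpha> \<beta> h x \<equiv> exp (- \<epsilon> * h x) * flux \<alpha> \<beta> h x"

definition transport :: "real \<Rightarrow> (real \<Rightarrow> real) \<Rightarrow> (real \<Rightarrow> real) \<Rightarrow> (real \<Rightarrow> real) \<Rightarrow> real \<Rightarrow> real" where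
  "transport \<epsilon> \<alpha> \<beta> h x =
     - (exp (\<epsilon> * h x) * solve \<epsilon> (wflux \<epsilon> \<alpha> \<beta> h) x)"

definition transport0 :: "real \<Rightarrow> (real \<Rightarrow> real) \<Rightarrow> (real \<Rightarrow> real) \<Rightarrow> real \<Rightarrow> real" where
  "transport0 \<epsilon> \<alpha> \<beta> x = - solve \<epsilon> (\<lambda>x. \<alpha> x + \<beta> x) x"

text \<open>The first variation of \<open>transport\<close> at \<open>h = 0\<close>: the term under
  \<open>solve\<close> varies the flux and the weight \<open>exp (- \<epsilon> * h)\<close>, the
  last term varies the outer factor \<open>exp (\<epsilon> * h)\<close>.\<close>

definition transport_lin :: "real \<Rightarrow> (real \<Rightarrow> real) \<Rightarrow> (real \<Rightarrow> real) \<Rightarrow> (real \<Rightarrow> real) \<Rightarrow> real \<Rightarrow> real" where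
  "transport_lin \<epsilon> \<alpha> \<beta> h x =
     - solve \<epsilon> (\<lambda>x. (\<alpha> x - \<beta> x) * deriv h x - \<epsilon> * h x * (\<alpha> x + \<beta> x)) x
     + \<epsilon> * h x * transport0 \<epsilon> \<alpha> \<beta> x"

lemma expands_cong:
  assumes "expands s r \<Phi> a L"
    and "\<And>h x. \<Phi> h x = \<Phi>' h x" "\<And>x. a x = a' x" "\<And>h x. L h x = L' h x"
  shows "expands s r \<Phi>' a' L'"
proof -
  have "\<Phi> = \<Phi>'" "a = a'" "L = L'" using assms by (auto simp: fun_eq_iff)
  then show ?thesis using assms by simp
qed

context
  fixes s \<epsilon> :: real and \<alpha> \<beta> :: "real \<Rightarrow> real"
  assumes s: "s > 3/2" and \<epsilon>: "\<epsilon> \<in> {1, -1}" and \<alpha>: "\<alpha> \<in> sobolev (s - 1)" and \<beta>: "\<beta> \<in> sobolev (s - 1)"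
begin

lemma expands_flux:
  "expands s (s - 1) (\<lambda>h x. flux \<alpha> \<beta> h x)
     (\<lambda>x. \<alpha> x + \<beta> x) (\<lambda>h x. (\<alpha> x - \<beta> x) * deriv h x)"
proof -
  have s1: "s - 1 > 1/2" using s by simp
  show ?thesis
    by (rule expands_cong[OF expands_add[OF
          expands_mult[OF expands_const[OF \<alpha>] expands_add[OF expands_const[OF sobolev_const(1)[of 1]] expands_deriv[OF s]] s1]
          expands_mult[OF expands_const[OF \<beta>] expands_inverse[OF s] s1]]])
       (simp_all add: algebra_simps)
qed

lemma expands_weighted_flux:
  "expands s (s - 1) (\<lambda>h x. exp (- \<epsilon> * h x) * flux \<alpha> \<beta> h x)
     (\<lambda>x. \<alpha> x + \<beta> x) (\<lambda>h x. (\<alpha> x - \<beta> x) * deriv h x - \<epsilon> * h x * (\<alpha> x + \<beta> x))"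
proof -
  have s1: "s - 1 > 1/2" and s2: "s > 1/2" and s3: "s - 1 \<le> s" using s by simp_all
  have \<epsilon>': "- \<epsilon> \<in> {1, -1}" using \<epsilon> by auto
  show ?thesis
    by (rule expands_cong[OF expands_mult[OF
          expands_compose_linear[OF expands_exp[OF s2 \<epsilon>'] linear_map_embedding[OF s3]] expands_flux s1]])
       (simp_all add: algebra_simps)
qed

text \<open>Here the derivative is recovered: the weighted flux involves \<open>deriv h\<close> and
  is expanded only in class \<open>s - 1\<close>, but \<open>solve\<close> maps back to class
  \<open>s\<close>, where the outer exponential is expanded as well.\<close>

lemma expands_transport: "expands s s (transport \<epsilon> \<alpha> \<beta>) (transport0 \<epsilon> \<alpha> \<beta>) (transport_lin \<epsilon> \<alpha> \<beta>)"
proof -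
  have s1: "s - 1 > 1/2" and s2: "s > 1/2" using s by simp_all
  have lin: "linear_map (s - 1) s (solve \<epsilon>)" using linear_map_solve[OF \<epsilon> s1] by simp
  show ?thesis
    by (rule expands_cong[OF expands_compose_linear[OF expands_mult[OF expands_exp[OF s2 \<epsilon>]
            expands_compose_linear[OF expands_weighted_flux lin] s2] linear_map_cmult[of _ "-1"]]])
       (simp_all add: transport_def transport0_def transport_lin_def)
qed

lemma transport_has_derivative:
  assumes h: "h \<in> sobolev s"
    and m: "(wflux \<epsilon> \<alpha> \<beta> h) \<in> sobolev (s - 1)"
  shows "(transport \<epsilon> \<alpha> \<beta> h has_real_derivative
     \<epsilon> * (1 + deriv h x) * transport \<epsilon> \<alpha> \<beta> h x - flux \<alpha> \<beta> h x) (at x)"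
proof -
  have s1: "s - 1 > 1/2" using s by simp
  show ?thesis
    unfolding transport_def
    by (rule derivative_eq_intros solve_has_derivative[OF \<epsilon> s1 m] sobolev_deriv(1)[OF h s] refl)+
       (simp add: algebra_simps exp_minus_inverse)
qed

lemma transport0_has_derivative:
  "(transport0 \<epsilon> \<alpha> \<beta> has_real_derivative \<epsilon> * transport0 \<epsilon> \<alpha> \<beta> x - (\<alpha> x + \<beta> x)) (at x)"
proof -
  have s1: "s - 1 > 1/2" using s by simp
  show ?thesis
    unfolding transport0_def
    by (rule derivative_eq_intros solve_has_derivative[OF \<epsilon> s1 sobolev_add(1)[OF \<alpha> \<beta>]] refl)+
       (simp add: algebra_simps)
qed

text \<open>This is the formal linearization at \<open>h = 0\<close> of the differential equation
  for \<open>transport\<close>. It characterizes the derivative by a local relation, which later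
  integrations by parts use in place of the explicit formula.\<close>

lemma transport_lin_has_derivative:
  assumes h: "h \<in> sobolev s"
  shows "(transport_lin \<epsilon> \<alpha> \<beta> h has_real_derivative
     \<epsilon> * transport_lin \<epsilon> \<alpha> \<beta> h x + \<epsilon> * deriv h x * transport0 \<epsilon> \<alpha> \<beta> x - (\<alpha> x - \<beta> x) * deriv h x) (at x)"
proof -
  have s1: "s - 1 > 1/2" using s by simp
  have e2: "\<epsilon> * (\<epsilon> * y) = y" for y using \<epsilon> by auto
  note m = linear_map_sobolev[OF expands_linear[OF expands_weighted_flux] h]
  show ?thesis
    unfolding transport_lin_def
    by (rule derivative_eq_intros solve_has_derivative[OF \<epsilon> s1 m] sobolev_deriv(1)[OF h s]
          transport0_has_derivative refl)+
       (simp add: algebra_simps e2)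
qed

end

text \<open>A half sum although \<open>A\<inverse> d/dx\<close> is a half difference of resolvents:
  the minus sign is carried by the factor \<open>\<epsilon>\<close> inside
  \<open>transport (-1)\<close>.\<close>

definition conj_op :: "(real \<Rightarrow> real) \<Rightarrow> (real \<Rightarrow> real) \<Rightarrow> (real \<Rightarrow> real) \<Rightarrow> real \<Rightarrow> real" where
  "conj_op \<alpha> \<beta> h x = (transport 1 \<alpha> \<beta> h x + transport (-1) \<alpha> \<beta> h x) / 2"

definition conj_op0 :: "(real \<Rightarrow> real) \<Rightarrow> (real \<Rightarrow> real) \<Rightarrow> real \<Rightarrow> real" where
  "conj_op0 \<alpha> \<beta> x = (transport0 1 \<alpha> \<beta> x + transport0 (-1) \<alpha> \<beta> x) / 2"

definition conj_op_lin :: "(real \<Rightarrow> real) \<Rightarrow> (real \<Rightarrow> real) \<Rightarrow> (real \<Rightarrow> real) \<Rightarrow> real \<Rightarrow> real" where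
  "conj_op_lin \<alpha> \<beta> h x = (transport_lin 1 \<alpha> \<beta> h x + transport_lin (-1) \<alpha> \<beta> h x) / 2"

lemma expands_conj_op:
  assumes s: "s > 3/2" and \<alpha>: "\<alpha> \<in> sobolev (s - 1)" and \<beta>: "\<beta> \<in> sobolev (s - 1)"
  shows "expands s s (conj_op \<alpha> \<beta>) (conj_op0 \<alpha> \<beta>) (conj_op_lin \<alpha> \<beta>)"
  by (rule expands_cong[OF expands_compose_linear[OF expands_add[OF
        expands_transport[OF s _ \<alpha> \<beta>, of 1] expands_transport[OF s _ \<alpha> \<beta>, of "-1"]] linear_map_cmult[of _ "1/2"]]])
     (simp_all add: conj_op_def conj_op0_def conj_op_lin_def)

section \<open>Lifts of circle diffeomorphisms and their inverses\<close>

context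
  fixes s :: real and h \<phi> :: "real \<Rightarrow> real"
  assumes s: "s > 3/2" and h: "h \<in> sobolev s" and pos: "\<And>x. 1 + deriv h x > 0"
    and \<phi>: "\<And>x. \<phi> x = x + h x"
begin

lemma lift_has_derivative: "(\<phi> has_real_derivative 1 + deriv h x) (at x)"
  unfolding \<phi>[abs_def] by (auto intro!: derivative_eq_intros sobolev_deriv(1)[OF h s])

lemma lift_isCont: "isCont \<phi> x"
  using lift_has_derivative DERIV_isCont by blast

lemma lift_bij: "bij \<phi>"
proof -
  have mono: "\<phi> x < \<phi> y" if "x < y" for x y
    using DERIV_pos_imp_increasing[OF that, of \<phi>] lift_has_derivative pos by blast
  have "inj \<phi>"
    by (rule injI) (metis mono linorder_neqE order_less_irrefl)
  moreover have "\<exists>x. \<phi> x = y" for y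
  proof -
    \<comment> \<open>A lift displaces every point by at most the sup norm of \<open>h\<close>, so
      \<open>y\<close> lies between the values at \<open>y - B\<close> and
      \<open>y + B\<close>.\<close>
    define B where "B = emb s * snorm s h"
    have B: "\<bar>h x\<bar> \<le> B" for x unfolding B_def using s by (intro sobolev_sup_bound h) simp
    have "\<phi> (y - B) \<le> y" "y \<le> \<phi> (y + B)"
      using B[of "y - B"] B[of "y + B"] unfolding \<phi> by linarith+
    moreover have "y - B \<le> y + B" using B[of 0] by linarith
    ultimately show ?thesis
      using IVT[of \<phi> "y - B" y "y + B"] lift_isCont by auto
  qed
  then have "surj \<phi>" by (metis surjI)
  ultimately show ?thesis by (rule bijI)
qed

lemma lift_inv: "\<phi> (inv \<phi> y) = y" "inv \<phi> (\<phi> x) = x"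
  using lift_bij by (auto simp: bij_is_surj bij_is_inj surj_f_inv_f)

lemma lift_inv_periodic: "inv \<phi> (y + 1) = inv \<phi> y + 1"
proof -
  have "\<phi> (inv \<phi> y + 1) = y + 1"
    using lift_inv(1)[of y] sobolev_periodic[OF h] by (simp add: \<phi>)
  then show ?thesis using lift_inv(2) by metis
qed

lemma lift_inv_has_derivative:
  "(inv \<phi> has_real_derivative 1 / (1 + deriv h (inv \<phi> y))) (at y)"
proof -
  have "isCont (inv \<phi>) (\<phi> (inv \<phi> y))"
    by (rule isCont_inverse_function[of 1]) (auto simp: lift_inv lift_isCont)
  then have "isCont (inv \<phi>) y" by (simp only: lift_inv)
  then have "(inv \<phi> has_real_derivative inverse (1 + deriv h (inv \<phi> y))) (at y)"
    using pos[of "inv \<phi> y"]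
    by (intro DERIV_inverse_function[where f = \<phi> and g = "inv \<phi>" and a = "y - 1" and b = "y + 1"]
        lift_has_derivative) (auto simp: lift_inv)
  then show ?thesis by (simp add: inverse_eq_divide)
qed

lemma has_derivative_compose_lift_inv:
  assumes "\<And>x. (f has_real_derivative f' x) (at x)"
  shows "((\<lambda>y. f (inv \<phi> y)) has_real_derivative f' (inv \<phi> y) / (1 + deriv h (inv \<phi> y))) (at y)"
  using DERIV_chain2[OF assms lift_inv_has_derivative] by simp

lemma continuous_on_lift_inv: "continuous_on S (inv \<phi>)"
  by (rule continuous_at_imp_continuous_on) (use lift_inv_has_derivative DERIV_isCont in blast)

end

text \<open>Solutions are multiples of \<open>exp (k * x)\<close>, and over one period such a
  function is multiplied by \<open>exp k\<close>, which differs from 1.\<close>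

lemma periodic_exponential_zero:
  fixes f :: "real \<Rightarrow> real"
  assumes d: "\<And>x. (f has_real_derivative k * f x) (at x)" and per: "\<And>x. f (x + 1) = f x" and k: "k \<noteq> 0"
  shows "f x = 0"
proof -
  let ?g = "\<lambda>x. f x * exp (- k * x)"
  have "(?g has_real_derivative 0) (at x)" for x
    by (rule derivative_eq_intros d refl)+ (simp add: algebra_simps)
  then have "?g (x + 1) = ?g x" by (rule DERIV_isconst_all[rule_format]) 
  moreover have "exp (- k * (x + 1)) = exp (- k * x) * exp (- k)"
    by (simp add: algebra_simps flip: exp_add)
  ultimately have "f x * exp (- k * x) * exp (- k) = f x * exp (- k * x)"
    by (simp only: per mult.assoc)
  then show ?thesis using k by auto
qed

text \<open>Factorization of the operator into two first order ones: for \<open>d = f - g\<close>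
  with \<open>d'' = d\<close> the function \<open>w = d' + d\<close> satisfies \<open>w' = w\<close>
  and vanishes by periodicity; then \<open>d' = - d\<close> and \<open>d\<close> vanishes
  too.\<close>

lemma inj_on_helmholtz: "inj_on helmholtz C2_circle"
proof (rule inj_onI)
  fix f g assume f: "f \<in> C2_circle" and g: "g \<in> C2_circle" and eq: "helmholtz f = helmholtz g"
  have D: "(p has_real_derivative deriv p x) (at x)" "(deriv p has_real_derivative deriv (deriv p) x) (at x)"
    "p (x + 1) = p x" if "p \<in> C2_circle" for p x
    using that by (auto simp: C2_circle_def DERIV_deriv_iff_real_differentiable)
  have per': "deriv p (x + 1) = deriv p x" if p: "p \<in> C2_circle" for p x
  proof -
    have "((\<lambda>x. p (x + 1)) has_real_derivative deriv p (x + 1)) (at x)"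
      using DERIV_shift[THEN iffD1, OF D(1)[OF p, of "x + 1"]] .
    then have "(p has_real_derivative deriv p (x + 1)) (at x)" by (simp only: D(3)[OF p])
    then show ?thesis by (rule DERIV_imp_deriv[symmetric])
  qed
  have dd: "deriv (deriv f) x - deriv (deriv g) x = f x - g x" for x
    using fun_cong[OF eq, of x] by (simp add: helmholtz_def)
  let ?w = "\<lambda>x. (deriv f x - deriv g x) + (f x - g x)"
  have w: "?w x = 0" for x
  proof (rule periodic_exponential_zero[where k = 1 and f = ?w])
    show "(?w has_real_derivative 1 * ?w x) (at x)" for x
      by (rule derivative_eq_intros D f g refl)+ (use dd in \<open>simp add: algebra_simps\<close>)
    show "?w (x + 1) = ?w x" for x by (simp only: D(3) per' f g)
  qed simp
  have "f x - g x = 0" for x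
  proof (rule periodic_exponential_zero[where k = "-1" and f = "\<lambda>x. f x - g x"])
    show "((\<lambda>x. f x - g x) has_real_derivative - 1 * (f x - g x)) (at x)" for x
      by (rule derivative_eq_intros D f g refl)+ (use w[of x] in \<open>simp add: algebra_simps\<close>)
    show "f (x + 1) - g (x + 1) = f x - g x" for x by (simp only: D(3) f g)
  qed simp
  then show "f = g" by (simp add: fun_eq_iff)
qed

lemma helmholtz_inv_eqI:
  assumes "\<And>x. f (x + 1) = f x" "\<And>x. (f has_real_derivative f' x) (at x)"
    "\<And>x. (f' has_real_derivative f'' x) (at x)" "continuous_on UNIV f''" "\<And>x. f x - f'' x = g x"
  shows "helmholtz_inv g = f"
proof -
  have d: "deriv f = f'" "deriv f' = f''" using assms DERIV_imp_deriv by blast+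
  have "f \<in> C2_circle"
    unfolding C2_circle_def using assms d by (auto simp: real_differentiable_def)
  moreover have "helmholtz f = g" unfolding helmholtz_def d using assms(5) by auto
  ultimately show ?thesis
    unfolding helmholtz_inv_def using the_inv_into_f_f[OF inj_on_helmholtz] by blast
qed

text \<open>The half sum \<open>q\<close> and the half difference \<open>r\<close> of the two
  transports satisfy \<open>q' = \<phi>' * (r - g)\<close> and \<open>r' = \<phi>' * q\<close>.
  Composition with \<open>inv \<phi>\<close> divides derivatives by \<open>\<phi>'\<close> and
  leaves \<open>Q' = R - G\<close>, \<open>R' = Q\<close>, hence \<open>Q - Q'' = G'\<close>. As
  \<open>s - 1 > 3/2\<close>, \<open>G\<close> is continuously differentiable and \<open>Q\<close>
  lies in \<open>C2_circle\<close>.\<close>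

lemma helmholtz_inv_deriv_conj:
  assumes s: "s > 5/2" and h: "h \<in> sobolev s" and pos: "\<And>x. 1 + deriv h x > 0"
    and \<phi>: "\<And>x. \<phi> x = x + h x"
    and \<alpha>: "\<alpha> \<in> sobolev (s - 1)" and \<beta>: "\<beta> \<in> sobolev (s - 1)"
    and m: "\<And>\<epsilon>. \<epsilon> \<in> {1, -1} \<Longrightarrow>
      (wflux \<epsilon> \<alpha> \<beta> h) \<in> sobolev (s - 1)"
  shows "helmholtz_inv (deriv (\<lambda>y. \<alpha> (inv \<phi> y) + \<beta> (inv \<phi> y) / (1 + deriv h (inv \<phi> y))\<^sup>2)) =
     (\<lambda>y. conj_op \<alpha> \<beta> h (inv \<phi> y))"
proof -
  have s': "s > 3/2" "s - 1 > 3/2" using s by auto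
  define q where "q = conj_op \<alpha> \<beta> h"
  define r where "r x = (transport 1 \<alpha> \<beta> h x - transport (-1) \<alpha> \<beta> h x) / 2" for x
  define g where "g x = \<alpha> x + \<beta> x / (1 + deriv h x)\<^sup>2" for x
  define g' where "g' x = deriv \<alpha> x + (deriv \<beta> x * (1 + deriv h x) - 2 * \<beta> x * deriv (deriv h) x) / (1 + deriv h x) ^ 3" for x
  let ?F = "\<lambda>x. flux \<alpha> \<beta> h x"
  have T1: "(transport 1 \<alpha> \<beta> h has_real_derivative
      (1 + deriv h x) * transport 1 \<alpha> \<beta> h x - ?F x) (at x)" for x
    using transport_has_derivative[OF s'(1) _ \<alpha> \<beta> h m, of 1 x] by simp
  have T2: "(transport (-1) \<alpha> \<beta> h has_real_derivative
      - (1 + deriv h x) * transport (-1) \<alpha> \<beta> h x - ?F x) (at x)" for x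
    using transport_has_derivative[OF s'(1) _ \<alpha> \<beta> h m, of "-1" x] by simp
  have nz: "1 + deriv h x \<noteq> 0" for x using pos[of x] by simp
  note h' = sobolev_deriv(2)[OF h s'(1)]
  have q': "(q has_real_derivative (1 + deriv h x) * (r x - g x)) (at x)" for x
  proof -
    have "((y * a - (c * y + b * (1 / y))) + (- y * d - (c * y + b * (1 / y)))) / 2
        = y * ((a - d) / 2 - (c + b / y\<^sup>2))" if "y \<noteq> 0" for a b c d y :: real
      using that by (simp add: field_simps power2_eq_square)
    from this[OF nz[of x]] show ?thesis
      unfolding q_def conj_op_def[abs_def] r_def g_def
      by (intro DERIV_cong[OF DERIV_cdivide[OF DERIV_add[OF T1 T2]]])
  qed
  have r': "(r has_real_derivative (1 + deriv h x) * q x) (at x)" for x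
    unfolding r_def[abs_def] q_def conj_op_def
    by (rule DERIV_cong[OF DERIV_cdivide[OF DERIV_diff[OF T1 T2]]]) (simp add: algebra_simps)
  have g1: "(g has_real_derivative g' x) (at x)" for x
  proof -
    have "((\<lambda>x. 1 + deriv h x) has_real_derivative deriv (deriv h) x) (at x)"
      by (auto intro!: derivative_eq_intros sobolev_deriv(1)[OF h' s'(2)])
    from DERIV_divide[OF sobolev_deriv(1)[OF \<beta> s'(2)] DERIV_power[OF this, of 2]]
    have D: "((\<lambda>x. \<beta> x / (1 + deriv h x)\<^sup>2) has_real_derivative
        (deriv \<beta> x * (1 + deriv h x)\<^sup>2 - \<beta> x * (2 * (deriv (deriv h) x * (1 + deriv h x)))) /
        ((1 + deriv h x)\<^sup>2 * (1 + deriv h x)\<^sup>2)) (at x)"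
      using nz[of x] by simp
    have eq: "(b * y\<^sup>2 - c * (2 * (d * y))) / (y\<^sup>2 * y\<^sup>2) = (b * y - 2 * c * d) / y ^ 3"
      if "y \<noteq> 0" for b c d y :: real
      using that by (simp add: field_simps power2_eq_square power3_eq_cube)
    show ?thesis
      unfolding g_def[abs_def] g'_def
      by (rule DERIV_cong[OF DERIV_add[OF sobolev_deriv(1)[OF \<alpha> s'(2)] D]]) (simp only: eq[OF nz])
  qed
  note comp = has_derivative_compose_lift_inv[OF s'(1) h pos \<phi>]
  have cq: "continuous_on UNIV q" "continuous_on UNIV g'"
  proof -
    show "continuous_on UNIV q"
      by (intro continuous_at_imp_continuous_on ballI DERIV_isCont[OF q'])
    show "continuous_on UNIV g'"
      unfolding g'_def
      by (intro continuous_intros sobolev_continuous[OF sobolev_deriv(2)[OF \<alpha> s'(2)]]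
          sobolev_continuous[OF sobolev_deriv(2)[OF \<beta> s'(2)]] sobolev_continuous[OF \<beta>]
          sobolev_continuous[OF sobolev_deriv(2)[OF h' s'(2)]] sobolev_continuous[OF h']) (auto simp: nz)
  qed
  have dg: "deriv (\<lambda>y. g (inv \<phi> y)) = (\<lambda>y. g' (inv \<phi> y) / (1 + deriv h (inv \<phi> y)))"
    using comp[OF g1] DERIV_imp_deriv by blast
  have "helmholtz_inv (deriv (\<lambda>y. g (inv \<phi> y))) = (\<lambda>y. q (inv \<phi> y))"
  proof (rule helmholtz_inv_eqI)
    have "q (x + 1) = q x" for x
    proof -
      have p: "f (x + 1) = f x" if "f \<in> {\<alpha>, \<beta>, h, deriv h}" for f
        using sobolev_periodic[OF \<alpha>] sobolev_periodic[OF \<beta>] sobolev_periodic[OF h] sobolev_periodic[OF h'] that by auto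
      show ?thesis
        unfolding q_def conj_op_def transport_def solve_def by (simp add: p fseries_periodic)
    qed
    then show "q (inv \<phi> (y + 1)) = q (inv \<phi> y)" for y
      by (simp add: lift_inv_periodic[OF s'(1) h pos \<phi>])
    show "((\<lambda>y. q (inv \<phi> y)) has_real_derivative r (inv \<phi> y) - g (inv \<phi> y)) (at y)" for y
      using comp[OF q', of y] nz by simp
    have "((\<lambda>x. r x - g x) has_real_derivative (1 + deriv h x) * q x - g' x) (at x)" for x
      by (rule derivative_eq_intros r' g1 refl)+
    from comp[OF this]
    show "((\<lambda>y. r (inv \<phi> y) - g (inv \<phi> y)) has_real_derivative
        q (inv \<phi> y) - g' (inv \<phi> y) / (1 + deriv h (inv \<phi> y))) (at y)" for y
      using nz by (simp add: diff_divide_distrib)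
    show "continuous_on UNIV (\<lambda>y. q (inv \<phi> y) - g' (inv \<phi> y) / (1 + deriv h (inv \<phi> y)))"
      using nz by (intro continuous_intros continuous_on_compose2[OF cq(1)] continuous_on_compose2[OF cq(2)]
          continuous_on_compose2[OF sobolev_continuous[OF h']] continuous_on_lift_inv[OF s'(1) h pos \<phi>]) auto
    show "q (inv \<phi> y) - (q (inv \<phi> y) - g' (inv \<phi> y) / (1 + deriv h (inv \<phi> y))) = deriv (\<lambda>y. g (inv \<phi> y)) y" for y
      unfolding dg by simp
  qed
  then show ?thesis unfolding g_def q_def .
qed

section \<open>The Christoffel map near the identity\<close>

abbreviation (input) dx :: "circle_pair \<Rightarrow> real \<Rightarrow> real" where
  "dx U x \<equiv> deriv (fst U) x"

abbreviation (input) uu :: "circle_pair \<Rightarrow> circle_pair \<Rightarrow> real \<Rightarrow> real" where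
  "uu U V x \<equiv> fst U x * fst V x"

abbreviation (input) dd :: "circle_pair \<Rightarrow> circle_pair \<Rightarrow> real \<Rightarrow> real" where
  "dd U V x \<equiv> 1/2 * (dx U x * dx V x)"

abbreviation (input) rr :: "circle_pair \<Rightarrow> circle_pair \<Rightarrow> real \<Rightarrow> real" where
  "rr U V x \<equiv> snd U x * snd V x"

abbreviation (input) mix :: "circle_pair \<Rightarrow> circle_pair \<Rightarrow> real \<Rightarrow> real" where
  "mix U V x \<equiv> dx U x * snd V x + dx V x * snd U x"

text \<open>The first component of the Christoffel map at the identity is minus
  \<open>A\<inverse> d/dx\<close> of this function.\<close>

abbreviation (input) pot :: "circle_pair \<Rightarrow> circle_pair \<Rightarrow> real \<Rightarrow> real" where
  "pot U V x \<equiv> uu U V x + dd U V x + 1/2 * rr U V x"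

text \<open>The Christoffel map at \<open>\<phi> = id + h\<close>. Each derivative of
  \<open>U \<circ> inv \<phi>\<close> produces a division by \<open>\<phi>'\<close>, so the product
  of two derivatives goes into the slot \<open>\<beta>\<close> of \<open>conj_op\<close>, which
  carries \<open>1 / \<phi>'^2\<close>, and undifferentiated products go into the slot
  \<open>\<alpha>\<close>.\<close>

definition chr_fst :: "circle_pair \<Rightarrow> circle_pair \<Rightarrow> (real \<Rightarrow> real) \<Rightarrow> real \<Rightarrow> real" where
  "chr_fst U V h x = - conj_op (uu U V) (dd U V) h x
     - 1/2 * conj_op (rr U V) (\<lambda>x. 0) h x"

definition chr_snd :: "circle_pair \<Rightarrow> circle_pair \<Rightarrow> (real \<Rightarrow> real) \<Rightarrow> real \<Rightarrow> real" where
  "chr_snd U V h x =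
     - 1/2 * mix U V x * (1 / (1 + deriv h x))"

definition chr_unit :: "circle_pair \<Rightarrow> circle_pair \<Rightarrow> circle_pair" where
  "chr_unit U V =
     (\<lambda>x. - conj_op0 (uu U V) (dd U V) x
          - 1/2 * conj_op0 (rr U V) (\<lambda>x. 0) x,
      \<lambda>x. - 1/2 * mix U V x)"

definition chr_lin :: "circle_pair \<Rightarrow> circle_pair \<Rightarrow> (real \<Rightarrow> real) \<Rightarrow> circle_pair" where
  "chr_lin U V h =
     (\<lambda>x. - conj_op_lin (uu U V) (dd U V) h x
          - 1/2 * conj_op_lin (rr U V) (\<lambda>x. 0) h x,
      \<lambda>x. 1/2 * mix U V x * deriv h x)"

lemma chr_unit_sym: "chr_unit U V = chr_unit V U"
  unfolding chr_unit_def by (simp add: mult.commute add.commute)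

lemma model_spaceD: "U \<in> model_space s \<Longrightarrow> fst U \<in> sobolev s" "U \<in> model_space s \<Longrightarrow> snd U \<in> sobolev (s - 1)"
  by (auto simp: model_space_def)

lemma chr_coefficients_sobolev:
  assumes s: "s > 5/2" and U: "U \<in> model_space s" and V: "V \<in> model_space s"
  shows "(uu U V) \<in> sobolev (s - 1)"
    "(dd U V) \<in> sobolev (s - 1)"
    "(rr U V) \<in> sobolev (s - 1)"
    "(\<lambda>x. - 1/2 * mix U V x) \<in> sobolev (s - 1)"
proof -
  have s1: "s > 3/2" "s - 1 > 1/2" "s - 1 \<le> s" using s by auto
  note m = sobolev_mono(1)[OF _ s1(3)]
  note UV = model_spaceD[OF U] model_spaceD[OF V]
  show "(uu U V) \<in> sobolev (s - 1)"
    "(dd U V) \<in> sobolev (s - 1)"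
    "(rr U V) \<in> sobolev (s - 1)"
    "(\<lambda>x. - 1/2 * mix U V x) \<in> sobolev (s - 1)"
    by (intro sobolev_mult sobolev_cmult sobolev_add sobolev_deriv(2) m UV s1)+
qed

lemma expands_chr_fst:
  assumes s: "s > 5/2" and U: "U \<in> model_space s" and V: "V \<in> model_space s"
  shows "expands s s (chr_fst U V) (fst (chr_unit U V)) (\<lambda>h. fst (chr_lin U V h))"
proof -
  have s1: "s > 3/2" using s by simp
  note c = chr_coefficients_sobolev[OF s U V]
  show ?thesis
    by (rule expands_cong[OF expands_add[OF
          expands_compose_linear[OF expands_conj_op[OF s1 c(1,2)] linear_map_cmult[of _ "-1"]]
          expands_compose_linear[OF expands_conj_op[OF s1 c(3) sobolev_const(1)[of 0]] linear_map_cmult[of _ "-1/2"]]]])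
       (simp_all add: chr_fst_def chr_unit_def chr_lin_def)
qed

lemma expands_chr_snd:
  assumes s: "s > 5/2" and U: "U \<in> model_space s" and V: "V \<in> model_space s"
  shows "expands s (s - 1) (chr_snd U V) (snd (chr_unit U V)) (\<lambda>h. snd (chr_lin U V h))"
proof -
  have s1: "s > 3/2" "s - 1 > 1/2" using s by simp_all
  note c = chr_coefficients_sobolev[OF s U V]
  show ?thesis
    by (rule expands_cong[OF expands_mult[OF expands_const[OF c(4)] expands_inverse[OF s1(1)] s1(2)]])
       (simp_all add: chr_snd_def chr_unit_def chr_lin_def)
qed

lemma chr_unit_model_space:
  assumes "s > 5/2" "U \<in> model_space s" "V \<in> model_space s"
  shows "chr_unit U V \<in> model_space s"
  using expands_value[OF expands_chr_fst[OF assms]] expands_value[OF expands_chr_snd[OF assms]]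
  by (metis model_space_def mem_Times_iff)

lemma chr_lin_model_space:
  assumes "s > 5/2" "U \<in> model_space s" "V \<in> model_space s" "h \<in> sobolev s"
  shows "chr_lin U V h \<in> model_space s"
  using linear_map_sobolev[OF expands_linear[OF expands_chr_fst[OF assms(1-3)]] assms(4)]
    linear_map_sobolev[OF expands_linear[OF expands_chr_snd[OF assms(1-3)]] assms(4)]
  by (metis model_space_def mem_Times_iff)

lemma weighted_flux_near_0:
  assumes s: "s > 3/2" and \<alpha>: "\<alpha> \<in> sobolev (s - 1)" and \<beta>: "\<beta> \<in> sobolev (s - 1)"
  shows "\<exists>\<delta>>0. \<forall>h\<in>sobolev s. snorm s h < \<delta> \<longrightarrow> (\<forall>\<epsilon>\<in>{1, -1}.
    (wflux \<epsilon> \<alpha> \<beta> h) \<in> sobolev (s - 1))"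
proof -
  have "\<exists>\<delta>>0. \<forall>h\<in>sobolev s. snorm s h < \<delta> \<longrightarrow>
    (wflux \<epsilon> \<alpha> \<beta> h) \<in> sobolev (s - 1)"
    if "\<epsilon> \<in> {1, -1}" for \<epsilon>
    using expands_weighted_flux[OF s that \<alpha> \<beta>] unfolding expands_def by blast
  from this[of 1] this[of "-1"] obtain \<delta>1 \<delta>2 where "\<delta>1 > 0" "\<delta>2 > 0"
    "\<forall>h\<in>sobolev s. snorm s h < \<delta>1 \<longrightarrow>
      (\<lambda>x. exp (- 1 * h x) * flux \<alpha> \<beta> h x) \<in> sobolev (s - 1)"
    "\<forall>h\<in>sobolev s. snorm s h < \<delta>2 \<longrightarrow>
      (\<lambda>x. exp (- (-1) * h x) * flux \<alpha> \<beta> h x) \<in> sobolev (s - 1)"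
    by blast
  then show ?thesis by (intro exI[of _ "min \<delta>1 \<delta>2"]) auto
qed

text \<open>Smallness of \<open>h\<close> serves only to place the weighted fluxes in class
  \<open>s - 1\<close>, for both signs of the exponent. The formula is uniform in \<open>f\<close>,
  since right translation involves the first component alone.\<close>

lemma christoffel_near_unit:
  assumes s: "s > 5/2" and U: "U \<in> model_space s" and V: "V \<in> model_space s"
  shows "\<exists>\<delta>>0. \<forall>h\<in>sobolev s. snorm s h < \<delta> \<and> (\<forall>x. 1 + deriv h x > 0) \<longrightarrow>
    (\<forall>f. christoffel (\<lambda>x. x + h x, f) U V = (chr_fst U V h, chr_snd U V h))"
proof -
  have s1: "s > 3/2" "s - 1 > 1/2" using s by simp_all
  note c = chr_coefficients_sobolev[OF s U V]
  obtain \<delta>1 where \<delta>1: "\<delta>1 > 0" and m1: "\<And>h \<epsilon>. h \<in> sobolev s \<Longrightarrow> snorm s h < \<delta>1 \<Longrightarrow> \<epsilon> \<in> {1, -1} \<Longrightarrow>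
    (\<lambda>x. exp (- \<epsilon> * h x) * (fst U x * fst V x * (1 + deriv h x)
        + 1/2 * (dx U x * dx V x) * (1 / (1 + deriv h x)))) \<in> sobolev (s - 1)"
    using weighted_flux_near_0[OF s1(1) c(1,2)] by blast
  obtain \<delta>2 where \<delta>2: "\<delta>2 > 0" and m2: "\<And>h \<epsilon>. h \<in> sobolev s \<Longrightarrow> snorm s h < \<delta>2 \<Longrightarrow> \<epsilon> \<in> {1, -1} \<Longrightarrow>
    (\<lambda>x. exp (- \<epsilon> * h x) * (snd U x * snd V x * (1 + deriv h x) + 0 * (1 / (1 + deriv h x)))) \<in> sobolev (s - 1)"
    using weighted_flux_near_0[OF s1(1) c(3) sobolev_const(1)[of 0]] by blast
  have "christoffel (\<lambda>x. x + h x, f) U V = (chr_fst U V h, chr_snd U V h)"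
    if h: "h \<in> sobolev s" and d: "snorm s h < \<delta>1" "snorm s h < \<delta>2"
      and pos: "\<forall>x. 1 + deriv h x > 0" for h f
  proof -
    define \<phi> where "\<phi> x = x + h x" for x
    define \<psi> where "\<psi> = inv \<phi>"
    have p: "1 + deriv h x > 0" for x using pos by blast
    note inv = lift_inv[OF s1(1) h p \<phi>_def, folded \<psi>_def]
    have D: "deriv (w \<circ> \<psi>) = (\<lambda>y. deriv w (\<psi> y) / (1 + deriv h (\<psi> y)))" if "w \<in> sobolev s" for w
      using has_derivative_compose_lift_inv[OF s1(1) h p \<phi>_def sobolev_deriv(1)[OF that s1(1)]]
      unfolding \<psi>_def o_def using DERIV_imp_deriv by blast
    note UV = model_spaceD[OF U] model_spaceD[OF V]
    have "christoffel0 (fst U \<circ> \<psi>) (fst V \<circ> \<psi>) =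
        - helmholtz_inv (deriv (\<lambda>y. fst U (\<psi> y) * fst V (\<psi> y)
            + 1/2 * (deriv (fst U) (\<psi> y) * deriv (fst V) (\<psi> y)) / (1 + deriv h (\<psi> y))\<^sup>2))"
      unfolding christoffel0_def D[OF UV(1)] D[OF UV(3)] by (simp add: power2_eq_square)
    also have "\<dots> = - (\<lambda>y. conj_op (uu U V) (dd U V) h (\<psi> y))"
      by (rule arg_cong[where f = uminus])
         (rule helmholtz_inv_deriv_conj[OF s h p \<phi>_def c(1,2) m1[OF h d(1)], folded \<psi>_def])
    finally have 1: "christoffel0 (fst U \<circ> \<psi>) (fst V \<circ> \<psi>) x =
        - conj_op (uu U V) (dd U V) h (\<psi> x)" for x
      by simp
    have 2: "helmholtz_inv (deriv (\<lambda>y. (snd U \<circ> \<psi>) y * (snd V \<circ> \<psi>) y)) =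
        (\<lambda>y. conj_op (rr U V) (\<lambda>x. 0) h (\<psi> y))"
      using helmholtz_inv_deriv_conj[OF s h p \<phi>_def c(3) sobolev_const(1)[of 0] m2[OF h d(2)], folded \<psi>_def]
      by simp
    have frac: "- 1/2 * (a / y * b + c / y * d) = - 1/2 * (a * b + c * d) * (1 / y)" for a b c d y :: real
      by (simp add: add_divide_distrib diff_divide_distrib mult.commute)
    have "christoffel (\<phi>, f) U V = (chr_fst U V h, chr_snd U V h)"
      unfolding christoffel_def compose_pair_def fst_conv \<psi>_def[symmetric] christoffel_unit.simps
        1 2 D[OF UV(1)] D[OF UV(3)] snd_conv
      by (simp only: prod.inject fun_eq_iff o_def inv chr_fst_def chr_snd_def frac simp_thms)
    then show ?thesis unfolding \<phi>_def[abs_def] .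
  qed
  then show ?thesis using \<delta>1 \<delta>2 by (intro exI[of _ "min \<delta>1 \<delta>2"]) auto
qed

section \<open>Points of the group near the identity and uniqueness of Frechet derivatives\<close>

lemma HsG_D:
  assumes s: "s > 3/2" and p: "p \<in> HsG s"
  shows "(\<lambda>x. fst p x - x) \<in> sobolev s" "dx p x = 1 + deriv (\<lambda>x. fst p x - x) x"
    "1 + deriv (\<lambda>x. fst p x - x) x > 0" "snd p \<in> sobolev (s - 1)"
proof -
  show h: "(\<lambda>x. fst p x - x) \<in> sobolev s" and "snd p \<in> sobolev (s - 1)"
    using p by (auto simp: HsG_def)
  have "((\<lambda>x. x + (fst p x - x)) has_real_derivative 1 + deriv (\<lambda>x. fst p x - x) x) (at x)"
    by (rule derivative_eq_intros sobolev_deriv(1)[OF h s] refl)+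
  then show d: "dx p x = 1 + deriv (\<lambda>x. fst p x - x) x" by (auto intro: DERIV_imp_deriv)
  show "1 + deriv (\<lambda>x. fst p x - x) x > 0"
    unfolding d[symmetric] using p by (auto simp: HsG_def)
qed

lemma HsG_I:
  assumes s: "s > 3/2" and h: "h \<in> sobolev s" "\<And>x. 1 + deriv h x > 0" and f: "f \<in> sobolev (s - 1)"
  shows "(\<lambda>x. x + h x, f) \<in> HsG s"
proof -
  have "((\<lambda>x. x + h x) has_real_derivative 1 + deriv h x) (at x)" for x
    by (auto intro!: derivative_eq_intros sobolev_deriv(1)[OF h(1) s])
  then have "deriv (\<lambda>x. x + h x) x = 1 + deriv h x" for x by (rule DERIV_imp_deriv)
  then show ?thesis using h f by (simp add: HsG_def)
qed

lemma unit_G_HsG: "s > 3/2 \<Longrightarrow> unit_G \<in> HsG s"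
  using HsG_I[of s "\<lambda>x. 0" "\<lambda>x. 0"] sobolev_const(1)[of 0] by (simp add: unit_G_def id_def)

text \<open>On one period, hence everywhere, \<open>\<phi>'\<close> has a positive minimum
  \<open>m\<close>, while the derivative of the direction is bounded by \<open>B\<close>. Steps
  shorter than \<open>m / (B + 1)\<close> therefore keep \<open>\<phi>'\<close> positive.\<close>

lemma HsG_radially_open:
  assumes s: "s > 3/2" and p: "p \<in> HsG s" and U: "U \<in> model_space s"
  shows "\<exists>t0>0. \<forall>t. 0 < t \<and> t < t0 \<longrightarrow> p + scale_pair t U \<in> HsG s"
proof -
  let ?h = "\<lambda>x. fst p x - x"
  note P = HsG_D[OF s p] and U' = model_spaceD[OF U]
  note dh = sobolev_deriv[OF P(1) s] and dU = sobolev_deriv[OF U'(1) s]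
  have s1: "s - 1 > 1/2" using s by simp
  obtain x0 where x0: "\<And>x. x \<in> {0..1} \<Longrightarrow> 1 + deriv ?h x0 \<le> 1 + deriv ?h x"
  proof -
    have "continuous_on {0..1} (\<lambda>x. 1 + deriv ?h x)"
      by (intro continuous_intros sobolev_continuous[OF dh(2)])
    then have "\<exists>x\<in>{0..1}. \<forall>y\<in>{0..1}. 1 + deriv ?h x \<le> 1 + deriv ?h y"
      by (intro continuous_attains_inf) auto
    then show ?thesis using that by blast
  qed
  define m where "m = 1 + deriv ?h x0"
  have m0: "m > 0" unfolding m_def by (rule P(3))
  have m: "m \<le> 1 + deriv ?h x" for x
  proof -
    have "deriv ?h x = deriv ?h (frac x)"
      using periodic_add_int[of "deriv ?h" "frac x" "\<lfloor>x\<rfloor>"] sobolev_periodic[OF dh(2)] by (simp add: frac_def)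
    then show ?thesis using x0[of "frac x"] frac_lt_1[of x] by (simp add: m_def)
  qed
  define B where "B = emb (s - 1) * snorm (s - 1) (deriv (fst U))"
  have B: "\<bar>dx U x\<bar> \<le> B" for x unfolding B_def by (rule sobolev_sup_bound[OF dU(2) s1])
  have B0: "B \<ge> 0" using B[of 0] by linarith
  have "p + scale_pair t U \<in> HsG s" if t: "0 < t" "t < m / (B + 1)" for t
  proof -
    have "t * (B + 1) < m" using t B0 by (simp add: field_simps)
    then have tB: "t * B < m" using t by (simp add: algebra_simps)
    have pos: "1 + deriv (\<lambda>x. ?h x + t * fst U x) x > 0" for x
    proof -
      have "((\<lambda>x. ?h x + t * fst U x) has_real_derivative deriv ?h x + t * dx U x) (at x)"
        by (intro DERIV_add DERIV_cmult dh(1) dU(1))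
      then have e: "deriv (\<lambda>x. ?h x + t * fst U x) x = deriv ?h x + t * dx U x"
        by (rule DERIV_imp_deriv)
      have "\<bar>t * dx U x\<bar> \<le> t * B" using B[of x] t by (simp add: abs_mult)
      then show ?thesis using tB m[of x] unfolding e by linarith
    qed
    have "(\<lambda>x. x + (?h x + t * fst U x), \<lambda>x. snd p x + t * snd U x) \<in> HsG s"
      by (intro HsG_I s pos sobolev_add sobolev_cmult P U')
    moreover have "p + scale_pair t U = (\<lambda>x. x + (?h x + t * fst U x), \<lambda>x. snd p x + t * snd U x)"
      by (simp add: prod_eq_iff fun_eq_iff scale_pair_def)
    ultimately show ?thesis by simp
  qed
  then show ?thesis using m0 B0 by (intro exI[of _ "m / (B + 1)"]) auto
qed

lemma model_norm_ge:
  "snorm s (fst U) \<le> model_norm s U" "snorm (s - 1) (snd U) \<le> model_norm s U"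
  unfolding model_norm_def by (auto intro!: real_le_rsqrt)

lemma model_norm_le: "model_norm s U \<le> snorm s (fst U) + snorm (s - 1) (snd U)"
  unfolding model_norm_def by (rule sqrt_sum_squares_le_sum) (auto simp: sobolev_norm_nonneg)

lemma model_norm_nonneg: "model_norm s U \<ge> 0"
  unfolding model_norm_def by simp

lemma model_norm_scale: "model_norm s (scale_pair c U) = \<bar>c\<bar> * model_norm s U"
  unfolding model_norm_def scale_pair_def
  by (simp add: sobolev_norm_cmult power_mult_distrib real_sqrt_mult flip: distrib_left)

lemma scale_model_space: "U \<in> model_space s \<Longrightarrow> scale_pair c U \<in> model_space s"
  by (simp add: model_space_def scale_pair_def mem_Times_iff sobolev_cmult)

text \<open>Both candidates are tested on \<open>t * U\<close> for one small \<open>t\<close>.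
  Homogeneity cancels \<open>t\<close>, so the difference on \<open>U\<close> has norm at most
  \<open>2 * \<epsilon> * n\<close> for every \<open>\<epsilon>\<close>, and a function of Sobolev
  norm 0 vanishes identically.\<close>

lemma frechet_derivative_unique:
  assumes s: "s > 3/2" and p: "p \<in> HsG s"
    and L: "has_frechet_derivative_at s Y L p" and M: "has_frechet_derivative_at s Y M p"
    and U: "U \<in> model_space s"
  shows "L U = M U"
proof -
  have s1: "s > 1/2" "s - 1 > 1/2" using s by auto
  have LM: "L U \<in> model_space s" "M U \<in> model_space s"
    and sc: "\<And>c. L (scale_pair c U) = scale_pair c (L U)" "\<And>c. M (scale_pair c U) = scale_pair c (M U)"
    using L M U unfolding has_frechet_derivative_at_def bounded_linear_on_model_def by auto
  define n where "n = model_norm s U"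
  have n0: "n \<ge> 0" unfolding n_def by (rule model_norm_nonneg)
  have key: "snorm s (\<lambda>x. fst (L U) x - fst (M U) x) \<le> 2 * \<epsilon> * n \<and>
      snorm (s - 1) (\<lambda>x. snd (L U) x - snd (M U) x) \<le> 2 * \<epsilon> * n" if \<epsilon>: "\<epsilon> > 0" for \<epsilon>
  proof -
    obtain t0 where t0: "t0 > 0" "\<And>t. 0 < t \<Longrightarrow> t < t0 \<Longrightarrow> p + scale_pair t U \<in> HsG s"
      using HsG_radially_open[OF s p U] by blast
    obtain \<delta>1 where \<delta>1: "\<delta>1 > 0" "\<And>h. h \<in> model_space s \<Longrightarrow> p + h \<in> HsG s \<Longrightarrow> model_norm s h < \<delta>1 \<Longrightarrow>
        Y (p + h) - Y p - L h \<in> model_space s \<and> model_norm s (Y (p + h) - Y p - L h) \<le> \<epsilon> * model_norm s h"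
      using L \<epsilon> unfolding has_frechet_derivative_at_def by meson
    obtain \<delta>2 where \<delta>2: "\<delta>2 > 0" "\<And>h. h \<in> model_space s \<Longrightarrow> p + h \<in> HsG s \<Longrightarrow> model_norm s h < \<delta>2 \<Longrightarrow>
        Y (p + h) - Y p - M h \<in> model_space s \<and> model_norm s (Y (p + h) - Y p - M h) \<le> \<epsilon> * model_norm s h"
      using M \<epsilon> unfolding has_frechet_derivative_at_def by meson
    \<comment> \<open>Small enough for the ray to stay in the group and for both remainder
      estimates; the 1 in \<open>n + 1\<close> covers the case \<open>U = 0\<close>.\<close>
    define t where "t = min (t0 / 2) (min \<delta>1 \<delta>2 / (n + 1) / 2)"
    have t: "0 < t" "t < t0" unfolding t_def using t0(1) \<delta>1(1) \<delta>2(1) n0 by auto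
    have "t * (n + 1) \<le> min \<delta>1 \<delta>2 / (n + 1) / 2 * (n + 1)"
      using n0 by (intro mult_right_mono) (auto simp: t_def)
    also have "\<dots> = min \<delta>1 \<delta>2 / 2" using n0 by (simp add: field_simps)
    also have "\<dots> < min \<delta>1 \<delta>2" using \<delta>1(1) \<delta>2(1) by (simp add: min_def)
    finally have "t * (n + 1) < min \<delta>1 \<delta>2" .
    then have tn: "model_norm s (scale_pair t U) < \<delta>1" "model_norm s (scale_pair t U) < \<delta>2"
      using t by (auto simp: model_norm_scale n_def algebra_simps)
    define R1 R2 where "R1 = Y (p + scale_pair t U) - Y p - L (scale_pair t U)"
      and "R2 = Y (p + scale_pair t U) - Y p - M (scale_pair t U)"
    note h = scale_model_space[OF U, of t] t0(2)[OF t]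
    have R1: "R1 \<in> model_space s" "model_norm s R1 \<le> \<epsilon> * (t * n)"
      using \<delta>1(2)[OF h tn(1)] t by (auto simp: R1_def model_norm_scale n_def)
    have R2: "R2 \<in> model_space s" "model_norm s R2 \<le> \<epsilon> * (t * n)"
      using \<delta>2(2)[OF h tn(2)] t by (auto simp: R2_def model_norm_scale n_def)
    have f: "(\<lambda>x. t * (fst (L U) x - fst (M U) x)) = (\<lambda>x. fst R2 x - fst R1 x)"
      "(\<lambda>x. t * (snd (L U) x - snd (M U) x)) = (\<lambda>x. snd R2 x - snd R1 x)"
      unfolding R1_def R2_def sc by (auto simp: scale_pair_def fun_eq_iff algebra_simps)
    have "t * snorm s (\<lambda>x. fst (L U) x - fst (M U) x) \<le> \<epsilon> * (t * n) + \<epsilon> * (t * n)"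
      using sobolev_norm_cmult[of s t "\<lambda>x. fst (L U) x - fst (M U) x"] t
        sobolev_diff(2)[OF model_spaceD(1)[OF R2(1)] model_spaceD(1)[OF R1(1)]]
        model_norm_ge(1)[of s R1] model_norm_ge(1)[of s R2] R1(2) R2(2) unfolding f abs_of_pos[OF t(1)] by linarith
    moreover have "t * snorm (s - 1) (\<lambda>x. snd (L U) x - snd (M U) x) \<le> \<epsilon> * (t * n) + \<epsilon> * (t * n)"
      using sobolev_norm_cmult[of "s - 1" t "\<lambda>x. snd (L U) x - snd (M U) x"] t
        sobolev_diff(2)[OF model_spaceD(2)[OF R2(1)] model_spaceD(2)[OF R1(1)]]
        model_norm_ge(2)[where s = s and U = R1] model_norm_ge(2)[where s = s and U = R2] R1(2) R2(2) unfolding f abs_of_pos[OF t(1)] by linarith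
    ultimately have "t * snorm s (\<lambda>x. fst (L U) x - fst (M U) x) \<le> t * (2 * \<epsilon> * n)"
      "t * snorm (s - 1) (\<lambda>x. snd (L U) x - snd (M U) x) \<le> t * (2 * \<epsilon> * n)"
      by (simp_all add: algebra_simps)
    then show ?thesis using t by simp
  qed
  have zero: "x \<le> 0" if "\<And>\<epsilon>. \<epsilon> > 0 \<Longrightarrow> x \<le> 2 * \<epsilon> * n" for x
  proof (rule field_le_epsilon)
    fix e :: real assume e: "e > 0"
    have "x \<le> 2 * (e / (2 * (n + 1))) * n" using e n0 by (intro that) auto
    also have "\<dots> \<le> e" using e n0 by (simp add: field_simps)
    finally show "x \<le> 0 + e" by simp
  qed
  have "snorm s (\<lambda>x. fst (L U) x - fst (M U) x) \<le> 0"
    "snorm (s - 1) (\<lambda>x. snd (L U) x - snd (M U) x) \<le> 0"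
    using key by (auto intro!: zero)
  then have "snorm s (\<lambda>x. fst (L U) x - fst (M U) x) = 0"
    "snorm (s - 1) (\<lambda>x. snd (L U) x - snd (M U) x) = 0"
    by (simp_all add: sobolev_norm_nonneg order_antisym)
  note z = this
  have "fst (L U) x - fst (M U) x = 0" for x
    by (rule sobolev_norm_0_imp[OF sobolev_diff(1)[OF model_spaceD(1)[OF LM(1)] model_spaceD(1)[OF LM(2)]] s1(1) z(1)])
  moreover have "snd (L U) x - snd (M U) x = 0" for x
    by (rule sobolev_norm_0_imp[OF sobolev_diff(1)[OF model_spaceD(2)[OF LM(1)] model_spaceD(2)[OF LM(2)]] s1(2) z(2)])
  ultimately show ?thesis by (simp add: prod_eq_iff fun_eq_iff)
qed

text \<open>Off \<open>model_space s\<close> the map chosen by \<open>SOME\<close> is arbitrary; on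
  it the choice is forced.\<close>

lemma field_derivative_eq:
  assumes "s > 3/2" "p \<in> HsG s" "has_frechet_derivative_at s Y L p" "U \<in> model_space s"
  shows "field_derivative s Y p U = L U"
  unfolding field_derivative_def
  by (rule frechet_derivative_unique[OF assms(1,2) someI[of "\<lambda>L. has_frechet_derivative_at s Y L p", OF assms(3)] assms(3,4)])

lemma zero_model_space: "0 \<in> model_space s" "model_norm s 0 = 0"
proof -
  have z: "(0 :: real \<Rightarrow> real) \<in> sobolev r" "snorm r 0 = 0" for r
    using sobolev_const(1)[of 0 r] sobolev_const(2)[of r 0] sobolev_norm_nonneg[of r "\<lambda>x. 0"]
    by (simp_all add: zero_fun_def)
  show "0 \<in> model_space s" "model_norm s 0 = 0"
    by (simp_all add: model_space_def model_norm_def z mem_Times_iff)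
qed

lemma has_frechet_derivative_const: "has_frechet_derivative_at s (\<lambda>_. w) (\<lambda>_. 0) p"
proof -
  have "scale_pair c 0 = 0" for c by (simp add: scale_pair_def prod_eq_iff fun_eq_iff)
  then have "bounded_linear_on_model s (\<lambda>_. 0)"
    unfolding bounded_linear_on_model_def by (auto simp: zero_model_space intro!: exI[of _ 0])
  then show ?thesis
    unfolding has_frechet_derivative_at_def
    by (auto simp: zero_model_space model_norm_nonneg intro!: exI[of _ 1])
qed

lemma field_derivative_const:
  assumes "s > 3/2" "p \<in> HsG s" "U \<in> model_space s"
  shows "field_derivative s (\<lambda>_. w) p U = 0"
  using field_derivative_eq[OF assms(1,2) has_frechet_derivative_const assms(3)] .

text \<open>At \<open>h = 0\<close> the remainder estimate has right-hand side 0.\<close>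

lemma expands_at_0:
  assumes e: "expands s r \<Phi> a L" and r: "r > 1/2"
  shows "\<Phi> (\<lambda>x. 0) = a"
proof -
  obtain A K \<delta> where "expansion_bounds s r \<Phi> a L A K \<delta>"
    by (rule expandsE[OF e])
  note K = expansion_boundsD(2,3,6,7)[OF this]
  have z: "(\<lambda>x. 0) \<in> sobolev s" "snorm s (\<lambda>x. 0) = 0"
    using sobolev_const(1)[of 0 s] sobolev_const(2)[of s 0] sobolev_norm_nonneg[of s "\<lambda>x. 0"] by auto
  have "\<forall>c. \<forall>h\<in>sobolev s. L (\<lambda>x. c * h x) = (\<lambda>x. c * L h x)"
    using expands_linear[OF e] unfolding linear_map_def by blast
  from this[rule_format, OF z(1), of 0] have L0: "L (\<lambda>x. 0) = (\<lambda>x. 0)" by simp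
  have d: "snorm s (\<lambda>x. 0) < \<delta>" using z K by simp
  have "snorm r (\<lambda>x. \<Phi> (\<lambda>x. 0) x - a x) \<le> 0"
    using K(4)[OF z(1) d] by (simp add: L0 z)
  then have "snorm r (\<lambda>x. \<Phi> (\<lambda>x. 0) x - a x) = 0"
    by (simp add: order_antisym sobolev_norm_nonneg)
  from sobolev_norm_0_imp[OF sobolev_diff(1)[OF K(3)[OF z(1) d] expands_value[OF e]] r this]
  show ?thesis by (simp add: fun_eq_iff)
qed

text \<open>Translates componentwise expansions in \<open>h\<close> into a Frechet derivative on the
  group: a quadratic remainder is at most \<open>\<epsilon>\<close> times the norm once the norm is
  below \<open>\<epsilon> / (K1 + K2 + 1)\<close>. The formula for \<open>Y\<close> is asked for
  only near the identity, where the Christoffel map is explicit.\<close>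

lemma has_frechet_derivative_expands:
  assumes s: "s > 3/2" and e1: "expands s s \<Phi>1 a1 L1" and e2: "expands s (s - 1) \<Phi>2 a2 L2"
    and \<delta>0: "\<delta>0 > 0"
    and Y: "\<And>H. H \<in> model_space s \<Longrightarrow> unit_G + H \<in> HsG s \<Longrightarrow> snorm s (fst H) < \<delta>0 \<Longrightarrow>
              Y (unit_G + H) = (\<Phi>1 (fst H), \<Phi>2 (fst H))"
  shows "Y unit_G = (a1, a2)" "has_frechet_derivative_at s Y (\<lambda>H. (L1 (fst H), L2 (fst H))) unit_G"
proof -
  have s1: "s > 1/2" "s - 1 > 1/2" using s by auto
  have Y0: "Y unit_G = (\<Phi>1 (\<lambda>x. 0), \<Phi>2 (\<lambda>x. 0))"
  proof -
    have "fst (0 :: circle_pair) = (\<lambda>x. 0)" by (simp add: fun_eq_iff)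
    moreover have "snorm s (\<lambda>x. 0) = 0"
      using sobolev_const(2)[of s 0] sobolev_norm_nonneg[of s "\<lambda>x. 0"] by simp
    ultimately show ?thesis
      using Y[OF zero_model_space(1)] unit_G_HsG[OF s] \<delta>0 by simp
  qed
  then show Yu: "Y unit_G = (a1, a2)" using expands_at_0[OF e1 s1(1)] expands_at_0[OF e2 s1(2)] by simp
  obtain A1 K1 \<delta>1 where "expansion_bounds s s \<Phi>1 a1 L1 A1 K1 \<delta>1"
    by (rule expandsE[OF e1])
  note 1 = expansion_boundsD(1,2,3,5,6,7)[OF this]
  obtain A2 K2 \<delta>2 where "expansion_bounds s (s - 1) \<Phi>2 a2 L2 A2 K2 \<delta>2"
    by (rule expandsE[OF e2])
  note 2 = expansion_boundsD(1,2,3,5,6,7)[OF this]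
  note l1 = expands_linear[OF e1] and l2 = expands_linear[OF e2]
  note m1 = linear_map_sobolev[OF l1] and m2 = linear_map_sobolev[OF l2]
  let ?L = "\<lambda>H. (L1 (fst H), L2 (fst H))"
  have lin: "bounded_linear_on_model s ?L"
    unfolding bounded_linear_on_model_def
  proof (intro conjI ballI allI exI[of _ "A1 + A2"])
    fix U assume U: "U \<in> model_space s"
    note U1 = model_spaceD(1)[OF U]
    show "?L U \<in> model_space s" using m1[OF U1] m2[OF U1] by (simp add: model_space_def)
    show "?L (scale_pair c U) = scale_pair c (?L U)" for c
      using l1 l2 U1 unfolding linear_map_def scale_pair_def by simp
    have "model_norm s (?L U) \<le> snorm s (L1 (fst U)) + snorm (s - 1) (L2 (fst U))"
      using model_norm_le[of s "?L U"] by simp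
    also have "\<dots> \<le> (A1 + A2) * snorm s (fst U)"
      using 1(4)[OF U1] 2(4)[OF U1] by (simp add: distrib_right)
    also have "\<dots> \<le> (A1 + A2) * model_norm s U"
      using 1 2 by (intro mult_left_mono model_norm_ge) auto
    finally show "model_norm s (?L U) \<le> (A1 + A2) * model_norm s U" .
  next
    fix U V assume U: "U \<in> model_space s" and V: "V \<in> model_space s"
    show "?L (U + V) = ?L U + ?L V"
      using l1 l2 model_spaceD(1)[OF U] model_spaceD(1)[OF V]
      unfolding linear_map_def by (simp add: plus_fun_def)
  qed
  show "has_frechet_derivative_at s Y ?L unit_G"
    unfolding has_frechet_derivative_at_def
  proof (intro conjI lin allI impI)
    fix \<epsilon> :: real assume \<epsilon>: "\<epsilon> > 0"
    define \<delta> where "\<delta> = min (min \<delta>0 \<delta>1) (min \<delta>2 (\<epsilon> / (K1 + K2 + 1)))"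
    have \<delta>: "\<delta> > 0" using \<epsilon> \<delta>0 1 2 by (simp add: \<delta>_def)
    have "Y (unit_G + H) - Y unit_G - ?L H \<in> model_space s \<and>
        model_norm s (Y (unit_G + H) - Y unit_G - ?L H) \<le> \<epsilon> * model_norm s H"
      if H: "H \<in> model_space s" "unit_G + H \<in> HsG s" "model_norm s H < \<delta>" for H
    proof -
      note H1 = model_spaceD(1)[OF H(1)]
      define n where "n = snorm s (fst H)"
      have n0: "n \<ge> 0" by (simp add: n_def sobolev_norm_nonneg)
      have nH: "n \<le> model_norm s H" unfolding n_def by (rule model_norm_ge)
      then have n: "n < \<delta>0" "n < \<delta>1" "n < \<delta>2" "n < \<epsilon> / (K1 + K2 + 1)" using H(3) by (auto simp: \<delta>_def)
      have eq: "Y (unit_G + H) - Y unit_G - ?L H =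
          (\<lambda>x. \<Phi>1 (fst H) x - a1 x - L1 (fst H) x, \<lambda>x. \<Phi>2 (fst H) x - a2 x - L2 (fst H) x)"
        unfolding Y[OF H(1,2) n(1)[unfolded n_def]] Yu by (simp add: fun_eq_iff prod_eq_iff)
      have r1: "(\<lambda>x. \<Phi>1 (fst H) x - a1 x - L1 (fst H) x) \<in> sobolev s"
        by (intro sobolev_diff 1(5) H1 n[unfolded n_def] expands_value[OF e1] m1)
      have r2: "(\<lambda>x. \<Phi>2 (fst H) x - a2 x - L2 (fst H) x) \<in> sobolev (s - 1)"
        by (intro sobolev_diff 2(5) H1 n[unfolded n_def] expands_value[OF e2] m2)
      have "model_norm s (\<lambda>x. \<Phi>1 (fst H) x - a1 x - L1 (fst H) x, \<lambda>x. \<Phi>2 (fst H) x - a2 x - L2 (fst H) x)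
          \<le> K1 * n\<^sup>2 + K2 * n\<^sup>2"
        using model_norm_le[of s "(\<lambda>x. \<Phi>1 (fst H) x - a1 x - L1 (fst H) x, \<lambda>x. \<Phi>2 (fst H) x - a2 x - L2 (fst H) x)"]
          1(6)[OF H1 n(2)[unfolded n_def]] 2(6)[OF H1 n(3)[unfolded n_def]] by (simp add: n_def)
      also have "\<dots> = ((K1 + K2) * n) * n" by (simp add: power2_eq_square algebra_simps)
      also have "\<dots> \<le> \<epsilon> * n"
      proof (rule mult_right_mono[OF _ n0])
        have "(K1 + K2) * n \<le> (K1 + K2 + 1) * n" using n0 by (intro mult_right_mono) auto
        also have "\<dots> \<le> \<epsilon>" using n(4) 1 2 by (simp add: field_simps)
        finally show "(K1 + K2) * n \<le> \<epsilon>" .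
      qed
      also have "\<dots> \<le> \<epsilon> * model_norm s H" using \<epsilon> nH by simp
      finally show ?thesis unfolding eq using r1 r2 by (simp add: model_space_def)
    qed
    then show "\<exists>\<delta>>0. \<forall>H\<in>model_space s. unit_G + H \<in> HsG s \<and> model_norm s H < \<delta> \<longrightarrow>
        Y (unit_G + H) - Y unit_G - ?L H \<in> model_space s \<and>
        model_norm s (Y (unit_G + H) - Y unit_G - ?L H) \<le> \<epsilon> * model_norm s H"
      using \<delta> by blast
  qed
qed

section \<open>The curvature at the identity\<close>

context
  fixes s :: real
  assumes s: "s > 5/2"
begin

lemma christoffel_unit_plus:
  assumes U: "U \<in> model_space s" and V: "V \<in> model_space s"
  shows "\<exists>\<delta>>0. \<forall>H\<in>model_space s. unit_G + H \<in> HsG s \<longrightarrow> snorm s (fst H) < \<delta> \<longrightarrow>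
    christoffel (unit_G + H) U V = (chr_fst U V (fst H), chr_snd U V (fst H))"
proof -
  have s1: "s > 3/2" using s by simp
  obtain \<delta> where \<delta>: "\<delta> > 0" "\<And>h f. h \<in> sobolev s \<Longrightarrow> snorm s h < \<delta> \<Longrightarrow> \<forall>x. 1 + deriv h x > 0 \<Longrightarrow>
    christoffel (\<lambda>x. x + h x, f) U V = (chr_fst U V h, chr_snd U V h)"
    using christoffel_near_unit[OF s U V] by blast
  have "christoffel (unit_G + H) U V = (chr_fst U V (fst H), chr_snd U V (fst H))"
    if H: "H \<in> model_space s" "unit_G + H \<in> HsG s" "snorm s (fst H) < \<delta>" for H
  proof -
    have "(\<lambda>x. fst (unit_G + H) x - x) = fst H" by (simp add: unit_G_def fun_eq_iff)
    then have "\<forall>x. 1 + dx H x > 0" using HsG_D(3)[OF s1 H(2)] by simp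
    moreover have "unit_G + H = (\<lambda>x. x + fst H x, snd H)"
      by (simp add: unit_G_def prod_eq_iff fun_eq_iff)
    ultimately show ?thesis using \<delta>(2)[OF model_spaceD(1)[OF H(1)] H(3)] by simp
  qed
  then show ?thesis using \<delta>(1) by blast
qed

lemma christoffel_unit_G:
  assumes U: "U \<in> model_space s" and V: "V \<in> model_space s"
  shows "christoffel unit_G U V = chr_unit U V"
proof -
  have s1: "s > 3/2" using s by simp
  obtain \<delta> where "\<delta> > 0" "\<And>H. H \<in> model_space s \<Longrightarrow> unit_G + H \<in> HsG s \<Longrightarrow> snorm s (fst H) < \<delta> \<Longrightarrow>
    christoffel (unit_G + H) U V = (chr_fst U V (fst H), chr_snd U V (fst H))"
    using christoffel_unit_plus[OF U V] by blast
  from has_frechet_derivative_expands(1)[OF s1 expands_chr_fst[OF s U V] expands_chr_snd[OF s U V] this]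
  show ?thesis by simp
qed

text \<open>The derivative of the constant field is 0 at every nearby group element, so as a
  function of the point the covariant derivative is minus the Christoffel map and inherits its
  expansion.\<close>

lemma cov_deriv_const:
  assumes V: "V \<in> model_space s" and W: "W \<in> model_space s"
  shows "cov_deriv s (\<lambda>_. V) (\<lambda>_. W) unit_G = scale_pair (-1) (chr_unit W V)"
    "has_frechet_derivative_at s (cov_deriv s (\<lambda>_. V) (\<lambda>_. W))
       (\<lambda>H. scale_pair (-1) (chr_lin W V (fst H))) unit_G"
proof -
  have s1: "s > 3/2" using s by simp
  obtain \<delta> where \<delta>: "\<delta> > 0" "\<And>H. H \<in> model_space s \<Longrightarrow> unit_G + H \<in> HsG s \<Longrightarrow> snorm s (fst H) < \<delta> \<Longrightarrow>
    christoffel (unit_G + H) W V = (chr_fst W V (fst H), chr_snd W V (fst H))"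
    using christoffel_unit_plus[OF W V] by blast
  have Y: "cov_deriv s (\<lambda>_. V) (\<lambda>_. W) (unit_G + H) =
      (\<lambda>x. -1 * chr_fst W V (fst H) x, \<lambda>x. -1 * chr_snd W V (fst H) x)"
    if "H \<in> model_space s" "unit_G + H \<in> HsG s" "snorm s (fst H) < \<delta>" for H
    unfolding cov_deriv_def \<delta>(2)[OF that] field_derivative_const[OF s1 that(2) V]
    by (simp add: prod_eq_iff fun_eq_iff)
  have e: "expands s r (\<lambda>h x. -1 * \<Phi> h x) (\<lambda>x. -1 * a x) (\<lambda>h x. -1 * L h x)" if "expands s r \<Phi> a L" for r \<Phi> a L
    by (rule expands_compose_linear[OF that linear_map_cmult])
  note * = has_frechet_derivative_expands[OF s1 e[OF expands_chr_fst[OF s W V]] e[OF expands_chr_snd[OF s W V]] \<delta>(1) Y]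
  show "cov_deriv s (\<lambda>_. V) (\<lambda>_. W) unit_G = scale_pair (-1) (chr_unit W V)"
    "has_frechet_derivative_at s (cov_deriv s (\<lambda>_. V) (\<lambda>_. W))
       (\<lambda>H. scale_pair (-1) (chr_lin W V (fst H))) unit_G"
    using * unfolding scale_pair_def by simp_all
qed

lemma solve_zero: "solve \<epsilon> (\<lambda>x. 0) x = 0"
proof -
  have "fcoeff (\<lambda>x. 0) = (\<lambda>n. 0)" by (auto simp: fcoeff_const)
  then show ?thesis by (simp add: solve_def fseries_def)
qed

lemma chr_unit_zero: "chr_unit U 0 = 0"
proof -
  have "deriv (0 :: real \<Rightarrow> real) = (\<lambda>x. 0)" by (simp add: zero_fun_def)
  then show ?thesis
    unfolding chr_unit_def by (simp add: prod_eq_iff fun_eq_iff conj_op0_def transport0_def solve_zero)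
qed

lemma curvature_at_unit_G:
  assumes u: "u \<in> model_space s" and v: "v \<in> model_space s"
  shows "curvature_at s unit_G u v v =
    scale_pair (-1) (chr_lin v v (fst u)) - chr_unit (scale_pair (-1) (chr_unit v v)) u
    - (scale_pair (-1) (chr_lin v u (fst v)) - chr_unit (scale_pair (-1) (chr_unit v u)) v)"
proof -
  have s1: "s > 3/2" using s by simp
  note p = unit_G_HsG[OF s1]
  have c: "cov_deriv s (\<lambda>_. a) (cov_deriv s (\<lambda>_. b) (\<lambda>_. w)) unit_G =
      scale_pair (-1) (chr_lin w b (fst a)) - chr_unit (scale_pair (-1) (chr_unit w b)) a"
    if a: "a \<in> model_space s" and b: "b \<in> model_space s" and w: "w \<in> model_space s" for a b w
  proof -
    note cd = cov_deriv_const[OF b w]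
    show ?thesis
      unfolding cov_deriv_def[of s "\<lambda>_. a" "cov_deriv s (\<lambda>_. b) (\<lambda>_. w)"] cd(1)
        field_derivative_eq[OF s1 p cd(2) a]
        christoffel_unit_G[OF scale_model_space[OF chr_unit_model_space[OF s w b]] a] ..
  qed
  have "lie_bracket s (\<lambda>_. u) (\<lambda>_. v) unit_G = 0"
    unfolding lie_bracket_def field_derivative_const[OF s1 p u] field_derivative_const[OF s1 p v] by simp
  \<comment> \<open>A covariant derivative sees its direction only through the value at the point,
    so the vanishing of the bracket at the identity is enough.\<close>
  then have "cov_deriv s (lie_bracket s (\<lambda>_. u) (\<lambda>_. v)) (\<lambda>_. v) unit_G = 0"
    unfolding cov_deriv_def
    by (simp add: field_derivative_const[OF s1 p zero_model_space(1)]
        christoffel_unit_G[OF v zero_model_space(1)] chr_unit_zero)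
  then show ?thesis
    unfolding curvature_at_def curvature_def c[OF u v v] c[OF v u v] by simp
qed

text \<open>All integrations by parts take this form: the integrands differ by the derivative of a
  periodic primitive \<open>F\<close>, so that the work lies in naming \<open>F\<close>.\<close>

lemma integral_eq_exact:
  fixes f g F :: "real \<Rightarrow> real"
  assumes "continuous_on {0..1} f" "continuous_on {0..1} g"
    and F: "\<And>x. (F has_real_derivative f x - g x) (at x)" "\<And>x. F (x + 1) = F x"
  shows "I01 f = I01 g"
proof -
  have "((\<lambda>x. f x - g x) has_integral (F 1 - F 0)) {0..1}"
    using F(1) by (intro fundamental_theorem_of_calculus)
      (auto simp: has_real_derivative_iff_has_vector_derivative[symmetric] intro: DERIV_subset)
  then have "I01 (\<lambda>x. f x - g x) = 0" using F(2)[of 0] by (simp add: integral_unique)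
  then show ?thesis
    using integral_diff[OF integrable_continuous_real integrable_continuous_real, OF assms(1,2)] by simp
qed

lemma metric_unit_eq:
  assumes X: "X \<in> model_space s" and Z: "Z \<in> model_space s"
  shows "metric_unit X Z =
    I01 (\<lambda>x. fst X x * fst Z x + dx X x * dx Z x + snd X x * snd Z x)"
proof -
  have s1: "s > 3/2" using s by simp
  obtain X1 X2 Z1 Z2 where XZ: "X = (X1, X2)" "Z = (Z1, Z2)" by fastforce
  note X' = model_spaceD[OF X, unfolded XZ fst_conv snd_conv]
    and Z' = model_spaceD[OF Z, unfolded XZ fst_conv snd_conv]
  show ?thesis
    unfolding XZ metric_unit.simps fst_conv snd_conv
    by (intro integral_add[symmetric] integrable_continuous_real continuous_intros
        sobolev_continuous[OF X'(1)] sobolev_continuous[OF X'(2)] sobolev_continuous[OF Z'(1)]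
        sobolev_continuous[OF Z'(2)] sobolev_continuous[OF sobolev_deriv(2)[OF X'(1) s1]]
        sobolev_continuous[OF sobolev_deriv(2)[OF Z'(1) s1]])
qed

lemma metric_unit_G: "metric unit_G X Z = metric_unit X Z"
  by (simp add: metric_def unit_G_def compose_pair_def inv_id)

end

text \<open>
  With \<open>q = conj_op0 \<alpha> \<beta>\<close> and \<open>r = conj_rot0 \<alpha> \<beta>\<close>, the equation \<open>q - q'' = g'\<close>, \<open>g = \<alpha> + \<beta>\<close>, is
  the system \<open>q' = r - g\<close>, \<open>r' = q\<close>, which avoids differentiating \<open>g\<close>.
\<close>

definition conj_rot0 :: "(real \<Rightarrow> real) \<Rightarrow> (real \<Rightarrow> real) \<Rightarrow> real \<Rightarrow> real" where
  "conj_rot0 \<alpha> \<beta> x = (transport0 1 \<alpha> \<beta> x - transport0 (-1) \<alpha> \<beta> x) / 2"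

definition conj_rot_lin :: "(real \<Rightarrow> real) \<Rightarrow> (real \<Rightarrow> real) \<Rightarrow> (real \<Rightarrow> real) \<Rightarrow> real \<Rightarrow> real" where
  "conj_rot_lin \<alpha> \<beta> h x = (transport_lin 1 \<alpha> \<beta> h x - transport_lin (-1) \<alpha> \<beta> h x) / 2"

lemma conj_has_derivative:
  assumes s: "s > 3/2" and \<alpha>: "\<alpha> \<in> sobolev (s - 1)" and \<beta>: "\<beta> \<in> sobolev (s - 1)"
  shows "(conj_op0 \<alpha> \<beta> has_real_derivative conj_rot0 \<alpha> \<beta> x - (\<alpha> x + \<beta> x)) (at x)"
    "(conj_rot0 \<alpha> \<beta> has_real_derivative conj_op0 \<alpha> \<beta> x) (at x)"
    "conj_rot0 \<alpha> \<beta> (x + 1) = conj_rot0 \<alpha> \<beta> x"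
proof -
  note d1 = transport0_has_derivative[OF s _ \<alpha> \<beta>, of 1, simplified]
  note d2 = transport0_has_derivative[OF s _ \<alpha> \<beta>, of "-1", simplified]
  show "(conj_op0 \<alpha> \<beta> has_real_derivative conj_rot0 \<alpha> \<beta> x - (\<alpha> x + \<beta> x)) (at x)"
    unfolding conj_op0_def[abs_def] conj_rot0_def
    by (rule derivative_eq_intros d1 d2 refl | simp)+
  show "(conj_rot0 \<alpha> \<beta> has_real_derivative conj_op0 \<alpha> \<beta> x) (at x)"
    unfolding conj_op0_def conj_rot0_def[abs_def]
    by (rule derivative_eq_intros d1 d2 refl | simp)+
  show "conj_rot0 \<alpha> \<beta> (x + 1) = conj_rot0 \<alpha> \<beta> x"
    unfolding conj_rot0_def transport0_def solve_def fseries_periodic ..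
qed

text \<open>Linearization at \<open>h = 0\<close> of the system
  \<open>q' = \<phi>' * (r - g)\<close>, \<open>r' = \<phi>' * q\<close>, with
  \<open>\<phi>' * g\<close> being the flux.\<close>

lemma conj_lin_has_derivative:
  assumes s: "s > 3/2" and \<alpha>: "\<alpha> \<in> sobolev (s - 1)" and \<beta>: "\<beta> \<in> sobolev (s - 1)" and h: "h \<in> sobolev s"
  shows "(conj_op_lin \<alpha> \<beta> h has_real_derivative
      conj_rot_lin \<alpha> \<beta> h x + deriv h x * conj_rot0 \<alpha> \<beta> x - (\<alpha> x - \<beta> x) * deriv h x) (at x)"
    "(conj_rot_lin \<alpha> \<beta> h has_real_derivative conj_op_lin \<alpha> \<beta> h x + deriv h x * conj_op0 \<alpha> \<beta> x) (at x)"
    "conj_rot_lin \<alpha> \<beta> h (x + 1) = conj_rot_lin \<alpha> \<beta> h x"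
proof -
  have d: "(transport_lin \<epsilon> \<alpha> \<beta> h has_real_derivative
     \<epsilon> * transport_lin \<epsilon> \<alpha> \<beta> h x + \<epsilon> * deriv h x * transport0 \<epsilon> \<alpha> \<beta> x - (\<alpha> x - \<beta> x) * deriv h x) (at x)"
    if "\<epsilon> \<in> {1, -1}" for \<epsilon>
    by (rule transport_lin_has_derivative[OF s that \<alpha> \<beta> h])
  note d1 = d[of 1] and d2 = d[of "-1"]
  show "(conj_op_lin \<alpha> \<beta> h has_real_derivative
      conj_rot_lin \<alpha> \<beta> h x + deriv h x * conj_rot0 \<alpha> \<beta> x - (\<alpha> x - \<beta> x) * deriv h x) (at x)"
    unfolding conj_op_lin_def[abs_def] conj_rot_lin_def conj_rot0_def
    by (rule DERIV_cong[OF DERIV_cdivide[OF DERIV_add[OF d1 d2]]]) (auto simp: field_simps)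
  show "(conj_rot_lin \<alpha> \<beta> h has_real_derivative conj_op_lin \<alpha> \<beta> h x + deriv h x * conj_op0 \<alpha> \<beta> x) (at x)"
    unfolding conj_op_lin_def conj_rot_lin_def[abs_def] conj_op0_def
    by (rule DERIV_cong[OF DERIV_cdivide[OF DERIV_diff[OF d1 d2]]]) (auto simp: field_simps)
  have "h (x + 1) = h x" by (rule sobolev_periodic[OF h])
  then show "conj_rot_lin \<alpha> \<beta> h (x + 1) = conj_rot_lin \<alpha> \<beta> h x"
    unfolding conj_rot_lin_def transport_lin_def transport0_def solve_def fseries_periodic by simp
qed

section \<open>Inner products with the Christoffel map and its derivative\<close>

lemma model_space_continuous:
  assumes "s > 3/2" "X \<in> model_space s"
  shows "continuous_on S (fst X)" "continuous_on S (deriv (fst X))" "continuous_on S (snd X)"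
  using sobolev_continuous[OF model_spaceD(1)[OF assms(2)]] sobolev_continuous[OF model_spaceD(2)[OF assms(2)]]
    sobolev_continuous[OF sobolev_deriv(2)[OF model_spaceD(1)[OF assms(2)] assms(1)]] by auto

context
  fixes s :: real
  assumes s: "s > 5/2"
begin

lemma model_space_diff: "X \<in> model_space s \<Longrightarrow> Y \<in> model_space s \<Longrightarrow> X - Y \<in> model_space s"
  using sobolev_diff(1)[of "fst X" s "fst Y"] sobolev_diff(1)[of "snd X" "s - 1" "snd Y"]
  by (simp add: model_space_def mem_Times_iff fun_diff_def)

lemma metric_unit_diff:
  assumes X: "X \<in> model_space s" and Y: "Y \<in> model_space s" and Z: "Z \<in> model_space s"
  shows "metric_unit (X - Y) Z = metric_unit X Z - metric_unit Y Z"
proof -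
  have s1: "s > 3/2" using s by simp
  note X1 = model_spaceD(1)[OF X] and Y1 = model_spaceD(1)[OF Y]
  have d: "dx (X - Y) x = dx X x - dx Y x" for x
    using DERIV_diff[OF sobolev_deriv(1)[OF X1 s1] sobolev_deriv(1)[OF Y1 s1]]
    by (simp add: fun_diff_def DERIV_imp_deriv)
  show ?thesis
    unfolding metric_unit_eq[OF s model_space_diff[OF X Y] Z] metric_unit_eq[OF s X Z] metric_unit_eq[OF s Y Z] d
    by (subst integral_diff[symmetric])
       (auto intro!: integrable_continuous_real continuous_intros model_space_continuous[OF s1] X Y Z
          simp: algebra_simps)
qed

lemma deriv_scale_pair:
  assumes "X \<in> model_space s"
  shows "dx (scale_pair c X) x = c * dx X x"
  using DERIV_cmult[OF sobolev_deriv(1)[OF model_spaceD(1)[OF assms]], of c x] s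
  by (simp add: scale_pair_def DERIV_imp_deriv)

lemma metric_unit_scale:
  assumes X: "X \<in> model_space s" and Z: "Z \<in> model_space s"
  shows "metric_unit (scale_pair c X) Z = c * metric_unit X Z"
  unfolding metric_unit_eq[OF s scale_model_space[OF X] Z] metric_unit_eq[OF s X Z] deriv_scale_pair[OF X]
  by (simp add: scale_pair_def mult.assoc flip: integral_mult_right distrib_left)

lemma deriv_chr_unit:
  assumes U: "U \<in> model_space s" and V: "V \<in> model_space s"
  shows "dx (chr_unit U V) x =
    - (conj_rot0 (uu U V) (dd U V) x
       - (fst U x * fst V x + 1/2 * (dx U x * dx V x)))
    - 1/2 * (conj_rot0 (rr U V) (\<lambda>x. 0) x - snd U x * snd V x)"
proof -
  have s1: "s > 3/2" using s by simp
  note c = chr_coefficients_sobolev[OF s U V]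
  show ?thesis
    unfolding chr_unit_def fst_conv
    by (rule DERIV_imp_deriv)
       (rule derivative_eq_intros conj_has_derivative(1)[OF s1 c(1,2)]
          conj_has_derivative(1)[OF s1 c(3) sobolev_const(1)[of 0]] refl | simp)+
qed

text \<open>In the H1 product \<open>A\<close> cancels \<open>A\<inverse>\<close>, so the pairing is
  local in \<open>U\<close>, \<open>V\<close> and \<open>Z\<close>. The primitive comes from
  \<open>(r * z)' = q * z + (q' + g) * z'\<close>, which holds by \<open>r' = q\<close> and
  \<open>r = q' + g\<close>; the sign of \<open>F\<close> is that of the Christoffel map.\<close>

lemma metric_chr_unit:
  assumes U: "U \<in> model_space s" and V: "V \<in> model_space s" and Z: "Z \<in> model_space s"
  shows "metric_unit (chr_unit U V) Z = I01 (\<lambda>x.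
    pot U V x * dx Z x
    - 1/2 * mix U V x * snd Z x)"
proof -
  have s1: "s > 3/2" using s by simp
  note c = chr_coefficients_sobolev[OF s U V]
  note G = chr_unit_model_space[OF s U V]
  define r1 where "r1 = conj_rot0 (uu U V) (dd U V)"
  define r2 where "r2 = conj_rot0 (rr U V) (\<lambda>x. 0)"
  note d1 = conj_has_derivative(2,3)[OF s1 c(1,2), folded r1_def]
  note d2 = conj_has_derivative(2,3)[OF s1 c(3) sobolev_const(1)[of 0], folded r2_def]
  note cont = model_space_continuous[OF s1 U] model_space_continuous[OF s1 V] model_space_continuous[OF s1 Z]
    model_space_continuous[OF s1 G]
  show ?thesis
    unfolding metric_unit_eq[OF s G Z]
  proof (rule integral_eq_exact[OF s, where F = "\<lambda>x. - (r1 x + 1/2 * r2 x) * fst Z x"], goal_cases)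
    case (3 x)
    show ?case
      unfolding deriv_chr_unit[OF U V] r1_def[symmetric] r2_def[symmetric]
      by (rule derivative_eq_intros d1 d2 sobolev_deriv(1)[OF model_spaceD(1)[OF Z] s1] refl)+
         (simp add: chr_unit_def algebra_simps)
  qed (use d1(2) d2(2) sobolev_periodic[OF model_spaceD(1)[OF Z]] in \<open>auto intro!: continuous_intros cont\<close>)
qed

text \<open>The same primitive, built from the linearized \<open>r\<close>, removes the variation of
  the nonlocal operator: what remains nonlocal is \<open>chr_unit U V\<close> itself. The terms with
  \<open>\<alpha>\<close> cancel, and \<open>2 * \<beta>\<close> yields the product of four
  derivatives.\<close>

lemma metric_chr_lin:
  assumes U: "U \<in> model_space s" and V: "V \<in> model_space s" and Z: "Z \<in> model_space s" and h: "h \<in> sobolev s"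
  shows "metric_unit (chr_lin U V h) Z = I01 (\<lambda>x.
    - (dx U x * dx V x * deriv h x * dx Z x)
    - (fst (chr_unit U V) x * fst Z x * deriv h x - dx (chr_unit U V) x * dx Z x * deriv h x
       + snd (chr_unit U V) x * snd Z x * deriv h x))"
proof -
  have s1: "s > 3/2" using s by simp
  note c = chr_coefficients_sobolev[OF s U V]
  note G = chr_unit_model_space[OF s U V] and L = chr_lin_model_space[OF s U V h]
  let ?\<alpha> = "\<lambda>x. fst U x * fst V x" and ?\<beta> = "\<lambda>x. 1/2 * (dx U x * dx V x)"
    and ?\<gamma> = "\<lambda>x. snd U x * snd V x"
  define r1 where "r1 = conj_rot_lin ?\<alpha> ?\<beta> h"
  define r2 where "r2 = conj_rot_lin ?\<gamma> (\<lambda>x. 0) h"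
  note d1 = conj_lin_has_derivative[OF s1 c(1,2) h, folded r1_def]
  note d2 = conj_lin_has_derivative[OF s1 c(3) sobolev_const(1)[of 0] h, folded r2_def]
  note cont = model_space_continuous[OF s1 U] model_space_continuous[OF s1 V] model_space_continuous[OF s1 Z]
    model_space_continuous[OF s1 G] model_space_continuous[OF s1 L] sobolev_continuous[OF sobolev_deriv(2)[OF h s1]]
  have dL: "dx (chr_lin U V h) x =
      - (r1 x + deriv h x * conj_rot0 ?\<alpha> ?\<beta> x - (?\<alpha> x - ?\<beta> x) * deriv h x)
      - 1/2 * (r2 x + deriv h x * conj_rot0 ?\<gamma> (\<lambda>x. 0) x - ?\<gamma> x * deriv h x)" for x
    unfolding chr_lin_def fst_conv
    by (rule DERIV_imp_deriv) (rule derivative_eq_intros d1 d2 refl | simp)+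
  show ?thesis
    unfolding metric_unit_eq[OF s L Z]
  proof (rule integral_eq_exact[OF s, where F = "\<lambda>x. - (r1 x + 1/2 * r2 x) * fst Z x"], goal_cases)
    case (3 x)
    show ?case
      unfolding dL deriv_chr_unit[OF U V]
      by (rule derivative_eq_intros d1(2) d2(2) sobolev_deriv(1)[OF model_spaceD(1)[OF Z] s1] refl)+
         (simp add: chr_unit_def chr_lin_def algebra_simps)
  qed (use d1(3) d2(3) sobolev_periodic[OF model_spaceD(1)[OF Z]] in \<open>auto intro!: continuous_intros cont\<close>)
qed

text \<open>By the two preceding lemmas every pairing in the curvature, and also both sides of the
  claimed formula, are integrals of expressions local in \<open>u\<close>, \<open>v\<close>,
  \<open>A\<close> and \<open>B\<close>. The claim thus reduces to an identity between integrands
  modulo an exact derivative.\<close>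

theorem unnormalized_sectional_eq:
  assumes u: "u \<in> model_space s" and v: "v \<in> model_space s"
  shows "unnormalized_sectional s u v =
    metric_unit (chr_unit u v) (chr_unit u v) - metric_unit (chr_unit u u) (chr_unit v v)"
proof -
  have s1: "s > 3/2" using s by simp
  define A where "A = chr_unit v v"
  define B where "B = chr_unit v u"
  note Am = chr_unit_model_space[OF s v v, folded A_def] and Bm = chr_unit_model_space[OF s v u, folded B_def]
  note nA = scale_model_space[OF Am, of "-1"] and nB = scale_model_space[OF Bm, of "-1"]
  note u1 = model_spaceD(1)[OF u] and v1 = model_spaceD(1)[OF v]
  note D = chr_lin_model_space[OF s v v u1] and E = chr_lin_model_space[OF s v u v1]
  note M = chr_unit_model_space[OF s nA u] and N = chr_unit_model_space[OF s nB v]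
  note nD = scale_model_space[OF D, of "-1"] and nE = scale_model_space[OF E, of "-1"]
  define fD where "fD x = - (dx v x * dx v x * dx u x * dx u x)
    - (fst A x * fst u x * dx u x - dx A x * dx u x * dx u x
       + snd A x * snd u x * dx u x)" for x
  define fE where "fE x = - (dx v x * dx u x * dx v x * dx u x)
    - (fst B x * fst u x * dx v x - dx B x * dx u x * dx v x
       + snd B x * snd u x * dx v x)" for x
  define fM where "fM x = (- fst A x * fst u x + 1/2 * (- dx A x * dx u x)
      + 1/2 * (- snd A x * snd u x)) * dx u x
    - 1/2 * (- dx A x * snd u x + dx u x * (- snd A x)) * snd u x" for x
  define fN where "fN x = (- fst B x * fst v x + 1/2 * (- dx B x * dx v x)
      + 1/2 * (- snd B x * snd v x)) * dx u x
    - 1/2 * (- dx B x * snd v x + dx v x * (- snd B x)) * snd u x" for x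
  define fA where "fA x = (fst u x * fst u x + 1/2 * (dx u x * dx u x)
      + 1/2 * (snd u x * snd u x)) * dx A x
    - 1/2 * (dx u x * snd u x + dx u x * snd u x) * snd A x" for x
  define fB where "fB x = (fst v x * fst u x + 1/2 * (dx v x * dx u x)
      + 1/2 * (snd v x * snd u x)) * dx B x
    - 1/2 * (dx v x * snd u x + dx u x * snd v x) * snd B x" for x
  note cont = model_space_continuous[OF s1 u] model_space_continuous[OF s1 v]
    model_space_continuous[OF s1 Am] model_space_continuous[OF s1 Bm]
  have cf: "continuous_on {0..1} fD" "continuous_on {0..1} fE" "continuous_on {0..1} fM"
    "continuous_on {0..1} fN" "continuous_on {0..1} fA" "continuous_on {0..1} fB"
    unfolding fD_def fE_def fM_def fN_def fA_def fB_def by (intro continuous_intros cont)+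
  note int = cf[THEN integrable_continuous_real]
    have mD: "metric_unit (chr_lin v v (fst u)) u = I01 fD"
    unfolding metric_chr_lin[OF v v u u1] fD_def A_def ..
  have mE: "metric_unit (chr_lin v u (fst v)) u = I01 fE"
    unfolding metric_chr_lin[OF v u u v1] fE_def B_def ..
  have mM: "metric_unit (chr_unit (scale_pair (-1) A) u) u = I01 fM"
    unfolding metric_chr_unit[OF nA u u] deriv_scale_pair[OF Am] fM_def by (simp add: scale_pair_def)
  have mN: "metric_unit (chr_unit (scale_pair (-1) B) v) u = I01 fN"
    unfolding metric_chr_unit[OF nB v u] deriv_scale_pair[OF Bm] fN_def by (simp add: scale_pair_def)
  have mA: "metric_unit (chr_unit u u) A = I01 fA"
    unfolding metric_chr_unit[OF u u Am] fA_def ..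
  have mB: "metric_unit B B = I01 fB"
    unfolding metric_chr_unit[OF v u Bm, folded B_def] fB_def ..
  have "unnormalized_sectional s u v = (I01 fE + I01 fN) - (I01 fD + I01 fM)"
    unfolding unnormalized_sectional_def metric_unit_G[OF s] curvature_at_unit_G[OF s u v]
      A_def[symmetric] B_def[symmetric]
    by (simp add: metric_unit_diff metric_unit_scale model_space_diff u nD nE D E M N mD mE mM mN)
  also have "\<dots> = I01 (\<lambda>x. (fE x + fN x) - (fD x + fM x))"
    by (simp add: integral_add integral_diff int integrable_add)
  also have "\<dots> = I01 (\<lambda>x. fB x - fA x)"
  \<comment> \<open>The products of four derivatives in \<open>fD\<close> and \<open>fE\<close>
    agree and the terms with second components cancel. What survives is
    \<open>A' * u * u + 2 * A * u * u'\<close> minus the analogous terms with \<open>B\<close>, for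
    first components; both groups are exact.\<close>
  proof (rule integral_eq_exact[OF s, where F = "\<lambda>x. fst A x * fst u x * fst u x - fst B x * fst u x * fst v x"], goal_cases)
    case (3 x)
    note d = sobolev_deriv(1)[OF u1 s1] sobolev_deriv(1)[OF v1 s1]
      sobolev_deriv(1)[OF model_spaceD(1)[OF Am] s1] sobolev_deriv(1)[OF model_spaceD(1)[OF Bm] s1]
    show ?case
      by (rule derivative_eq_intros d refl)+
         (simp add: fA_def fB_def fD_def fE_def fM_def fN_def algebra_simps)
  next
    case (4 x)
    then show ?case
      using sobolev_periodic[OF u1] sobolev_periodic[OF v1] sobolev_periodic[OF model_spaceD(1)[OF Am]]
        sobolev_periodic[OF model_spaceD(1)[OF Bm]] by simp
  qed (auto intro!: continuous_intros cf)
  also have "\<dots> = I01 fB - I01 fA" by (simp add: integral_diff int)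
  also have "\<dots> = metric_unit (chr_unit u v) (chr_unit u v) - metric_unit (chr_unit u u) (chr_unit v v)"
    unfolding mA[symmetric] mB[symmetric] unfolding A_def B_def chr_unit_sym[of v u] ..
  finally show ?thesis .
qed

end

section \<open>Trigonometric polynomials\<close>

definition freqs :: "real set" where
  "freqs = {2 * pi * of_int n | n. True}"

lemma freqs_add: "\<omega> \<in> freqs \<Longrightarrow> \<eta> \<in> freqs \<Longrightarrow> \<omega> + \<eta> \<in> freqs"
  and freqs_diff: "\<omega> \<in> freqs \<Longrightarrow> \<eta> \<in> freqs \<Longrightarrow> \<omega> - \<eta> \<in> freqs"
  unfolding freqs_def
  by (auto simp flip: distrib_left right_diff_distrib of_int_add of_int_diff)

lemma freqs_abs_ge:
  assumes "\<omega> \<in> freqs" "\<omega> \<noteq> 0"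
  shows "\<bar>\<omega>\<bar> \<ge> 2 * pi"
proof -
  obtain n :: int where n: "\<omega> = 2 * pi * of_int n" using assms(1) by (auto simp: freqs_def)
  then have "\<bar>n\<bar> \<ge> 1" using assms(2) by auto
  then have "1 \<le> \<bar>real_of_int n\<bar>" by linarith
  then show ?thesis unfolding n by (simp add: abs_mult)
qed

lemma wavenumbers_freqs: "k \<in> wavenumbers \<Longrightarrow> k \<in> freqs"
  unfolding wavenumbers_def freqs_def by (auto intro: exI[of _ "int _"])

lemma wavenumbers_ge: "k \<in> wavenumbers \<Longrightarrow> k \<ge> 2 * pi"
  unfolding wavenumbers_def by auto

lemma cos_periodic_freqs: "\<omega> \<in> freqs \<Longrightarrow> cos (\<omega> * (x + 1)) = cos (\<omega> * x)"
  and sin_periodic_freqs: "\<omega> \<in> freqs \<Longrightarrow> sin (\<omega> * (x + 1)) = sin (\<omega> * x)"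
  unfolding freqs_def
  by (auto simp: distrib_left cos_add sin_add simp del: mult.assoc)

lemma integral_cos_freqs:
  assumes "\<omega> \<in> freqs"
  shows "I01 (\<lambda>x. cos (\<omega> * x)) = (if \<omega> = 0 then 1 else 0)"
proof (cases "\<omega> = 0")
  case False
  have "((\<lambda>x. cos (\<omega> * x)) has_integral (sin (\<omega> * 1) / \<omega> - sin (\<omega> * 0) / \<omega>)) {0..1}"
    using False by (intro fundamental_theorem_of_calculus)
      (auto intro!: derivative_eq_intros simp: has_real_derivative_iff_has_vector_derivative[symmetric])
  moreover have "sin \<omega> = 0" using sin_periodic_freqs[OF assms, of 0] by simp
  ultimately show ?thesis using False by (simp add: integral_unique)
qed simp

text \<open>The integral of \<open>cos (\<omega> * x) * cos (\<eta> * x)\<close> over a period. The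
  two halves are kept apart so that zero frequencies give 1 and negative ones such as
  \<open>K - L\<close> are allowed.\<close>

definition gram :: "real \<Rightarrow> real \<Rightarrow> real" where
  "gram \<omega> \<eta> = (if \<omega> = \<eta> then 1/2 else 0) + (if \<omega> = - \<eta> then 1/2 else 0)"

lemma integral_cos_cos:
  assumes "\<omega> \<in> freqs" "\<eta> \<in> freqs"
  shows "I01 (\<lambda>x. cos (\<omega> * x) * cos (\<eta> * x)) = gram \<omega> \<eta>"
proof -
  have "(\<lambda>x. cos (\<omega> * x) * cos (\<eta> * x)) = (\<lambda>x. 1/2 * cos ((\<omega> - \<eta>) * x) + 1/2 * cos ((\<omega> + \<eta>) * x))"
    by (simp add: left_diff_distrib distrib_right cos_diff cos_add fun_eq_iff add_divide_distrib diff_divide_distrib)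
  moreover have "I01 (\<lambda>x. 1/2 * cos ((\<omega> - \<eta>) * x) + 1/2 * cos ((\<omega> + \<eta>) * x)) =
      1/2 * I01 (\<lambda>x. cos ((\<omega> - \<eta>) * x)) + 1/2 * I01 (\<lambda>x. cos ((\<omega> + \<eta>) * x))"
    by (subst integral_add) (auto intro!: integrable_continuous_real continuous_intros)
  ultimately show ?thesis
    using assms by (auto simp: integral_cos_freqs freqs_add freqs_diff gram_def)
qed

text \<open>The lists of frequencies may contain equal or opposite entries; all coincidences are
  left to \<open>gram\<close>, so that no case distinction is made at this stage.\<close>

lemma integral_trig_product:
  fixes c d w v :: "nat \<Rightarrow> real"
  assumes "\<And>i. i < n \<Longrightarrow> w i \<in> freqs" "\<And>j. j < m \<Longrightarrow> v j \<in> freqs"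
  shows "I01 (\<lambda>x. (\<Sum>i<n. c i * cos (w i * x)) * (\<Sum>j<m. d j * cos (v j * x))) =
    (\<Sum>i<n. \<Sum>j<m. c i * d j * gram (w i) (v j))"
proof -
  have "(\<lambda>x. (\<Sum>i<n. c i * cos (w i * x)) * (\<Sum>j<m. d j * cos (v j * x))) =
      (\<lambda>x. \<Sum>i<n. \<Sum>j<m. c i * d j * (cos (w i * x) * cos (v j * x)))"
    by (simp add: sum_product mult_ac)
  moreover have "I01 (\<lambda>x. \<Sum>i<n. \<Sum>j<m. c i * d j * (cos (w i * x) * cos (v j * x))) =
      (\<Sum>i<n. \<Sum>j<m. c i * d j * I01 (\<lambda>x. cos (w i * x) * cos (v j * x)))"
    by (subst integral_sum, (auto intro!: integrable_continuous_real continuous_intros)[2])+ simp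
  ultimately show ?thesis using assms by (simp add: integral_cos_cos)
qed

lemma cos_sobolev:
  assumes "\<omega> \<in> freqs"
  shows "(\<lambda>x. c * cos (\<omega> * x)) \<in> sobolev r"
proof (rule sobolev_cmult)
  obtain m :: int where m: "\<omega> = 2 * pi * of_int m" using assms by (auto simp: freqs_def)
  have cos: "of_real (cos (\<omega> * x)) = (fexp m x + fexp (- m) x) / 2" for x
    by (simp add: m fexp_def complex_eq_iff)
  have fc0: "fcoeff (\<lambda>x. cos (\<omega> * x)) n = 0" if n: "n \<notin> {m, - m}" for n
  proof -
    have "(\<lambda>x. of_real (cos (\<omega> * x)) * fexp (- n) x) = (\<lambda>x. 1/2 * fexp (m - n) x + 1/2 * fexp (- m - n) x)"
      unfolding cos using fexp_add[of m "- n"] fexp_add[of "- m" "- n"] by (simp add: fun_eq_iff algebra_simps)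
    moreover have "I01 (\<lambda>x. 1/2 * fexp (m - n) x + 1/2 * fexp (- m - n) x) =
        1/2 * I01 (fexp (m - n)) + 1/2 * I01 (fexp (- m - n))"
      by (subst integral_add) (auto intro!: integrable_continuous_real continuous_intros)
    ultimately show ?thesis using n by (simp add: fcoeff_fexp integral_fexp)
  qed
  let ?f = "\<lambda>x. cos (\<omega> * x)"
  show "?f \<in> sobolev r"
  proof (rule sobolevI(1))
    show "cos (\<omega> * (x + 1)) = cos (\<omega> * x)" for x by (rule cos_periodic_freqs[OF assms])
    fix F :: "int set" assume F: "finite F"
    have "L2_set (wcoeff r ?f) F \<le> (\<Sum>n\<in>F. wcoeff r ?f n)" by (rule L2_set_le_sum) simp
    also have "\<dots> = (\<Sum>n\<in>F \<inter> {m, - m}. wcoeff r ?f n)"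
      using F fc0 by (intro sum.mono_neutral_right) auto
    also have "\<dots> \<le> (\<Sum>n\<in>{m, - m}. wcoeff r ?f n)" by (intro sum_mono2) auto
    finally show "L2_set (wcoeff r ?f) F \<le> (\<Sum>n\<in>{m, - m}. wcoeff r ?f n)" .
  qed (intro continuous_intros)
qed

text \<open>Symbol of \<open>- A\<inverse> d^2/dx^2\<close>, the operator that takes
  \<open>pot\<close> to the derivative of the first component of the Christoffel map.\<close>

definition hsymb :: "real \<Rightarrow> real" where
  "hsymb \<omega> = \<omega>\<^sup>2 / (1 + \<omega>\<^sup>2)"

lemma hsymb_bounds: "0 \<le> hsymb \<omega>" "hsymb \<omega> \<le> 1" "\<bar>\<omega>\<bar> \<ge> 1 \<Longrightarrow> hsymb \<omega> \<ge> 1/2"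
proof -
  have p: "1 + \<omega>\<^sup>2 > 0" by (simp add: add_pos_nonneg)
  show "0 \<le> hsymb \<omega>" "hsymb \<omega> \<le> 1" using p by (simp_all add: hsymb_def)
  assume "\<bar>\<omega>\<bar> \<ge> 1"
  then have "\<omega>\<^sup>2 \<ge> 1" using power_mono[of 1 "\<bar>\<omega>\<bar>" 2] by simp
  then show "hsymb \<omega> \<ge> 1/2" using p by (simp add: hsymb_def field_simps)
qed

lemma hsymb_0 [simp]: "hsymb 0 = 0" and hsymb_uminus [simp]: "hsymb (- \<omega>) = hsymb \<omega>"
  by (simp_all add: hsymb_def)

text \<open>The component \<open>X\<close> and its companion \<open>r\<close> solve
  \<open>X' = - r + pot\<close>, \<open>r' = - X\<close>, and the explicit trigonometric sums
  \<open>P\<close>, \<open>Q\<close> solve the same system. The sum and the difference of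
  \<open>X - P\<close> and \<open>r - Q\<close> then satisfy periodic exponential equations, hence
  vanish.\<close>

lemma deriv_chr_unit_trig:
  fixes c w :: "nat \<Rightarrow> real"
  assumes s: "s > 5/2" and U: "U \<in> model_space s" and V: "V \<in> model_space s"
    and w: "\<And>i. i < n \<Longrightarrow> w i \<in> freqs"
    and a: "\<And>x. fst U x * fst V x + 1/2 * (dx U x * dx V x) + 1/2 * (snd U x * snd V x) =
      (\<Sum>i<n. c i * cos (w i * x))"
  shows "dx (chr_unit U V) x = (\<Sum>i<n. c i * hsymb (w i) * cos (w i * x))"
proof -
  have s1: "s > 3/2" using s by simp
  note C = chr_coefficients_sobolev[OF s U V]
  define r where "r x = conj_rot0 (uu U V) (dd U V) x
    + 1/2 * conj_rot0 (rr U V) (\<lambda>x. 0) x" for x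
  define X where "X = fst (chr_unit U V)"
  have X: "X \<in> sobolev s" unfolding X_def by (rule model_spaceD(1)[OF chr_unit_model_space[OF s U V]])
  have dX: "deriv X x = - r x + (\<Sum>i<n. c i * cos (w i * x))" for x
    unfolding X_def deriv_chr_unit[OF s U V] a[symmetric] r_def by (simp add: algebra_simps)
  have X': "(X has_real_derivative - r x + (\<Sum>i<n. c i * cos (w i * x))) (at x)" for x
    using sobolev_deriv(1)[OF X s1, of x] unfolding dX .
  have r': "(r has_real_derivative - X x) (at x)" for x
    unfolding r_def[abs_def] X_def chr_unit_def fst_conv
    by (rule derivative_eq_intros conj_has_derivative(2)[OF s1 C(1,2)]
        conj_has_derivative(2)[OF s1 C(3) sobolev_const(1)[of 0]] refl | simp)+
  have per: "X (x + 1) = X x" "r (x + 1) = r x" for x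
    using sobolev_periodic[OF X] conj_has_derivative(3)[OF s1 C(1,2)]
      conj_has_derivative(3)[OF s1 C(3) sobolev_const(1)[of 0]] by (simp_all add: r_def)
  define P where "P x = (\<Sum>i<n. c i * (w i / (1 + (w i)\<^sup>2)) * sin (w i * x))" for x
  define Q where "Q x = (\<Sum>i<n. c i / (1 + (w i)\<^sup>2) * cos (w i * x))" for x
  have nz: "1 + (y::real)\<^sup>2 \<noteq> 0" for y
    using zero_le_power2[of y] by linarith
  have sc: "((\<lambda>x. a * sin (v * x)) has_real_derivative a * (cos (v * x) * v)) (at x)"
    "((\<lambda>x. a * cos (v * x)) has_real_derivative a * (- sin (v * x) * v)) (at x)" for a v x :: real
    by (intro DERIV_cmult; auto intro!: derivative_eq_intros)+
  have P': "(P has_real_derivative (\<Sum>i<n. c i * hsymb (w i) * cos (w i * x))) (at x)" for x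
  proof -
    have "(P has_real_derivative (\<Sum>i<n. c i * (w i / (1 + (w i)\<^sup>2)) * (cos (w i * x) * w i))) (at x)"
      unfolding P_def[abs_def] by (rule DERIV_sum) (rule sc)
    then show ?thesis by (simp add: hsymb_def power2_eq_square mult_ac)
  qed
  have Q': "(Q has_real_derivative - P x) (at x)" for x
  proof -
    have "(Q has_real_derivative (\<Sum>i<n. c i / (1 + (w i)\<^sup>2) * (- sin (w i * x) * w i))) (at x)"
      unfolding Q_def[abs_def] by (rule DERIV_sum) (rule sc)
    then show ?thesis by (simp add: P_def mult_ac flip: sum_negf)
  qed
  have PQ: "(\<Sum>i<n. c i * hsymb (w i) * cos (w i * x)) = - Q x + (\<Sum>i<n. c i * cos (w i * x))" for x
  proof -
    have "c * hsymb v * z = - (c / (1 + v\<^sup>2) * z) + c * z" for c v z :: real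
      using nz[of v] unfolding hsymb_def by (simp add: divide_simps) (simp add: algebra_simps)
    then show ?thesis unfolding Q_def by (simp add: sum_subtractf sum_negf flip: sum.distrib)
  qed
  have perPQ: "P (x + 1) = P x" "Q (x + 1) = Q x" for x
    unfolding P_def Q_def using w by (auto intro!: sum.cong simp: cos_periodic_freqs sin_periodic_freqs)
  have "(X x - P x) + (r x - Q x) = 0" for x
  proof (rule periodic_exponential_zero[where k = "-1" and f = "\<lambda>x. (X x - P x) + (r x - Q x)"])
    show "((\<lambda>x. (X x - P x) + (r x - Q x)) has_real_derivative -1 * ((X x - P x) + (r x - Q x))) (at x)" for x
      by (rule derivative_eq_intros X' P' r' Q' refl)+ (simp add: PQ)
  qed (simp_all add: per perPQ)
  moreover have "(X x - P x) - (r x - Q x) = 0" for x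
  proof (rule periodic_exponential_zero[where k = 1 and f = "\<lambda>x. (X x - P x) - (r x - Q x)"])
    show "((\<lambda>x. (X x - P x) - (r x - Q x)) has_real_derivative 1 * ((X x - P x) - (r x - Q x))) (at x)" for x
      by (rule derivative_eq_intros X' P' r' Q' refl)+ (simp add: PQ)
  qed (simp_all add: per perPQ)
  ultimately have "r x = Q x" for x by (smt (verit))
  then show ?thesis unfolding X_def[symmetric] dX PQ by simp
qed

text \<open>With \<open>a = u1' * v2\<close> and \<open>b = v1' * u2\<close> the second components
  contribute \<open>(a + b)^2 / 4 - a * b = (a - b)^2 / 4\<close>; the remaining two integrals come
  from the first components.\<close>

lemma unnormalized_sectional_split:
  assumes s: "s > 5/2" and u: "u \<in> model_space s" and v: "v \<in> model_space s"
  shows "unnormalized_sectional s u v =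
    I01 (\<lambda>x. pot u v x
      * dx (chr_unit u v) x)
    - I01 (\<lambda>x. pot u u x
      * dx (chr_unit v v) x)
    + 1/4 * I01 (\<lambda>x. (dx u x * snd v x - dx v x * snd u x)\<^sup>2)"
  (is "_ = integral _ ?f - integral _ ?g + 1/4 * integral _ ?h")
proof -
  have s1: "s > 3/2" using s by simp
  note G = chr_unit_model_space[OF s u v] chr_unit_model_space[OF s v v]
  note cont = model_space_continuous[OF s1 u] model_space_continuous[OF s1 v]
    model_space_continuous[OF s1 G(1)] model_space_continuous[OF s1 G(2)]
  let ?p = "\<lambda>x. 1/4 * (dx u x * snd v x + dx v x * snd u x)\<^sup>2"
    and ?q = "\<lambda>x. dx u x * snd u x * dx v x * snd v x"
  have int: "?f integrable_on {0..1}" "?g integrable_on {0..1}" "?p integrable_on {0..1}" "?q integrable_on {0..1}"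
    by (intro integrable_continuous_real continuous_intros cont)+
  have "metric_unit (chr_unit u v) (chr_unit u v) = I01 (\<lambda>x. ?f x + ?p x)"
    unfolding metric_chr_unit[OF s u v G(1)]
    by (rule integral_cong) (simp add: chr_unit_def power2_eq_square algebra_simps)
  moreover have "metric_unit (chr_unit u u) (chr_unit v v) = I01 (\<lambda>x. ?g x + ?q x)"
    unfolding metric_chr_unit[OF s u u G(2)]
    by (rule integral_cong) (simp add: chr_unit_def power2_eq_square algebra_simps)
  moreover have "I01 ?p - I01 ?q = 1/4 * I01 ?h"
    unfolding integral_diff[OF int(3,4), symmetric] integral_mult_right[symmetric]
    by (rule integral_cong) (simp add: power2_eq_square algebra_simps)
  ultimately show ?thesis
    unfolding unnormalized_sectional_eq[OF s u v] using integral_add[OF int(1,3)] integral_add[OF int(2,4)] by simp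
qed

text \<open>\<open>p = 1\<close> and \<open>p = 0\<close> are the two families of the proposition.\<close>

definition cos_pair :: "real \<Rightarrow> real \<Rightarrow> real \<Rightarrow> circle_pair" where
  "cos_pair p k K = (\<lambda>x. p * cos (k * x), \<lambda>x. cos (K * x))"

text \<open>Coefficients of \<open>pot\<close> by the product-to-sum formulas. The product of
  derivatives adds \<open>p^2 * k * l / 2\<close> times a product of sines, which enters with
  opposite signs at \<open>k + l\<close> and \<open>k - l\<close>.\<close>

definition prod_coeff :: "real \<Rightarrow> real \<Rightarrow> real \<Rightarrow> nat \<Rightarrow> real" where
  "prod_coeff p k l i = [p\<^sup>2 * (1/2 - k * l / 4), p\<^sup>2 * (1/2 + k * l / 4), 1/4, 1/4] ! i"

definition prod_freq :: "real \<Rightarrow> real \<Rightarrow> real \<Rightarrow> real \<Rightarrow> nat \<Rightarrow> real" where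
  "prod_freq k l K L i = [k + l, k - l, K + L, K - L] ! i"

section \<open>Curvature of cosine pairs as finite quadratic forms\<close>

lemma cos_pair_model_space: "k \<in> freqs \<Longrightarrow> K \<in> freqs \<Longrightarrow> cos_pair p k K \<in> model_space s"
  using cos_sobolev[of k p s] cos_sobolev[of K 1 "s - 1"] by (simp add: cos_pair_def model_space_def)

lemma cos_pair_sel:
  "fst (cos_pair p k K) x = p * cos (k * x)" "snd (cos_pair p k K) x = cos (K * x)"
  "dx (cos_pair p k K) x = - p * k * sin (k * x)"
proof -
  have "((\<lambda>x. p * cos (k * x)) has_real_derivative - p * k * sin (k * x)) (at x)"
    by (auto intro!: derivative_eq_intros)
  then show "dx (cos_pair p k K) x = - p * k * sin (k * x)"
    by (simp add: cos_pair_def DERIV_imp_deriv)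
qed (simp_all add: cos_pair_def)

lemma sum_lessThan_4: "(\<Sum>i<4::nat. f i) = f 0 + f 1 + f 2 + (f 3 :: real)"
  by (simp add: eval_nat_numeral)

lemma prod_simps:
  "prod_coeff p k l 0 = p\<^sup>2 * (1/2 - k * l / 4)" "prod_coeff p k l 1 = p\<^sup>2 * (1/2 + k * l / 4)"
  "prod_coeff p k l 2 = 1/4" "prod_coeff p k l 3 = 1/4"
  "prod_freq k l K L 0 = k + l" "prod_freq k l K L 1 = k - l"
  "prod_freq k l K L 2 = K + L" "prod_freq k l K L 3 = K - L"
  by (simp_all add: prod_coeff_def prod_freq_def)

lemma cos_pair_product:
  "fst (cos_pair p k K) x * fst (cos_pair p l L) x
   + 1/2 * (dx (cos_pair p k K) x * dx (cos_pair p l L) x)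
   + 1/2 * (snd (cos_pair p k K) x * snd (cos_pair p l L) x)
   = (\<Sum>i<4. prod_coeff p k l i * cos (prod_freq k l K L i * x))"
  unfolding cos_pair_sel sum_lessThan_4 prod_simps
  by (simp add: distrib_right left_diff_distrib cos_add cos_diff)
     (simp add: field_simps power2_eq_square)

lemma prod_freq_freqs:
  assumes "k \<in> freqs" "l \<in> freqs" "K \<in> freqs" "L \<in> freqs" "i < 4"
  shows "prod_freq k l K L i \<in> freqs"
proof -
  have "i = 0 \<or> i = 1 \<or> i = 2 \<or> i = 3" using assms(5) by auto
  then show ?thesis using assms by (auto simp: prod_freq_def freqs_add freqs_diff)
qed

lemma gram_props:
  "gram \<omega> \<eta> \<ge> 0" "gram \<omega> \<eta> = gram \<eta> \<omega>" "hsymb \<eta> * gram \<omega> \<eta> = hsymb \<omega> * gram \<omega> \<eta>"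
  "hsymb \<omega> * gram \<omega> \<omega> = hsymb \<omega> / 2"
  by (auto simp: gram_def)

text \<open>Contribution of the first components to the square of the Christoffel map at
  \<open>(u, v)\<close>; \<open>cross_part\<close> below is the one to its pairing between
  \<open>(u, u)\<close> and \<open>(v, v)\<close>.\<close>

definition norm_part :: "real \<Rightarrow> real \<Rightarrow> real \<Rightarrow> real \<Rightarrow> real \<Rightarrow> real" where
  "norm_part p k l K L = (\<Sum>i<4. \<Sum>j<4. prod_coeff p k l i *
     (prod_coeff p k l j * hsymb (prod_freq k l K L j)) * gram (prod_freq k l K L i) (prod_freq k l K L j))"

definition cross_part :: "real \<Rightarrow> real \<Rightarrow> real \<Rightarrow> real \<Rightarrow> real \<Rightarrow> real" where
  "cross_part p k l K L = (\<Sum>i<4. \<Sum>j<4. prod_coeff p k k i *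
     (prod_coeff p l l j * hsymb (prod_freq l l L L j)) * gram (prod_freq k k K K i) (prod_freq l l L L j))"

lemma unnormalized_sectional_cos_pair:
  assumes s: "s > 5/2" and f: "k \<in> freqs" "l \<in> freqs" "K \<in> freqs" "L \<in> freqs"
  shows "unnormalized_sectional s (cos_pair p k K) (cos_pair p l L) =
    norm_part p k l K L - cross_part p k l K L
    + 1/4 * I01 (\<lambda>x. (- p * k * sin (k * x) * cos (L * x) - (- p * l * sin (l * x)) * cos (K * x))\<^sup>2)"
proof -
  note u = cos_pair_model_space[OF f(1,3)] and v = cos_pair_model_space[OF f(2,4)]
  have d: "deriv (fst (chr_unit (cos_pair p k K) (cos_pair p l L))) x =
      (\<Sum>i<4. prod_coeff p k l i * hsymb (prod_freq k l K L i) * cos (prod_freq k l K L i * x))" for x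
    by (rule deriv_chr_unit_trig[OF s u v prod_freq_freqs[OF f] cos_pair_product])
  have d': "deriv (fst (chr_unit (cos_pair p l L) (cos_pair p l L))) x =
      (\<Sum>i<4. prod_coeff p l l i * hsymb (prod_freq l l L L i) * cos (prod_freq l l L L i * x))" for x
    by (rule deriv_chr_unit_trig[OF s v v prod_freq_freqs[OF f(2,2,4,4)] cos_pair_product])
  have i1: "I01 (\<lambda>x. (\<Sum>i<4. c i * cos (prod_freq k l K L i * x)) * (\<Sum>j<4. d j * cos (prod_freq k l K L j * x)))
      = (\<Sum>i<4. \<Sum>j<4. c i * d j * gram (prod_freq k l K L i) (prod_freq k l K L j))" for c d
    by (rule integral_trig_product) (rule prod_freq_freqs[OF f], assumption)+
  have i2: "I01 (\<lambda>x. (\<Sum>i<4. c i * cos (prod_freq k k K K i * x)) * (\<Sum>j<4. d j * cos (prod_freq l l L L j * x)))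
      = (\<Sum>i<4. \<Sum>j<4. c i * d j * gram (prod_freq k k K K i) (prod_freq l l L L j))" for c d
    by (rule integral_trig_product; rule prod_freq_freqs[OF f(1,1,3,3)] prod_freq_freqs[OF f(2,2,4,4)]; assumption)
  show ?thesis
    unfolding unnormalized_sectional_split[OF s u v] d d' cos_pair_product
      i1 i2 norm_part_def cross_part_def
    by (simp only: cos_pair_sel)
qed

text \<open>For positive wavenumbers \<open>k + l\<close> never meets \<open>k - l\<close> up to
  sign, nor \<open>K + L\<close> meets \<open>K - L\<close>. The other mixed terms occur in
  symmetric pairs with the common factor \<open>2 * 1/4\<close>. On the diagonal \<open>gram\<close>
  counts as 1/2 even at frequency 0, where \<open>hsymb\<close> vanishes.\<close>

lemma norm_part_eq:
  fixes k l K L p :: real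
  assumes "k > 0" "l > 0" "K > 0" "L > 0"
  defines "c1 \<equiv> p\<^sup>2 * (1/2 - k * l / 4)" and "c2 \<equiv> p\<^sup>2 * (1/2 + k * l / 4)"
  shows "norm_part p k l K L =
    1/2 * c1\<^sup>2 * hsymb (k + l) + 1/2 * c2\<^sup>2 * hsymb (k - l) + 1/32 * (hsymb (K + L) + hsymb (K - L))
    + 1/2 * c1 * hsymb (k + l) * (gram (k + l) (K + L) + gram (k + l) (K - L))
    + 1/2 * c2 * hsymb (k - l) * (gram (k - l) (K + L) + gram (k - l) (K - L))"
proof -
  have z: "gram (k + l) (k - l) = 0" "gram (k - l) (k + l) = 0" "gram (K + L) (K - L) = 0" "gram (K - L) (K + L) = 0"
    using assms(1-4) by (auto simp: gram_def)
  have h: "c * hsymb \<eta> * gram \<omega> \<eta> = c * hsymb \<omega> * gram \<omega> \<eta>" for c \<omega> \<eta>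
    using gram_props(3)[of \<eta> \<omega>] by (simp add: mult.assoc)
  have d: "a * (a * hsymb \<omega>) * gram \<omega> \<omega> = 1/2 * a\<^sup>2 * hsymb \<omega>" for a \<omega>
    using gram_props(4)[of \<omega>] by (simp add: power2_eq_square mult.assoc mult.left_commute)
  have o: "a * (b * hsymb \<eta>) * gram \<omega> \<eta> + b * (a * hsymb \<omega>) * gram \<eta> \<omega> = 2 * a * b * hsymb \<omega> * gram \<omega> \<eta>" for a b \<omega> \<eta>
    using h[of "a * b" \<eta> \<omega>] gram_props(2)[of \<eta> \<omega>] by (simp add: mult_ac)
  show ?thesis
    unfolding norm_part_def sum_lessThan_4 prod_simps c1_def[symmetric] c2_def[symmetric] z
    unfolding distrib_left
    using o[of c1 "1/4" "K + L" "k + l"] o[of c1 "1/4" "K - L" "k + l"]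
      o[of c2 "1/4" "K + L" "k - l"] o[of c2 "1/4" "K - L" "k - l"]
      d[of c1 "k + l"] d[of c2 "k - l"] d[of "1/4" "K + L"] d[of "1/4" "K - L"]
    by (simp only: mult_zero_right mult_1_right power_one_over power2_eq_square)
qed

text \<open>The differences \<open>k - k\<close> and \<open>K - K\<close> give constants: on one
  side they are killed by \<open>hsymb 0 = 0\<close>, on the other they are orthogonal to the
  nonconstant cosines.\<close>

lemma cross_part_eq:
  fixes k l K L p :: real
  assumes "k > 0" "l > 0" "K > 0" "L > 0"
  defines "a \<equiv> p\<^sup>2 * (1/2 - k * k / 4)" and "b \<equiv> p\<^sup>2 * (1/2 - l * l / 4)"
  shows "cross_part p k l K L =
    a * b * hsymb (2 * l) * gram (2 * k) (2 * l) + 1/4 * a * hsymb (2 * L) * gram (2 * k) (2 * L)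
    + 1/4 * b * hsymb (2 * l) * gram (2 * K) (2 * l) + 1/16 * hsymb (2 * L) * gram (2 * K) (2 * L)"
proof -
  have z: "gram 0 (2 * l) = 0" "gram 0 (2 * L) = 0"
    using assms(1-4) by (auto simp: gram_def)
  show ?thesis
    unfolding cross_part_def sum_lessThan_4 prod_simps a_def[symmetric] b_def[symmetric]
      mult_2[symmetric] diff_self z hsymb_0
    by simp
qed

section \<open>Coinciding frequencies and the lower bounds\<close>

lemma gram_le: "\<omega> > 0 \<Longrightarrow> \<eta> > 0 \<Longrightarrow> gram \<omega> \<eta> \<le> 1/2" "\<omega> \<noteq> \<eta> \<Longrightarrow> \<omega> > 0 \<Longrightarrow> \<eta> > 0 \<Longrightarrow> gram \<omega> \<eta> = 0"
  by (auto simp: gram_def)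

text \<open>\<open>K + L\<close> exceeds the modulus of \<open>K - L\<close>, so
  \<open>\<omega>\<close> matches at most one of them, and being positive it matches with only one
  sign.\<close>

lemma gram_sum_le:
  assumes "\<omega> > 0" "K > 0" "L > 0"
  shows "gram \<omega> (K + L) + gram \<omega> (K - L) \<le> 1/2"
  using assms by (auto simp: gram_def)

lemma pi_sq_ge: "x \<ge> 2 * pi \<Longrightarrow> y \<ge> 2 * pi \<Longrightarrow> x * y \<ge> (36 :: real)"
  using mult_mono[of 6 x 6 y] pi_gt3 by simp

text \<open>The only term of \<open>norm_part\<close> that can be negative comes from a coincidence
  with \<open>k + l\<close>; the square absorbs it, as \<open>c1 \<le> -1/2\<close> and
  \<open>G \<le> 1/2\<close> give \<open>c1^2 + c1 * G \<ge> 0\<close>. The frequency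
  \<open>k - l\<close> alone contributes at least \<open>1/4\<close>. In \<open>cross_part\<close>
  the first term vanishes because \<open>k \<noteq> l\<close>, the mixed ones are nonpositive, and
  the last is at most \<open>1/32\<close>.\<close>

lemma unnormalized_sectional_pos_distinct:
  assumes s: "s > 5/2" and W: "k \<in> wavenumbers" "l \<in> wavenumbers" "K \<in> wavenumbers" "L \<in> wavenumbers"
    and kl: "k \<noteq> l"
  shows "unnormalized_sectional s (cos_pair 1 k K) (cos_pair 1 l L) > 0"
proof -
  note g = W[THEN wavenumbers_ge] and f = W[THEN wavenumbers_freqs]
  have pos: "k > 0" "l > 0" "K > 0" "L > 0" using g pi_gt3 by linarith+
  define c1 c2 a b where "c1 = 1/2 - k * l / 4" and "c2 = 1/2 + k * l / 4"
    and "a = 1/2 - k * k / 4" and "b = 1/2 - l * l / 4"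
  have c: "c1 \<le> -1/2" "c2 \<ge> 1" "a \<le> 0" "b \<le> 0"
    using pi_sq_ge[OF g(1) g(2)] pi_sq_ge[OF g(1) g(1)] pi_sq_ge[OF g(2) g(2)]
    by (simp_all add: c1_def c2_def a_def b_def)
  note h = hsymb_bounds(1,2)
  define G where "G = gram (k + l) (K + L) + gram (k + l) (K - L)"
  have G: "0 \<le> G" "G \<le> 1/2" unfolding G_def using gram_props(1) gram_sum_le pos by (auto intro: add_nonneg_nonneg)
  have "1/2 * c1\<^sup>2 * hsymb (k + l) + 1/2 * c1 * hsymb (k + l) * G \<ge> 0"
  proof -
    have "c1 * G \<ge> c1 * (1/2)" using G c by (intro mult_left_mono_neg) auto
    moreover have "c1 * (c1 + 1/2) \<ge> 0" using c by (intro mult_nonpos_nonpos) auto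
    ultimately have "c1\<^sup>2 + c1 * G \<ge> 0" by (simp add: power2_eq_square algebra_simps)
    then have "1/2 * hsymb (k + l) * (c1\<^sup>2 + c1 * G) \<ge> 0" using h by (intro mult_nonneg_nonneg) auto
    then show ?thesis by (simp add: algebra_simps)
  qed
  moreover have "1/2 * c2\<^sup>2 * hsymb (k - l) \<ge> 1/4"
  proof -
    have "\<bar>k - l\<bar> \<ge> 1" using freqs_abs_ge[OF freqs_diff[OF f(1,2)]] kl pi_gt3 by auto
    then have "hsymb (k - l) \<ge> 1/2" by (rule hsymb_bounds(3))
    moreover have "c2\<^sup>2 \<ge> 1" using c by simp
    ultimately have "c2\<^sup>2 * hsymb (k - l) \<ge> 1 * (1/2)" by (intro mult_mono) auto
    then show ?thesis by simp
  qed
  moreover have "1/2 * c2 * hsymb (k - l) * (gram (k - l) (K + L) + gram (k - l) (K - L)) \<ge> 0"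
    using c h gram_props(1) by (intro mult_nonneg_nonneg add_nonneg_nonneg) auto
  moreover have aux: "1/4 \<le> X + Y + 1/32 * (P + Q) + Z + V"
    if "0 \<le> X + Z" "1/4 \<le> Y" "0 \<le> V" "0 \<le> P" "0 \<le> Q" for X Y Z V P Q :: real
    using that by (simp add: add_divide_distrib)
  ultimately have N: "norm_part 1 k l K L \<ge> 1/4"
    unfolding norm_part_eq[OF pos] power_one mult_1 c1_def[symmetric] c2_def[symmetric] G_def[symmetric]
    by (intro aux h)
  have "1/4 * a * hsymb (2 * L) * gram (2 * k) (2 * L) \<le> 0" "1/4 * b * hsymb (2 * l) * gram (2 * K) (2 * l) \<le> 0"
    using c h gram_props(1) by (auto intro!: mult_nonpos_nonneg)
  moreover have "1/16 * hsymb (2 * L) * gram (2 * K) (2 * L) \<le> 1/16 * 1 * (1/2)"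
    using h gram_props(1) gram_le(1) pos by (intro mult_mono mult_left_mono mult_nonneg_nonneg) auto
  moreover have "gram (2 * k) (2 * l) = 0" using gram_le(2) pos kl by simp
  ultimately have T: "cross_part 1 k l K L \<le> 1/32"
    unfolding cross_part_eq[OF pos] by (simp add: a_def[symmetric] b_def[symmetric])
  have "I01 (\<lambda>x. (- 1 * k * sin (k * x) * cos (L * x) - (- 1 * l * sin (l * x)) * cos (K * x))\<^sup>2) \<ge> 0"
    by (intro integral_nonneg integrable_continuous_real continuous_intros) auto
  then show ?thesis
    unfolding unnormalized_sectional_cos_pair[OF s f] using N T by simp
qed

text \<open>In the cosine expansion the constant terms give 1/2. Since \<open>K \<noteq> L\<close>,
  \<open>2 * k\<close> equals at most one of \<open>2 * K\<close> and \<open>2 * L\<close>, which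
  costs at most \<open>1/4 * 1/2 = 1/8\<close>; coincidences with \<open>K + L\<close> or
  \<open>K - L\<close> only add.\<close>

lemma integral_sin_sq_cos_diff_sq:
  assumes f: "k \<in> freqs" "K \<in> freqs" "L \<in> freqs" and pos: "k > 0" "K > 0" "L > 0" and KL: "K \<noteq> L"
  shows "I01 (\<lambda>x. (sin (k * x))\<^sup>2 * (cos (K * x) - cos (L * x))\<^sup>2) \<ge> 3/8"
proof -
  let ?c = "(!) [1/2, -1/2 :: real]" and ?w = "(!) [0, k + k]"
    and ?d = "(!) [1, 1/2, 1/2, -1, -1 :: real]" and ?v = "(!) [0, K + K, L + L, K + L, K - L]"
  have eq: "(sin (k * x))\<^sup>2 * (cos (K * x) - cos (L * x))\<^sup>2 =
      (\<Sum>i<2. ?c i * cos (?w i * x)) * (\<Sum>j<5. ?d j * cos (?v j * x))" for x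
  proof -
    have "cos ((k + k) * x) = 1 - 2 * (sin (k * x))\<^sup>2"
      using cos_double_sin[of "k * x"] by (simp add: algebra_simps)
    then have "(sin (k * x))\<^sup>2 = 1/2 * cos (0 * x) + (-1/2) * cos ((k + k) * x)"
      by (simp add: diff_divide_distrib)
    also have "\<dots> = (\<Sum>i<2. ?c i * cos (?w i * x))" by (simp add: eval_nat_numeral)
    finally have "(sin (k * x))\<^sup>2 = (\<Sum>i<2. ?c i * cos (?w i * x))" .
    moreover have "(cos (K * x) - cos (L * x))\<^sup>2 = (\<Sum>j<5. ?d j * cos (?v j * x))"
    proof -
      have c: "cos ((w + w) * x) = 2 * (cos (w * x))\<^sup>2 - 1" for w :: real
        using cos_double_cos[of "w * x"] by (simp add: algebra_simps)
      have e: "cos ((K + L) * x) = cos (K * x) * cos (L * x) - sin (K * x) * sin (L * x)"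
        "cos ((K - L) * x) = cos (K * x) * cos (L * x) + sin (K * x) * sin (L * x)"
        by (simp_all add: distrib_right left_diff_distrib cos_add cos_diff)
      have "(\<Sum>j<5. ?d j * cos (?v j * x)) = 1 + 1/2 * cos ((K + K) * x) + 1/2 * cos ((L + L) * x)
          - cos ((K + L) * x) - cos ((K - L) * x)"
        by (simp add: eval_nat_numeral)
      also have "\<dots> = (cos (K * x) - cos (L * x))\<^sup>2"
        unfolding c e by (simp add: power2_eq_square algebra_simps)
      finally show ?thesis by simp
    qed
    ultimately show ?thesis by simp
  qed
  have "I01 (\<lambda>x. (\<Sum>i<2. ?c i * cos (?w i * x)) * (\<Sum>j<5. ?d j * cos (?v j * x)))
      = (\<Sum>i<2. \<Sum>j<5. ?c i * ?d j * gram (?w i) (?v j))"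
  proof (rule integral_trig_product)
    have z: "0 \<in> freqs" using freqs_diff[OF f(1,1)] by simp
    fix i :: nat
    show "?w i \<in> freqs" if "i < 2"
      using that z freqs_add[OF f(1,1)] by (auto simp: less_Suc_eq numeral_eq_Suc)
    show "?v i \<in> freqs" if "i < 5"
      using that z freqs_add[OF f(2,2)] freqs_add[OF f(3,3)] freqs_add[OF f(2,3)] freqs_diff[OF f(2,3)]
      by (auto simp: less_Suc_eq numeral_eq_Suc)
  qed
  also have "\<dots> = 1/2 * (gram 0 0 - gram 0 (K - L)) - 1/2 * gram 0 (K + L) + 1/4 * gram 0 (K + K) + 1/4 * gram 0 (L + L)
      - 1/2 * gram (k + k) 0 - 1/4 * (gram (k + k) (K + K) + gram (k + k) (L + L))
      + 1/2 * (gram (k + k) (K + L) + gram (k + k) (K - L))"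
    by (simp add: eval_nat_numeral algebra_simps)
  also have "\<dots> \<ge> 3/8"
  proof -
    have "gram 0 0 = 1" "gram 0 (K - L) = 0" "gram 0 (K + L) = 0" "gram 0 (K + K) = 0" "gram 0 (L + L) = 0" "gram (k + k) 0 = 0"
      using pos KL by (auto simp: gram_def)
    moreover have "gram (k + k) (K + K) + gram (k + k) (L + L) \<le> 1/2" using pos KL by (auto simp: gram_def)
    ultimately show ?thesis using gram_props(1)[of "k + k" "K + L"] gram_props(1)[of "k + k" "K - L"]
      by (simp add: add_divide_distrib)
  qed
  finally show ?thesis unfolding eq .
qed

text \<open>With equal first wavenumbers the large terms \<open>1/2 * a^2 * H\<close> of both parts
  cancel and \<open>k - l = 0\<close> drops out. What is left is at least
  \<open>a / 4 = 1/8 - k^2 / 16\<close>, because \<open>G \<le> 1/2\<close> and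
  \<open>H \<le> 1\<close>. The second components add at least \<open>1/4 * 3/8 * k^2\<close>, which
  outweighs it.\<close>

lemma unnormalized_sectional_pos_equal:
  assumes s: "s > 5/2" and W: "k \<in> wavenumbers" "K \<in> wavenumbers" "L \<in> wavenumbers" and KL: "K \<noteq> L"
  shows "unnormalized_sectional s (cos_pair 1 k K) (cos_pair 1 k L) > 0"
proof -
  note g = W[THEN wavenumbers_ge] and f = W[THEN wavenumbers_freqs]
  have pos: "k > 0" "K > 0" "L > 0" using g pi_gt3 by linarith+
  define a where "a = 1/2 - k * k / 4"
  have a: "a \<le> 0" using pi_sq_ge[OF g(1) g(1)] by (simp add: a_def)
  note h = hsymb_bounds(1,2)
  define H where "H = hsymb (k + k)"
  define G where "G = gram (k + k) (K + L) + gram (k + k) (K - L)"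
  have G: "G \<le> 1/2" unfolding G_def using gram_sum_le pos by simp
  have H: "0 \<le> H" "H \<le> 1" unfolding H_def by (rule h)+
  have aH: "a * H \<le> 0" using a H by (simp add: mult_nonpos_nonneg)
  have "(a * H) * G \<ge> (a * H) * (1/2)" using G aH by (intro mult_left_mono_neg) auto
  then have "1/2 * a * H * G \<ge> 1/4 * (a * H)" by (simp add: mult.commute)
  moreover have "norm_part 1 k k K L =
      1/2 * a\<^sup>2 * H + 1/32 * hsymb (K + L) + 1/32 * hsymb (K - L) + 1/2 * a * H * G"
    unfolding norm_part_eq[OF pos(1,1,2,3)] power_one mult_1 a_def[symmetric] G_def[symmetric] H_def[symmetric]
    by (simp add: add_divide_distrib)
  ultimately have N: "norm_part 1 k k K L \<ge> 1/2 * a\<^sup>2 * H + 1/4 * (a * H)"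
    using h(1)[of "K + L"] h(1)[of "K - L"] by (simp only:)
  have "1/4 * a * hsymb (2 * L) * gram (2 * k) (2 * L) \<le> 0" "1/4 * a * hsymb (2 * k) * gram (2 * K) (2 * k) \<le> 0"
    using a h gram_props(1) by (auto intro!: mult_nonpos_nonneg)
  moreover have "a * a * hsymb (2 * k) * gram (2 * k) (2 * k) = 1/2 * a\<^sup>2 * H"
    using pos by (simp add: gram_def H_def power2_eq_square)
  moreover have "1/16 * hsymb (2 * L) * gram (2 * K) (2 * L) = 0" using pos KL by (simp add: gram_def)
  ultimately have T: "cross_part 1 k k K L \<le> 1/2 * a\<^sup>2 * H"
    unfolding cross_part_eq[OF pos(1,1,2,3)] power_one mult_1 a_def[symmetric] by linarith
  have "a * H \<ge> a * 1" using a H by (intro mult_left_mono_neg) auto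
  then have NT: "norm_part 1 k k K L - cross_part 1 k k K L \<ge> 1/4 * a" using N T by linarith
  have "(\<lambda>x. (- 1 * k * sin (k * x) * cos (L * x) - (- 1 * k * sin (k * x)) * cos (K * x))\<^sup>2) =
      (\<lambda>x. k\<^sup>2 * ((sin (k * x))\<^sup>2 * (cos (K * x) - cos (L * x))\<^sup>2))"
    by (simp add: fun_eq_iff power2_eq_square algebra_simps)
  then have "I01 (\<lambda>x. (- 1 * k * sin (k * x) * cos (L * x) - (- 1 * k * sin (k * x)) * cos (K * x))\<^sup>2)
      = k\<^sup>2 * I01 (\<lambda>x. (sin (k * x))\<^sup>2 * (cos (K * x) - cos (L * x))\<^sup>2)" by simp
  also have "\<dots> \<ge> k\<^sup>2 * (3/8)"
    by (intro mult_left_mono integral_sin_sq_cos_diff_sq f pos KL) auto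
  finally have R: "I01 (\<lambda>x. (- 1 * k * sin (k * x) * cos (L * x) - (- 1 * k * sin (k * x)) * cos (K * x))\<^sup>2)
      \<ge> k\<^sup>2 * (3/8)" .
  have "k\<^sup>2 > 0" using pos by simp
  then show ?thesis
    unfolding unnormalized_sectional_cos_pair[OF s f(1,1,2,3)]
    using NT R by (simp add: a_def power2_eq_square)
qed

text \<open>Both frequencies \<open>K + L\<close> and \<open>K - L\<close> have modulus at least
  \<open>2 * pi\<close>, so each \<open>hsymb\<close> is at least 1/2 and the numerator is at least
  \<open>1/32\<close>. The cosines are orthogonal of square norm 1/2, so the denominator is
  \<open>1/4\<close>.\<close>

lemma sectional_density:
  assumes s: "s > 5/2" and W: "K \<in> wavenumbers" "L \<in> wavenumbers" and KL: "K \<noteq> L"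
  shows "sectional s (\<lambda>x. 0, \<lambda>x. cos (K * x)) (\<lambda>x. 0, \<lambda>x. cos (L * x)) \<ge> 1/8"
proof -
  note g = W[THEN wavenumbers_ge] and f = W[THEN wavenumbers_freqs]
  have pos: "K > 0" "L > 0" using g pi_gt3 by linarith+
  \<comment> \<open>With amplitude 0 the first wavenumber is a dummy; \<open>2 * pi\<close> is
    chosen to be an admissible value.\<close>
  have cp: "(\<lambda>x. 0, \<lambda>x. cos (k * x)) = cos_pair 0 (2 * pi) k" for k by (simp add: cos_pair_def)
  have W1: "2 * pi \<in> wavenumbers" unfolding wavenumbers_def by (auto intro: exI[of _ 1])
  note f1 = wavenumbers_freqs[OF W1]
  have p1: "2 * pi > 0" by simp
  have "gram (2 * K) (2 * L) = 0" using gram_le(2) pos KL by simp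
  then have S: "unnormalized_sectional s (cos_pair 0 (2 * pi) K) (cos_pair 0 (2 * pi) L) =
      1/32 * (hsymb (K + L) + hsymb (K - L))"
    unfolding unnormalized_sectional_cos_pair[OF s f1 f1 f]
      norm_part_eq[OF p1 p1 pos] cross_part_eq[OF p1 p1 pos] by simp
  have m: "metric unit_G (\<lambda>x. 0, \<lambda>x. cos (\<omega> * x)) (\<lambda>x. 0, \<lambda>x. cos (\<eta> * x)) = gram \<omega> \<eta>"
    if "\<omega> \<in> freqs" "\<eta> \<in> freqs" for \<omega> \<eta>
    unfolding metric_unit_G[OF s] using integral_cos_cos[OF that] by simp
  have gr: "gram K K = 1/2" "gram L L = 1/2" "gram K L = 0" using pos KL by (auto simp: gram_def)
  have "\<bar>K + L\<bar> \<ge> 1" "\<bar>K - L\<bar> \<ge> 1"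
    using g pi_gt3 freqs_abs_ge[OF freqs_diff[OF f]] KL by auto
  then have "hsymb (K + L) \<ge> 1/2" "hsymb (K - L) \<ge> 1/2" using hsymb_bounds(3) by blast+
  then show ?thesis
    unfolding sectional_def m[OF f] m[OF f(1,1)] m[OF f(2,2)] gr
    unfolding cp S by (simp add: power2_eq_square)
qed

theorem proposition5p2:
  fixes s :: real
  assumes "s > 5/2"
  shows "(\<forall>k1\<in>wavenumbers. \<forall>k2\<in>wavenumbers. \<forall>l1\<in>wavenumbers. \<forall>l2\<in>wavenumbers. \<forall>u v.
            u = (\<lambda>x. cos (k1 * x), \<lambda>x. cos (k2 * x)) \<and>
            v = (\<lambda>x. cos (l1 * x), \<lambda>x. cos (l2 * x)) \<and> u \<noteq> v \<longrightarrow>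
            unnormalized_sectional s u v > 0) \<and>
         (\<forall>k2\<in>wavenumbers. \<forall>l2\<in>wavenumbers. \<forall>u v.
            u = (\<lambda>x. 0, \<lambda>x. cos (k2 * x)) \<and>
            v = (\<lambda>x. 0, \<lambda>x. cos (l2 * x)) \<and> u \<noteq> v \<longrightarrow>
            sectional s u v \<ge> 1/8)"
proof (intro conjI ballI allI impI)
  fix k1 k2 l1 l2 :: real and u v :: circle_pair
  assume W: "k1 \<in> wavenumbers" "k2 \<in> wavenumbers" "l1 \<in> wavenumbers" "l2 \<in> wavenumbers"
    and uv: "u = (\<lambda>x. cos (k1 * x), \<lambda>x. cos (k2 * x)) \<and> v = (\<lambda>x. cos (l1 * x), \<lambda>x. cos (l2 * x)) \<and> u \<noteq> v"
  have "u = cos_pair 1 k1 k2" "v = cos_pair 1 l1 l2" using uv by (simp_all add: cos_pair_def)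
  moreover have "k1 \<noteq> l1 \<or> k2 \<noteq> l2" using uv by auto
  ultimately show "unnormalized_sectional s u v > 0"
    using unnormalized_sectional_pos_distinct[OF assms W(1,3,2,4)] unnormalized_sectional_pos_equal[OF assms W(1,2,4)]
    by blast
next
  fix k2 l2 :: real and u v :: circle_pair
  assume W: "k2 \<in> wavenumbers" "l2 \<in> wavenumbers"
    and uv: "u = (\<lambda>x. 0, \<lambda>x. cos (k2 * x)) \<and> v = (\<lambda>x. 0, \<lambda>x. cos (l2 * x)) \<and> u \<noteq> v"
  then have "k2 \<noteq> l2" by auto
  then show "sectional s u v \<ge> 1/8" using sectional_density[OF assms W] uv by simp
qed

end
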